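(* Let $q\ge1$ and $p\ge2q$ be integers, $G=U(p,q)$, $\tilde K=U(p)\times SU(q)$. Let $\varphi\in C(G)$ be a $\tilde K$-spherical function, regarded as a continuous function on $C_q\times\mathbb T$ via $\varphi(t,z):=\varphi(a_{t,z})$. Then the product formula for $\varphi$ has the following form on $C_q\times\mathbb T$: for all $s,t\in C_q$ and $z_1,z_2\in\mathbb T$, $$\varphi(t,z_1)\varphi(s,z_2)=\frac1{\kappa_p}\int_{B_q}\int_{SU(q)}\varphi\Bigl(\mathrm{arcosh}\bigl(\sigma_{sing}(\sinh\underline t\,w\,\sinh\underline s+\cosh\underline t\,v\,\cosh\underline s)\bigr),\ z_1z_2\cdot\arg\bigl(\Delta(\sinh\underline t\,w\,\sinh\underline s+\cosh\underline t\,v\,\cosh\underline s)\bigr)\Bigr)\,\Delta(I_q-w^*w)^{p-2q}\,dv\,dw.$$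
   Context: $U(p,q)$ is the group of $(p+q)\times(p+q)$ complex matrices preserving the Hermitian form with matrix $\mathrm{diag}(I_p,-I_q)$; $U(p)\times SU(q)$ is embedded block-diagonally. A $\tilde K$-spherical function is a (nonzero) continuous $\tilde K$-biinvariant function $\varphi$ on $G$ with $\varphi(g)\varphi(h)=\int_{\tilde K}\varphi(gkh)\,dk$ for all $g,h\in G$, $dk$ the normalized Haar measure of $\tilde K$. $\mathbb T=\{z\in\mathbb C:|z|=1\}$, $C_q=\{t\in\mathbb R^q:t_1\ge\dots\ge t_q\ge0\}$, $\cosh\underline t=\mathrm{diag}(\cosh t_1,\dots,\cosh t_q)$, $\sinh\underline t=\mathrm{diag}(\sinh t_1,\dots,\sinh t_q)$. The double coset space $G//\tilde K$ is identified with $C_q\times\mathbb T$ via the representatives $$a_{t,z}=\begin{pmatrix}I_{p-q}&0&0\\0&r_q(z)^{-1}\cosh\underline t&\sinh\underline t\\0&\sinh\underline t&r_q(z)\cosh\underline t\end{pmatrix},\qquad r_q(e^{i\tau})=e^{i\tau/q}\ \text{ for }\tau\in[0,2\pi[.$$ $\Delta$ is the determinant, $\arg z=z/|z|$ for $z\ne0$, $\sigma_{sing}(a)=\sqrt{\mathrm{spec}(a^*a)}$ is the vector of singular values of $a\in M^{q,q}(\mathbb C)$ in decreasing order, arcosh acts componentwise, $B_q=\{w\in M^{q,q}(\mathbb C):w^*w\le I_q\}$, $dw$ is Lebesgue measure, $dv$ is the normalized Haar measure of $SU(q)$, $\kappa_p=\int_{B_q}\Delta(I_q-w^*w)^{p-2q}\,dw$.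 *)

theory Defs
  imports "HOL-Analysis.Analysis" "HOL-Computational_Algebra.Polynomial" "HOL-Library.Multiset"
begin

definition conj_transpose :: "complex^'n^'m \<Rightarrow> complex^'m^'n"
  where "conj_transpose A = transpose (map_matrix cnj A)"

definition unitary_group :: "(complex^'n^'n) set"
  where "unitary_group = {A. conj_transpose A ** A = mat 1}"

definition special_unitary_group :: "(complex^'n^'n) set"
  where "special_unitary_group = {A. conj_transpose A ** A = mat 1 \<and> det A = 1}"

(* Matrices in p + q dimensions are indexed by a sum type, so that the block structure
   (p, q) is carried by the index type: Inl marks the first p indices, Inr the last q. *)

definition signature_form :: "complex^('p::finite+'q::finite)^('p+'q)"
  where "signature_form =
    (\<chi> i j. if i = j then (case i of Inl _ \<Rightarrow> 1 | Inr _ \<Rightarrow> - 1) else 0)"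

definition pseudo_unitary_group :: "(complex^('p::finite+'q::finite)^('p+'q)) set"
  where "pseudo_unitary_group =
    {A. conj_transpose A ** signature_form ** A = signature_form}"

definition block_diag :: "complex^'p^'p \<Rightarrow> complex^'q^'q \<Rightarrow> complex^('p::finite+'q::finite)^('p+'q)"
  where "block_diag u v = (\<chi> i j. case (i, j) of
      (Inl k, Inl l) \<Rightarrow> u $ k $ l
    | (Inr k, Inr l) \<Rightarrow> v $ k $ l
    | _ \<Rightarrow> 0)"

definition K_tilde :: "(complex^('p::finite+'q::finite)^('p+'q)) set"
  where "K_tilde = {block_diag u v | u v. u \<in> unitary_group \<and> v \<in> special_unitary_group}"

(* For a compact matrix group K this is the unique left-invariant Borel probability
   measure on K (regularity is automatic, and so is right-invariance). *)
definition normalized_haar_measure ::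
    "(complex^'n^'n) set \<Rightarrow> (complex^'n^'n) measure \<Rightarrow> bool"
  where "normalized_haar_measure K M \<longleftrightarrow>
    sets M = sets (restrict_space borel K) \<and>
    emeasure M K = 1 \<and>
    (\<forall>g\<in>K. distr M M (\<lambda>h. g ** h) = M)"

(* M is meant to be the normalized Haar measure of K. Only the values of f on G matter. *)
definition spherical_function ::
    "(complex^'n^'n) set \<Rightarrow> (complex^'n^'n) set \<Rightarrow> (complex^'n^'n) measure \<Rightarrow>
     (complex^'n^'n \<Rightarrow> complex) \<Rightarrow> bool"
  where "spherical_function G K M f \<longleftrightarrow>
    continuous_on G f \<and>
    (\<exists>g\<in>G. f g \<noteq> 0) \<and>
    (\<forall>g\<in>G. \<forall>k\<in>K. \<forall>k'\<in>K. f (k ** g ** k') = f g) \<and>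
    (\<forall>g\<in>G. \<forall>h\<in>G. f g * f h = (LINT k|M. f (g ** k ** h)))"

(* A linear order on the finite index type 'q fixes the enumeration 1, ..., q of indices. *)
definition chamber :: "(real^'q::{finite,linorder}) set"
  where "chamber = {t. (\<forall>i j. i \<le> j \<longrightarrow> t $ j \<le> t $ i) \<and> (\<forall>i. 0 \<le> t $ i)}"

definition diag_matrix :: "real^'q \<Rightarrow> complex^'q^'q"
  where "diag_matrix d = (\<chi> i j. if i = j then of_real (d $ i) else 0)"

definition cosh_diag :: "real^'q \<Rightarrow> complex^'q^'q"
  where "cosh_diag t = diag_matrix (\<chi> i. cosh (t $ i))"

definition sinh_diag :: "real^'q \<Rightarrow> complex^'q^'q"
  where "sinh_diag t = diag_matrix (\<chi> i. sinh (t $ i))"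

(* Arg2pi takes values in [0, 2 pi). *)
definition root_branch :: "nat \<Rightarrow> complex \<Rightarrow> complex"
  where "root_branch q z = cis (Arg2pi z / real q)"

(* Here p = CARD('m) + CARD('q), i.e. 'm indexes the block of size p - q. *)
definition coset_rep :: "real^'q \<Rightarrow> complex \<Rightarrow> complex^((('m::finite)+('q::finite))+'q)^(('m+'q)+'q)"
  where "coset_rep t z = (\<chi> i j. case (i, j) of
      (Inl (Inl k), Inl (Inl l)) \<Rightarrow> (if k = l then 1 else 0)
    | (Inl (Inr k), Inl (Inr l)) \<Rightarrow> inverse (root_branch CARD('q) z) * cosh_diag t $ k $ l
    | (Inl (Inr k), Inr l) \<Rightarrow> sinh_diag t $ k $ l
    | (Inr k, Inl (Inr l)) \<Rightarrow> sinh_diag t $ k $ l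
    | (Inr k, Inr l) \<Rightarrow> root_branch CARD('q) z * cosh_diag t $ k $ l
    | _ \<Rightarrow> 0)"

definition char_polynomial :: "complex^'n^'n \<Rightarrow> complex poly"
  where "char_polynomial A = det (mat [:0, 1:] - map_matrix (\<lambda>c. [:c:]) A)"

(* eigenvalues with algebraic multiplicity *)
definition spec :: "complex^'n^'n \<Rightarrow> complex multiset"
  where "spec A = proots (char_polynomial A)"

(* The eigenvalues of a* a are real and nonnegative, so Re loses nothing. The descending
   list has length CARD('q), and card {..<i} is the position of i, counted from 0. *)
definition sigma_sing :: "complex^'q::{finite,linorder}^'q::{finite,linorder} \<Rightarrow> real^'q::{finite,linorder}"
  where "sigma_sing a = (\<chi> i.
    rev (sorted_list_of_multiset
      (image_mset (\<lambda>x. sqrt (Re x)) (spec (conj_transpose a ** a)))) ! card {..<i})"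

definition arcosh_vec :: "real^'q \<Rightarrow> real^'q"
  where "arcosh_vec x = (\<chi> i. arcosh (x $ i))"

definition pos_semidef :: "complex^'n^'n \<Rightarrow> bool"
  where "pos_semidef A \<longleftrightarrow>
    conj_transpose A = A \<and> (\<forall>x. 0 \<le> Re (\<Sum>i\<in>UNIV. cnj (x $ i) * (A *v x) $ i))"

definition matrix_ball :: "(complex^'q^'q) set"
  where "matrix_ball = {w. pos_semidef (mat 1 - conj_transpose w ** w)}"

(* Lebesgue measure on q x q complex matrices comes from their euclidean_space structure.
   The integrand is real and nonnegative on the ball. The type argument supplies q. *)
definition kappa :: "'q::finite itself \<Rightarrow> nat \<Rightarrow> complex"
  where "kappa _ p =
    (LINT w:(matrix_ball :: (complex^'q^'q) set)|lborel.
      det (mat 1 - conj_transpose w ** w) ^ (p - 2 * CARD('q)))"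

end

theory Submission
  imports Defs
begin

text \<open>
  Write \<open>\<phi> (a) \<phi> (b)\<close> as the integral of \<open>\<phi> (a k b)\<close> over \<open>k = diag (u, v)\<close> in \<open>U(p) \<times> SU(q)\<close>. The
  double coset of an element of \<open>U(p, q)\<close> depends only on its lower right \<open>q \<times> q\<close> block, whose singular
  values and determinant give the representative. For \<open>a k b\<close> this block is, after a rotation of \<open>u\<close> by
  a scalar of modulus one, \<open>sinh t w sinh s + cosh t v cosh s\<close> up to a phase, where \<open>w\<close> is the lower right
  block of \<open>u\<close>. So it remains to see that \<open>w\<close> and \<open>v\<close> are independent, that \<open>v\<close> is Haar distributed and that
  \<open>w\<close> has a density proportional to \<open>det (1 - w* w) ^ (p - 2 q)\<close> on the ball.

  The density comes from Lebesgue measure on \<open>p \<times> q\<close> matrices \<open>Z\<close> with blocks \<open>Y\<close> and \<open>y\<close>: by invariance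
  under \<open>U(p)\<close> the matrix \<open>y (Z* Z)^(-1/2)\<close> is distributed like \<open>w\<close> and independent of \<open>S = Z* Z\<close>, while
  \<open>Y* Y = S - y* y\<close> has density \<open>det ^ (p - 2 q)\<close> with respect to Lebesgue measure on Hermitian matrices.
  The latter fact holds because relatively invariant measures on the cone of positive definite matrices
  are unique up to a factor. All normalising constants are recovered from the total mass at the end.
\<close>

section \<open>Complex matrices\<close>

text \<open>The phase rotation uses that all of U(p) is available: in the corner of
  \<open>a k b\<close> the cosh term picks up the roots of \<open>z1\<close> and \<open>z2\<close>
  from the two representatives, the sinh term picks up none, and replacing \<open>u\<close> by
  diag(1, r1 r2) \<open>u\<close> gives it the same phase. The condition p >= 2q enters as q <= p -
  q: it makes the Gram matrix of the (p - q) x q block \<open>Y\<close> nonsingular almost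
  everywhere and leaves room to complete every contraction to a unitary matrix. The exponent p - 2q
  is (p - q) - q, the difference between the degrees of relative invariance of Gram matrices and of
  Lebesgue measure on Hermitian matrices. The Haar measure of U(p) occurs only as the law of the
  block \<open>u\<close> under the given measure of the product group; independence of
  \<open>w\<close> and \<open>v\<close> comes from averaging over translations by SU(q). Since the
  root has a discontinuous branch, continuity of the integrand in (w, v) cannot be read off the
  formula. It descends from the compact group, where the integrand is a translate of the spherical
  function.\<close>

abbreviation ct :: "complex^'n^'m \<Rightarrow> complex^'m^'n"
  where "ct A \<equiv> conj_transpose A"

definition cinner :: "complex^'n \<Rightarrow> complex^'n \<Rightarrow> complex"
  where "cinner x y = (\<Sum>i\<in>UNIV. cnj (x $ i) * y $ i)"

lemma ct_nth [simp]: "ct A $ i $ j = cnj (A $ j $ i)"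
  by (simp add: conj_transpose_def transpose_def)

lemma if_times: "(if b then x else y) * z = (if b then x * z else y * z)"
  and times_if: "z * (if b then x else y) = (if b then z * x else z * y)"
  by simp_all

lemma matrix_mult_nth: "(A ** B) $ i $ j = (\<Sum>k\<in>UNIV. A $ i $ k * B $ k $ j)"
  by (simp add: matrix_matrix_mult_def)

lemma matrix_vector_mult_nth: "(A *v x) $ i = (\<Sum>k\<in>UNIV. A $ i $ k * x $ k)"
  by (simp add: matrix_vector_mult_def)

lemma mat_nth: "mat c $ i $ j = (if i = j then c else 0)"
  by (simp add: mat_def)

lemma ct_ct [simp]: "ct (ct A) = A"
  by (simp add: vec_eq_iff)

lemma ct_mult: "ct (A ** B) = ct B ** ct A"
  by (simp add: vec_eq_iff matrix_mult_nth mult.commute)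

lemma ct_mat [simp]: "ct (mat c) = mat (cnj c)"
  by (auto simp: vec_eq_iff mat_nth)

lemma ct_add: "ct (A + B) = ct A + ct B"
  and ct_diff: "ct (A - B) = ct A - ct B"
  and ct_minus: "ct (- A) = - ct A"
  and ct_scaleR: "ct (r *\<^sub>R A) = r *\<^sub>R ct A"
  and ct_0 [simp]: "ct 0 = 0"
  by (simp_all add: vec_eq_iff)

lemma det_ct: "det (ct A) = cnj (det A)"
proof -
  have "det (map_matrix cnj A) = cnj (det A)"
    by (simp add: det_def)
  then show ?thesis
    by (simp add: conj_transpose_def)
qed

lemma det_mat: "det (mat c :: 'a::comm_ring_1^'n^'n) = c ^ CARD('n)"
  by (subst det_diagonal) (auto simp: mat_nth)

lemma mat_mult_nth: "(mat c ** A) $ i $ j = c * A $ i $ j"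
  by (simp add: matrix_mult_nth mat_nth if_times cong: if_cong)

lemma mult_mat_nth: "(A ** mat c) $ i $ j = A $ i $ j * (c :: 'a::comm_semiring_1)"
  by (simp add: matrix_mult_nth mat_nth times_if cong: if_cong)

lemma mat_commute: "mat c ** A = A ** mat (c :: 'a::comm_semiring_1)"
  by (simp add: vec_eq_iff mat_mult_nth mult_mat_nth mult.commute)

lemma mat_mult_mat: "mat c ** mat d = mat (c * d :: 'a::comm_semiring_1)"
  by (simp add: vec_eq_iff mat_mult_nth mat_nth)

lemma matrix_mult_diff_left: "(A - B) ** C = A ** C - B ** (C :: 'a::ring_1^'n^'m)"
  and matrix_mult_diff_right: "D ** (A - B) = D ** A - D ** (B :: 'a::ring_1^'m^'l)"
  by (simp_all add: vec_eq_iff matrix_mult_nth algebra_simps sum_subtractf)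

lemma matrix_mult_add_left: "(A + B) ** C = A ** C + B ** (C :: 'a::ring_1^'n^'m)"
  and matrix_mult_add_right: "D ** (A + B) = D ** A + D ** (B :: 'a::ring_1^'m^'l)"
  by (simp_all add: vec_eq_iff matrix_mult_nth algebra_simps sum.distrib)

lemma matrix_mult_minus_left: "(- A) ** C = - (A ** (C :: 'a::ring_1^'n^'m))"
  and matrix_mult_minus_right: "D ** (- B) = - (D ** (B :: 'a::ring_1^'m^'l))"
  by (simp_all add: vec_eq_iff matrix_mult_nth sum_negf)

lemma matrix_mult_0 [simp]: "0 ** A = (0 :: 'a::semiring_1^'n^'m)" "B ** 0 = (0 :: 'a::semiring_1^'k^'l)"
  by (simp_all add: vec_eq_iff matrix_mult_nth)

lemma matrix_mult_scaleR_left: "(r *\<^sub>R A) ** C = r *\<^sub>R (A ** (C :: complex^'n^'m))"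
  and matrix_mult_scaleR_right: "D ** (r *\<^sub>R B) = r *\<^sub>R (D ** (B :: complex^'k^'l))"
  by (simp_all add: vec_eq_iff matrix_mult_nth scaleR_sum_right)

lemma matrix_inv_mult:
  fixes A :: "complex^'n^'n"
  assumes "det A \<noteq> 0"
  shows matrix_inv_left: "matrix_inv A ** A = mat 1"
    and matrix_inv_right: "A ** matrix_inv A = mat 1"
proof -
  have "\<exists>A'. A ** A' = mat 1 \<and> A' ** A = mat 1"
    using assms invertible_det_nz[of A] by (simp add: invertible_def)
  then have "A ** matrix_inv A = mat 1 \<and> matrix_inv A ** A = mat 1"
    unfolding matrix_inv_def by (rule someI_ex)
  then show "matrix_inv A ** A = mat 1" "A ** matrix_inv A = mat 1"
    by auto
qed

lemma det_matrix_inv: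
  fixes A :: "complex^'n^'n"
  assumes "det A \<noteq> 0"
  shows "det (matrix_inv A) = inverse (det A)"
  using assms by (metis det_I det_mul inverse_unique matrix_inv_right)

lemma unitary_iff: "U \<in> unitary_group \<longleftrightarrow> ct U ** U = mat 1"
  by (simp add: unitary_group_def)

lemma unitary_iff': "U \<in> unitary_group \<longleftrightarrow> U ** ct U = mat 1"
  unfolding unitary_iff using matrix_left_right_inverse by blast

lemma unitary_cancel [simp]:
  assumes "U \<in> unitary_group"
  shows "ct U ** U = mat 1" "U ** ct U = mat 1"
    "ct U ** (U ** X) = X" "U ** (ct U ** X) = X"
    "Y ** ct U ** U = Y" "Y ** U ** ct U = Y"
  using assms unitary_iff[of U] unitary_iff'[of U]
  by (auto simp: matrix_mul_assoc) (auto simp flip: matrix_mul_assoc)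

lemma unitary_mult: "U \<in> unitary_group \<Longrightarrow> V \<in> unitary_group \<Longrightarrow> U ** V \<in> unitary_group"
  unfolding unitary_iff by (metis ct_mult matrix_mul_assoc matrix_mul_lid)

lemma unitary_ct: "U \<in> unitary_group \<Longrightarrow> ct U \<in> unitary_group"
  using unitary_iff' unitary_iff by (metis ct_ct)

lemma unitary_1 [simp]: "mat 1 \<in> unitary_group"
  by (simp add: unitary_iff)

lemma unitary_mat: "cmod c = 1 \<Longrightarrow> mat c \<in> unitary_group"
  by (simp add: unitary_iff mat_mult_mat complex_norm_square[symmetric] mult.commute)

lemma norm_det_unitary: "U \<in> unitary_group \<Longrightarrow> cmod (det U) = 1"
proof -
  assume "U \<in> unitary_group"
  then have "det (ct U) * det U = 1"
    by (metis det_I det_mul unitary_iff)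
  then have "complex_of_real ((cmod (det U))\<^sup>2) = 1"
    by (metis det_ct complex_norm_square mult.commute)
  then show ?thesis
    by (metis norm_ge_zero of_real_eq_1_iff power2_eq_1_iff neg_0_le_iff_le not_one_le_zero)
qed

section \<open>The Hermitian inner product and positive semidefinite matrices\<close>

lemma cinner_mult_left: "cinner (A *v x) y = cinner x (ct A *v y)"
proof -
  have "cinner (A *v x) y = (\<Sum>i\<in>UNIV. \<Sum>j\<in>UNIV. cnj (A $ i $ j) * cnj (x $ j) * y $ i)"
    by (simp add: cinner_def matrix_vector_mult_nth sum_distrib_right)
  also have "\<dots> = (\<Sum>j\<in>UNIV. \<Sum>i\<in>UNIV. cnj (A $ i $ j) * cnj (x $ j) * y $ i)"
    by (rule sum.swap)
  also have "\<dots> = cinner x (ct A *v y)"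
    by (simp add: cinner_def matrix_vector_mult_nth sum_distrib_left mult_ac)
  finally show ?thesis .
qed

lemma cinner_mult_right: "cinner x (A *v y) = cinner (ct A *v x) y"
  by (simp add: cinner_mult_left)

lemma cinner_self: "cinner x x = complex_of_real ((norm x)\<^sup>2)"
  by (simp add: cinner_def norm_vec_def L2_set_def sum_nonneg flip: of_real_power)
    (simp add: complex_norm_square mult.commute del: of_real_power)

lemma cnj_cinner: "cnj (cinner x y) = cinner y x"
  by (simp add: cinner_def mult.commute)

lemma cinner_add_left: "cinner (x + y) z = cinner x z + cinner y z"
  and cinner_add_right: "cinner x (y + z) = cinner x y + cinner x z"
  and cinner_diff_left: "cinner (x - y) z = cinner x z - cinner y z"
  and cinner_diff_right: "cinner x (y - z) = cinner x y - cinner x z"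
  and cinner_smult_left: "cinner (c *s x) z = cnj c * cinner x z"
  and cinner_smult_right: "cinner x (c *s z) = c * cinner x z"
  and cinner_scaleR_right: "cinner x (r *\<^sub>R z) = r *\<^sub>R cinner x z"
  and cinner_scaleR_left: "cinner (r *\<^sub>R x) z = r *\<^sub>R cinner x z"
  and cinner_0_left [simp]: "cinner 0 x = 0"
  and cinner_0_right [simp]: "cinner x 0 = 0"
  by (simp_all add: cinner_def algebra_simps sum.distrib sum_subtractf sum_distrib_left scaleR_sum_right)

lemma cinner_axis_left: "cinner (axis i c) x = cnj c * x $ i"
  by (simp add: cinner_def axis_def if_distrib[of cnj] if_times cong: if_cong)

lemma matrix_vector_axis_nth: "(A *v axis j c) $ i = A $ i $ j * (c::complex)"
  by (simp add: matrix_vector_mult_nth axis_def times_if cong: if_cong)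

lemma matrix_vector_scaleR: "A *v (r *\<^sub>R x) = r *\<^sub>R (A *v (x :: complex^'n))"
  by (simp add: vec_eq_iff matrix_vector_mult_nth scaleR_sum_right)

lemma cinner_eq_0_all: "(\<And>x. cinner x y = 0) \<Longrightarrow> y = 0"
  using cinner_self[of y] by simp

text \<open>Polarization: \<open>x + y\<close> yields the sum and \<open>x + \<i> *s y\<close> the
  difference of the two cross terms, so both vanish.\<close>

lemma cinner_quadratic_eq_0:
  fixes A :: "complex^'n^'n"
  assumes "\<And>x. cinner x (A *v x) = 0"
  shows "A = 0"
proof -
  have *: "cinner x (A *v y) = 0" for x y
  proof -
    have 1: "cinner x (A *v y) + cinner y (A *v x) = 0"
      using assms[of "x + y"] assms[of x] assms[of y]
      by (simp add: cinner_add_left cinner_add_right matrix_vector_right_distrib add.commute)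
    have "cinner x (A *v (\<i> *s y)) + cinner (\<i> *s y) (A *v x) = 0"
      using assms[of "x + \<i> *s y"] assms[of x] assms[of "\<i> *s y"]
      by (simp add: cinner_add_left cinner_add_right matrix_vector_right_distrib add.commute)
    moreover have "A *v (\<i> *s y) = \<i> *s (A *v y)"
      by (simp add: vec_eq_iff matrix_vector_mult_nth sum_distrib_left mult_ac)
    ultimately have "\<i> * (cinner x (A *v y) - cinner y (A *v x)) = 0"
      by (simp add: cinner_smult_left cinner_smult_right algebra_simps)
    then show ?thesis using 1 by simp
  qed
  have "A *v y = 0" for y
    by (rule cinner_eq_0_all) (rule *)
  then show ?thesis
    by (simp add: matrix_eq)
qed

lemma pos_semidef_iff:
  "pos_semidef A \<longleftrightarrow> ct A = A \<and> (\<forall>x. 0 \<le> Re (cinner x (A *v x)))"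
  by (simp add: pos_semidef_def cinner_def)

lemma Im_cinner_hermitian:
  assumes "ct A = A"
  shows "Im (cinner x (A *v x)) = 0"
proof -
  have "cnj (cinner x (A *v x)) = cinner x (A *v x)"
    by (metis cnj_cinner cinner_mult_right assms)
  then show ?thesis by (metis complex_cnj equal_neg_zero complex.sel(2) complex_surj)
qed

text \<open>A form with real values agrees with the form of the adjoint, so polarization forces
  \<open>A\<close> to be Hermitian.\<close>

lemma pos_semidefI:
  fixes A :: "complex^'n^'n"
  assumes "\<And>x. Im (cinner x (A *v x)) = 0" "\<And>x. 0 \<le> Re (cinner x (A *v x))"
  shows "pos_semidef A"
proof -
  have "cinner x ((ct A - A) *v x) = 0" for x
  proof -
    have "cinner x (ct A *v x) = cnj (cinner x (A *v x))"
      by (simp add: cinner_mult_right cnj_cinner)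
    also have "\<dots> = cinner x (A *v x)"
      using assms(1)[of x] by (simp add: complex_eq_iff)
    finally show ?thesis
      by (simp add: matrix_vector_mult_diff_rdistrib cinner_diff_right)
  qed
  then have "ct A - A = 0"
    by (rule cinner_quadratic_eq_0)
  then show ?thesis
    using assms(2) by (simp add: pos_semidef_iff)
qed

lemma cinner_gram: "cinner x ((ct A ** A) *v x) = complex_of_real ((norm (A *v x))\<^sup>2)"
  by (metis cinner_mult_right cinner_self ct_ct matrix_vector_mul_assoc)

lemma pos_semidef_gram: "pos_semidef (ct A ** A)"
  by (simp add: pos_semidef_iff ct_mult cinner_gram)

lemma pos_semidef_conj: "pos_semidef A \<Longrightarrow> pos_semidef (ct B ** A ** B)"
  unfolding pos_semidef_iff
  by (auto simp: ct_mult matrix_mul_assoc cinner_mult_right simp flip: matrix_vector_mul_assoc)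
    (metis cinner_mult_left ct_ct)

text \<open>Evaluate the form at \<open>x - t A x\<close> for small \<open>t\<close>.\<close>
lemma pos_semidef_kernel:
  assumes A: "pos_semidef A" and 0: "Re (cinner x (A *v x)) = 0"
  shows "A *v x = 0"
proof -
  define y where "y = A *v x"
  have herm: "ct A = A" using A by (simp add: pos_semidef_iff)
  have ineq: "0 \<le> - 2 * t * (norm y)\<^sup>2 + t\<^sup>2 * Re (cinner y (A *v y))" for t :: real
  proof -
    have "0 \<le> Re (cinner (x - t *\<^sub>R y) (A *v (x - t *\<^sub>R y)))"
      using A by (simp add: pos_semidef_iff)
    also have "\<dots> = Re (cinner x (A *v x)) - t * Re (cinner x (A *v y)) - t * Re (cinner y y) + t\<^sup>2 * Re (cinner y (A *v y))"
      by (simp add: algebra_simps matrix_vector_scaleR cinner_diff_left cinner_diff_right cinner_scaleR_left cinner_scaleR_right y_def power2_eq_square)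
    also have "cinner x (A *v y) = cinner y y"
      by (simp add: cinner_mult_right herm y_def)
    finally show ?thesis
      by (simp add: 0 cinner_self)
  qed
  have "norm y = 0"
  proof (rule ccontr)
    assume "norm y \<noteq> 0"
    then have N: "(norm y)\<^sup>2 > 0" by simp
    define c where "c = Re (cinner y (A *v y))"
    have c: "c \<ge> 0" using A by (simp add: c_def pos_semidef_iff)
    \<comment> \<open>This \<open>t\<close> makes the quadratic term at most half of the linear one,
      so the value becomes negative; adding 1 covers \<open>c = 0\<close>.\<close>
    define t where "t = (norm y)\<^sup>2 / (c + 1)"
    have t: "t > 0" using N c by (simp add: t_def)
    have "t * c \<le> (norm y)\<^sup>2"
      using c N by (simp add: t_def divide_simps)
    then have "t * (t * c) \<le> t * (norm y)\<^sup>2"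
      using t by (intro mult_left_mono) auto
    then have "- 2 * t * (norm y)\<^sup>2 + t\<^sup>2 * c < 0"
      using mult_pos_pos[OF t N] by (simp add: power2_eq_square algebra_simps)
    then show False using ineq[of t] by (simp add: c_def)
  qed
  then show ?thesis by (simp add: y_def)
qed

lemma det_eq_0_iff_kernel: "det (A :: complex^'n^'n) = 0 \<longleftrightarrow> (\<exists>x. x \<noteq> 0 \<and> A *v x = 0)"
  by (metis invertible_det_nz invertible_left_inverse matrix_left_invertible_ker matrix_vector_mult_0_right)

lemma pos_semidef_det_nz_iff:
  assumes "ct A = A"
  shows "pos_semidef A \<and> det A \<noteq> 0 \<longleftrightarrow> (\<forall>x. x \<noteq> 0 \<longrightarrow> 0 < Re (cinner x (A *v x)))"
proof
  assume "pos_semidef A \<and> det A \<noteq> 0"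
  then show "\<forall>x. x \<noteq> 0 \<longrightarrow> 0 < Re (cinner x (A *v x))"
    by (metis det_eq_0_iff_kernel less_eq_real_def pos_semidef_iff pos_semidef_kernel)
next
  assume *: "\<forall>x. x \<noteq> 0 \<longrightarrow> 0 < Re (cinner x (A *v x))"
  then have "\<forall>x. 0 \<le> Re (cinner x (A *v x))"
    by (metis less_eq_real_def cinner_0_left complex.sel(1) zero_complex.code)
  moreover have "det A \<noteq> 0"
    using * by (auto simp: det_eq_0_iff_kernel)
  ultimately show "pos_semidef A \<and> det A \<noteq> 0"
    using assms by (simp add: pos_semidef_iff)
qed

text \<open>The difference \<open>D\<close> satisfies \<open>R D + D T = 0\<close>. Multiplying by
  \<open>D\<close> and taking traces gives two sums of nonnegative terms with total zero, so
  \<open>R D = T D = 0\<close> and hence \<open>D D = 0\<close>.\<close>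

lemma pos_semidef_sq_unique:
  fixes R T :: "complex^'n^'n"
  assumes R: "pos_semidef R" and T: "pos_semidef T" and eq: "R ** R = T ** T"
  shows "R = T"
proof -
  define D where "D = R - T"
  have herm: "ct R = R" "ct T = T" "ct D = D"
    using R T by (auto simp: pos_semidef_iff D_def ct_diff)
  have *: "D *v x = 0" for x
  proof -
    have 1: "R ** D + D ** T = 0"
      by (simp add: D_def matrix_mult_diff_left matrix_mult_diff_right eq)
    have D0: "R *v (D *v x) = 0" "T *v (D *v x) = 0" for x
    proof -
      have nn: "0 \<le> Re (cinner (D *v x) (R *v (D *v x)))" for x
        using R by (simp add: pos_semidef_iff)
      have nn': "0 \<le> Re (cinner (D *v x) (T *v (D *v x)))" for x
        using T by (simp add: pos_semidef_iff)
      have tr: "D ** R ** D + D ** D ** T = 0"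
        using 1 by (metis matrix_mul_assoc matrix_mult_add_right matrix_mult_0(2))
      have tr0: "trace (D ** R ** D) + trace (D ** T ** D) = 0"
      proof -
        have "trace (D ** T ** D) = trace (D ** (D ** T))"
          using trace_mul_sym[of "D ** T" D] by simp
        then show ?thesis
          using arg_cong[OF tr, of trace] by (simp add: trace_add matrix_mul_assoc) (simp add: trace_def)
      qed
      have diag: "Re ((D ** X ** D) $ i $ i) = Re (cinner (D *v axis i 1) (X *v (D *v axis i 1)))" for X :: "complex^'n^'n" and i
      proof -
        have "cinner (D *v axis i 1) (X *v (D *v axis i 1)) = cinner (axis i 1) ((D ** X ** D) *v axis i 1)"
          by (simp add: cinner_mult_left herm matrix_vector_mul_assoc matrix_mul_assoc)
        also have "\<dots> = (D ** X ** D) $ i $ i"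
          by (simp add: cinner_axis_left matrix_vector_axis_nth)
        finally show ?thesis by simp
      qed
      have "(\<Sum>i\<in>UNIV. Re ((D ** R ** D) $ i $ i) + Re ((D ** T ** D) $ i $ i)) = 0"
        using arg_cong[OF tr0, of Re] by (simp add: trace_def sum.distrib)
      then have "\<forall>i\<in>UNIV. Re ((D ** R ** D) $ i $ i) + Re ((D ** T ** D) $ i $ i) = 0"
        by (subst (asm) sum_nonneg_eq_0_iff) (use nn nn' in \<open>simp_all add: diag\<close>)
      then have "Re (cinner (D *v axis i 1) (R *v (D *v axis i 1))) = 0 \<and> Re (cinner (D *v axis i 1) (T *v (D *v axis i 1))) = 0" for i
        using nn[of "axis i 1"] nn'[of "axis i 1"] by (simp add: diag) (smt (verit))
      then have ax: "R *v (D *v axis i 1) = 0" "T *v (D *v axis i 1) = 0" for i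
        using pos_semidef_kernel R T by blast+
      have "(R ** D) $ j $ i = 0" "(T ** D) $ j $ i = 0" for i j
        using ax[of i] by (metis matrix_vector_axis_nth matrix_vector_mul_assoc mult.right_neutral zero_index)+
      then have "R ** D = 0" "T ** D = 0" by (simp_all add: vec_eq_iff)
      then show "R *v (D *v x) = 0" "T *v (D *v x) = 0"
        by (simp_all add: matrix_vector_mul_assoc)
    qed
    have "D *v (D *v x) = 0"
      using D0[of x] by (simp add: D_def matrix_vector_mult_diff_rdistrib)
    then have "cinner (D *v x) (D *v x) = 0"
      by (simp add: cinner_mult_left herm)
    then show ?thesis by (simp add: cinner_self)
  qed
  then have "D = 0" by (simp add: matrix_eq)
  then show ?thesis by (simp add: D_def)
qed

section \<open>Polar and singular value decompositions\<close>

lemma continuous_on_matrix_mult [continuous_intros]: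
  fixes f :: "'a::topological_space \<Rightarrow> complex^'n^'m"
  shows "continuous_on S f \<Longrightarrow> continuous_on S g \<Longrightarrow> continuous_on S (\<lambda>x. f x ** g x)"
  unfolding matrix_matrix_mult_def by (intro continuous_intros)

lemma continuous_on_ct [continuous_intros]:
  fixes f :: "'a::topological_space \<Rightarrow> complex^'n^'m"
  shows "continuous_on S f \<Longrightarrow> continuous_on S (\<lambda>x. ct (f x))"
  unfolding conj_transpose_def transpose_def map_matrix_def
  by (simp, intro continuous_intros)

lemma continuous_on_det [continuous_intros]:
  fixes f :: "'a::topological_space \<Rightarrow> complex^'n^'n"
  shows "continuous_on S f \<Longrightarrow> continuous_on S (\<lambda>x. det (f x))"
  unfolding det_def by (intro continuous_intros)

lemma continuous_on_trace [continuous_intros]: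
  fixes f :: "'a::topological_space \<Rightarrow> complex^'n^'n"
  shows "continuous_on S f \<Longrightarrow> continuous_on S (\<lambda>x. trace (f x))"
  unfolding trace_def by (intro continuous_intros)

lemma norm_matrix_sq: "(norm A)\<^sup>2 = (\<Sum>i\<in>UNIV. \<Sum>j\<in>UNIV. (cmod (A $ i $ j))\<^sup>2)"
  by (simp add: norm_vec_def L2_set_def sum_nonneg)

lemma norm_sq_trace: "complex_of_real ((norm A)\<^sup>2) = trace (ct A ** A)"
  unfolding norm_matrix_sq trace_def matrix_mult_nth
  by (subst sum.swap) (simp add: complex_norm_square mult.commute del: of_real_power)

lemma norm_ct [simp]: "norm (ct A) = norm A"
proof -
  have "(norm (ct A))\<^sup>2 = (norm A)\<^sup>2"
    unfolding norm_matrix_sq by (subst sum.swap) simp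
  then show ?thesis by simp
qed

lemma norm_unitary_left [simp]: "U \<in> unitary_group \<Longrightarrow> norm (U ** A) = norm A"
proof -
  assume U: "U \<in> unitary_group"
  have "complex_of_real ((norm (U ** A))\<^sup>2) = complex_of_real ((norm A)\<^sup>2)"
    unfolding norm_sq_trace ct_mult using U by (simp flip: matrix_mul_assoc)
  then show ?thesis by (simp only: of_real_eq_iff) simp
qed

lemma norm_unitary_right [simp]: "U \<in> unitary_group \<Longrightarrow> norm (A ** U) = norm A"
  by (metis ct_mult norm_ct norm_unitary_left unitary_ct)

lemma norm_unitary: "U \<in> unitary_group \<Longrightarrow> norm (U :: complex^'n^'n) = norm (mat 1 :: complex^'n^'n)"
  by (metis matrix_mul_rid norm_unitary_left)

lemma closed_unitary: "closed (unitary_group :: (complex^'n^'n) set)"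
  unfolding unitary_group_def by (intro closed_Collect_eq continuous_intros)

lemma compact_unitary: "compact (unitary_group :: (complex^'n^'n) set)"
  unfolding compact_eq_bounded_closed using closed_unitary norm_unitary
  by (metis bounded_iff order_refl)

lemma closed_special_unitary: "closed (special_unitary_group :: (complex^'n^'n) set)"
  unfolding special_unitary_group_def
  by (intro closed_Collect_conj closed_Collect_eq continuous_intros)

lemma special_unitary_iff: "U \<in> special_unitary_group \<longleftrightarrow> U \<in> unitary_group \<and> det U = 1"
  by (simp add: unitary_group_def special_unitary_group_def del: unitary_cancel)

lemma compact_special_unitary: "compact (special_unitary_group :: (complex^'n^'n) set)"
proof -
  have "special_unitary_group \<subseteq> (unitary_group :: (complex^'n^'n) set)"
    by (auto simp: special_unitary_iff)
  then show ?thesis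
    using bounded_subset closed_special_unitary compact_eq_bounded_closed compact_unitary by metis
qed

text \<open>The competitors are \<open>1 + (e - 1) x x*\<close> for a unit vector \<open>x\<close>:
  they are unitary when \<open>e\<close> has modulus 1 and change the trace by
  \<open>(e - 1) * a\<close>, where \<open>a\<close> is the value of the form at \<open>x\<close>.
  Choosing \<open>e\<close> with \<open>e * a = cmod a\<close> gives
  \<open>cmod a \<le> Re a\<close>, so \<open>a\<close> is real and nonnegative.\<close>

lemma pos_semidef_of_trace_max:
  fixes N :: "complex^'n^'n"
  assumes max: "\<And>X. X \<in> unitary_group \<Longrightarrow> Re (trace (X ** N)) \<le> Re (trace N)"
  shows "pos_semidef N"
proof -
  have *: "Im (cinner x (N *v x)) = 0 \<and> 0 \<le> Re (cinner x (N *v x))" if x: "norm x = 1" for x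
  proof -
    define a where "a = cinner x (N *v x)"
    show ?thesis
    proof (cases "a = 0")
      case True
      then show ?thesis by (simp add: a_def)
    next
      case False
      define e where "e = cnj a / cmod a"
      have e: "cmod e = 1" "e * a = cmod a"
        using False by (auto simp: e_def norm_divide complex_norm_square[symmetric] mult.commute power2_eq_square field_simps)
      define X :: "complex^'n^'n" where "X = mat 1 + (\<chi> i j. (e - 1) * x $ i * cnj (x $ j))"
      have x1: "(\<Sum>k\<in>UNIV. x $ k * cnj (x $ k)) = 1"
        using cinner_self[of x] x by (simp add: cinner_def mult.commute)
      have e1: "cnj (e - 1) + (e - 1) + cnj (e - 1) * (e - 1) = 0"
      proof -
        have "cnj e * e = 1"
          using e(1) by (simp add: mult.commute flip: complex_norm_square)
        then show ?thesis by (simp add: algebra_simps)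
      qed
      define Y :: "complex^'n^'n" where "Y = (\<chi> i j. x $ i * cnj (x $ j))"
      have Y: "ct Y = Y" "Y ** Y = Y"
      proof -
        have "(Y ** Y) $ i $ j = x $ i * cnj (x $ j) * (\<Sum>k\<in>UNIV. x $ k * cnj (x $ k))" for i j
          by (simp add: Y_def matrix_mult_nth sum_distrib_left mult_ac)
        then show "Y ** Y = Y" by (simp add: vec_eq_iff x1) (simp add: Y_def)
      qed (simp add: Y_def vec_eq_iff)
      have X: "X = mat 1 + mat (e - 1) ** Y"
        by (simp add: X_def Y_def vec_eq_iff mat_mult_nth mult_ac)
      have "ct X ** X = mat 1 + mat (cnj (e - 1) + (e - 1) + cnj (e - 1) * (e - 1)) ** Y"
      proof -
        have "ct X ** X = mat 1 + mat (cnj (e - 1)) ** Y + mat (e - 1) ** Y + (mat (cnj (e - 1)) ** Y) ** (mat (e - 1) ** Y)"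
          by (simp add: X ct_add ct_mult Y matrix_mult_add_left matrix_mult_add_right del: complex_cnj_diff)
             (simp flip: mat_commute add: add_ac)
        also have "(mat (cnj (e - 1)) ** Y) ** (mat (e - 1) ** Y) = mat (cnj (e - 1) * (e - 1)) ** Y"
          by (metis Y(2) mat_commute mat_mult_mat matrix_mul_assoc)
        finally show ?thesis
          by (simp add: vec_eq_iff mat_mult_nth algebra_simps)
      qed
      then have "X \<in> unitary_group"
        unfolding unitary_iff e1 by (simp add: vec_eq_iff mat_mult_nth)
      then have "Re (trace (X ** N)) \<le> Re (trace N)" by (rule max)
      moreover have "trace (X ** N) = trace N + (e - 1) * a"
      proof -
        have "trace (X ** N) = trace N + (e - 1) * trace (Y ** N)"
          by (simp add: X matrix_mult_add_left trace_add flip: matrix_mul_assoc)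
             (simp add: trace_def mat_mult_nth sum_distrib_left)
        also have "trace (Y ** N) = a"
          unfolding a_def cinner_def trace_def matrix_mult_nth matrix_vector_mult_nth Y_def
          by (subst sum.swap) (simp add: sum_distrib_left mult_ac)
        finally show ?thesis .
      qed
      ultimately have "Re (e * a) \<le> Re a" by (simp add: algebra_simps)
      then have le: "cmod a \<le> Re a" using e(2) by simp
      then have "cmod a = Re a" using complex_Re_le_cmod[of a] by simp
      then have "Im a = 0" "0 \<le> Re a"
        using cmod_power2[of a] by auto (metis norm_ge_zero)
      then show ?thesis by (simp add: a_def)
    qed
  qed
  have "Im (cinner x (N *v x)) = 0 \<and> 0 \<le> Re (cinner x (N *v x))" for x
  proof (cases "x = 0")
    case False
    define y where "y = (1 / norm x) *\<^sub>R x"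
    have y: "norm y = 1" "x = norm x *\<^sub>R y" using False by (auto simp: y_def)
    have "cinner x (N *v x) = (norm x)\<^sup>2 *\<^sub>R cinner y (N *v y)"
      by (subst (1 2) y(2)) (simp add: matrix_vector_scaleR cinner_scaleR_left cinner_scaleR_right power2_eq_square)
    then show ?thesis using *[OF y(1)] by simp
  qed simp
  then show ?thesis by (intro pos_semidefI) auto
qed

text \<open>Compactness supplies a maximiser \<open>U\<close> of \<open>Re (trace (X ** A))\<close>;
  comparing it with all \<open>X ** U\<close> is the hypothesis of
  \<open>pos_semidef_of_trace_max\<close> for \<open>U ** A\<close>.\<close>

lemma polar_decomposition:
  fixes A :: "complex^'n^'n"
  obtains U where "U \<in> unitary_group" "pos_semidef (U ** A)"
proof -
  have "\<exists>U\<in>unitary_group. \<forall>X\<in>unitary_group. Re (trace (X ** A)) \<le> Re (trace (U ** A))"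
    using unitary_1 by (intro continuous_attains_sup compact_unitary continuous_intros) blast
  then obtain U where U: "U \<in> unitary_group"
    and max: "\<And>X. X \<in> unitary_group \<Longrightarrow> Re (trace (X ** A)) \<le> Re (trace (U ** A))" by blast
  have "pos_semidef (U ** A)"
    by (rule pos_semidef_of_trace_max) (metis U max matrix_mul_assoc unitary_mult)
  with U show ?thesis by (rule that)
qed

text \<open>Maximising \<open>Re tr (C U A V)\<close> over unitary \<open>U\<close>, \<open>V\<close> for a diagonal matrix \<open>C\<close> with distinct
  positive entries forces \<open>U A V\<close> to be diagonal, nonnegative and sorted like \<open>C\<close>.\<close>
lemma singular_value_decomposition:
  fixes A :: "complex^'n^'n" and c :: "'n \<Rightarrow> real"
  assumes c: "inj c" "\<And>i. 0 < c i"
  obtains U d V where "U \<in> unitary_group" "V \<in> unitary_group" "A = U ** diag_matrix d ** V"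
    "\<And>i. 0 \<le> d $ i" "\<And>i j. c i \<le> c j \<Longrightarrow> d $ i \<le> d $ j"
proof -
  define C where "C = diag_matrix (\<chi> i. c i)"
  have C: "(C ** M) $ i $ j = c i * M $ i $ j" "(M ** C) $ i $ j = M $ i $ j * c j" for M :: "complex^'n^'n" and i j
    by (simp_all add: C_def diag_matrix_def matrix_mult_nth if_times times_if cong: if_cong)
  define f where "f = (\<lambda>P. Re (trace (C ** (fst P ** A ** snd P))))"
  have "\<exists>P\<in>unitary_group \<times> unitary_group. \<forall>Q\<in>unitary_group \<times> unitary_group. f Q \<le> f P"
    unfolding f_def using unitary_1 by (intro continuous_attains_sup compact_Times compact_unitary continuous_intros) blast
  then obtain U V where U: "U \<in> unitary_group" and V: "V \<in> unitary_group"
    and "\<And>Q. Q \<in> unitary_group \<times> unitary_group \<Longrightarrow> f Q \<le> f (U, V)" by blast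
  then have max: "f (X, Y) \<le> f (U, V)" if "X \<in> unitary_group" "Y \<in> unitary_group" for X Y
    using that by blast
  define M where "M = U ** A ** V"
  have max1: "Re (trace (C ** (X ** M ** Y))) \<le> Re (trace (C ** M))" if "X \<in> unitary_group" "Y \<in> unitary_group" for X Y
    using max[of "X ** U" "V ** Y"] that U V by (simp add: f_def M_def matrix_mul_assoc unitary_mult)
  have 1: "pos_semidef (M ** C)"
  proof (rule pos_semidef_of_trace_max)
    fix X :: "complex^'n^'n" assume "X \<in> unitary_group"
    then show "Re (trace (X ** (M ** C))) \<le> Re (trace (M ** C))"
      using max1[of X "mat 1"] trace_mul_sym[of C "X ** M"] trace_mul_sym[of C M] by (simp add: matrix_mul_assoc)
  qed
  have 2: "pos_semidef (C ** M)"
  proof (rule pos_semidef_of_trace_max)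
    fix X :: "complex^'n^'n" assume "X \<in> unitary_group"
    then show "Re (trace (X ** (C ** M))) \<le> Re (trace (C ** M))"
      using max1[of "mat 1" X] trace_mul_sym[of "C ** M" X] by (simp add: matrix_mul_assoc)
  qed
  have ctC: "ct C = C" by (auto simp: C_def diag_matrix_def vec_eq_iff)
  \<comment> \<open>Both \<open>M C\<close> and \<open>C M\<close> are Hermitian. Together the two
    relations make \<open>M\<close> commute with \<open>C C\<close>, whose diagonal entries are
    distinct, so \<open>M\<close> is diagonal.\<close>
  have "C ** ct M = M ** C" "ct M ** C = C ** M"
    using 1 2 by (auto simp: pos_semidef_iff ct_mult ctC)
  then have comm: "M ** C ** C = C ** C ** M"
    by (metis matrix_mul_assoc)
  have off: "M $ i $ j = 0" if "i \<noteq> j" for i j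
  proof -
    have "M $ i $ j * c j * c j = c i * (c i * M $ i $ j)"
      using arg_cong[OF comm, of "\<lambda>X. X $ i $ j"] by (simp add: C flip: matrix_mul_assoc) (simp add: C matrix_mul_assoc)
    then have "(complex_of_real (c j) * c j - complex_of_real (c i) * c i) * M $ i $ j = 0"
      by (simp add: algebra_simps)
    moreover have "c j * c j \<noteq> c i * c i"
      using c that by (metis injD less_eq_real_def power2_eq_square power2_eq_imp_eq)
    then have "complex_of_real (c j) * c j - complex_of_real (c i) * c i \<noteq> 0"
      by (simp flip: of_real_mult)
    ultimately show ?thesis by simp
  qed
  define d where "d = (\<chi> i. Re (M $ i $ i))"
  have dd: "M $ i $ i = d $ i \<and> 0 \<le> d $ i" for i
  proof -
    have "cinner (axis i 1) ((M ** C) *v axis i 1) = M $ i $ i * c i"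
      by (simp add: cinner_axis_left matrix_vector_axis_nth C)
    moreover have "Im (cinner (axis i 1) ((M ** C) *v axis i 1)) = 0" "0 \<le> Re (cinner (axis i 1) ((M ** C) *v axis i 1))"
      using 1 Im_cinner_hermitian by (auto simp: pos_semidef_iff)
    ultimately have "Im (M $ i $ i) * c i = 0" "0 \<le> Re (M $ i $ i) * c i" by auto
    then show ?thesis using c(2)[of i] by (auto simp: d_def complex_eq_iff zero_le_mult_iff)
  qed
  have M: "M = diag_matrix d"
    using off dd by (auto simp: vec_eq_iff diag_matrix_def)
  have sorted: "d $ i \<le> d $ j" if "c i \<le> c j" for i j
  proof (cases "i = j")
    case False
    \<comment> \<open>Conjugation by the transposition of \<open>i\<close> and \<open>j\<close> is a
      competitor that swaps two diagonal entries of \<open>M\<close>; optimality then is the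
      rearrangement inequality for two terms.\<close>
    define P :: "complex^'n^'n" where "P = (\<chi> k l. if l = Transposition.transpose i j k then 1 else 0)"
    have cP: "ct P = P"
      by (auto simp: P_def vec_eq_iff Transposition.transpose_def)
    have "P ** P = mat 1"
      by (auto simp: P_def vec_eq_iff matrix_mult_nth mat_nth if_times cong: if_cong)
    then have "P \<in> unitary_group" by (simp add: unitary_iff cP)
    then have "Re (trace (C ** (P ** M ** P))) \<le> Re (trace (C ** M))"
      by (rule max1) fact
    moreover have "(P ** M ** P) $ k $ k = d $ (Transposition.transpose i j k)" for k
    proof -
      have PZ: "(P ** Z) $ k $ l = Z $ Transposition.transpose i j k $ l" for Z :: "complex^'n^'n" and k l
        by (simp add: P_def matrix_mult_nth if_times cong: if_cong)
      have "P $ k $ l = (if k = Transposition.transpose i j l then 1 else 0)" for k l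
        by (auto simp: P_def)
      then have "(Z ** P) $ k $ l = Z $ k $ Transposition.transpose i j l" for Z :: "complex^'n^'n" and k l
        by (simp add: matrix_mult_nth times_if cong: if_cong)
      then show ?thesis using PZ by (simp add: M diag_matrix_def)
    qed
    ultimately have le: "(\<Sum>k\<in>UNIV. c k * d $ (Transposition.transpose i j k)) \<le> (\<Sum>k\<in>UNIV. c k * d $ k)"
      by (simp add: trace_def C M) (simp add: diag_matrix_def)
    have split: "(\<Sum>k\<in>UNIV. g k) = g i + (g j + (\<Sum>k\<in>UNIV - {i} - {j}. g k))" for g :: "'n \<Rightarrow> real"
      using False by (simp add: sum.remove[of UNIV i] sum.remove[of "UNIV - {i}" j])
    have "(\<Sum>k\<in>UNIV - {i} - {j}. c k * d $ (Transposition.transpose i j k)) = (\<Sum>k\<in>UNIV - {i} - {j}. c k * d $ k)"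
      by (rule sum.cong) (auto simp: Transposition.transpose_def)
    then have "c i * d $ j + c j * d $ i \<le> c i * d $ i + c j * d $ j"
      using le unfolding split by simp
    then have "0 \<le> (c j - c i) * (d $ j - d $ i)" by (simp add: algebra_simps)
    moreover have "c i < c j" using that False c(1) by (metis injD less_eq_real_def)
    ultimately show ?thesis by (simp add: zero_le_mult_iff)
  qed simp
  have "A = ct U ** diag_matrix d ** ct V"
    unfolding M[symmetric] M_def using U V by (simp add: matrix_mul_assoc)
  then show ?thesis by (rule that[rotated 2]) (use U V dd sorted unitary_ct in auto)
qed

text \<open>When the order of the singular values is irrelevant, any enumeration of the indices
  supplies the weights; adding 1 makes them positive.\<close>

lemma singular_value_decomposition':
  fixes A :: "complex^'n^'n"
  obtains U d V where "U \<in> unitary_group" "V \<in> unitary_group" "A = U ** diag_matrix d ** V" "\<And>i. 0 \<le> d $ i"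
proof -
  obtain f :: "'n \<Rightarrow> nat" where f: "inj f"
    using finite_imp_inj_to_nat_seg[of "UNIV :: 'n set"] by auto
  have "inj (\<lambda>i. real (f i) + 1)" using f by (auto simp: inj_on_def)
  then show ?thesis
    by (rule singular_value_decomposition[of "\<lambda>i. real (f i) + 1" A]) (use that in auto)
qed

lemma diag_matrix_mult: "diag_matrix d ** diag_matrix e = diag_matrix (\<chi> i. d $ i * e $ i)"
  by (auto simp: diag_matrix_def vec_eq_iff matrix_mult_nth if_times times_if cong: if_cong)

lemma ct_diag_matrix [simp]: "ct (diag_matrix d) = diag_matrix d"
  by (auto simp: diag_matrix_def vec_eq_iff)

lemma det_diag_matrix: "det (diag_matrix d) = of_real (\<Prod>i\<in>UNIV. d $ i)"
  by (subst det_diagonal) (auto simp: diag_matrix_def)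

lemma diag_matrix_1: "diag_matrix (\<chi> i. 1) = mat 1"
  by (auto simp: diag_matrix_def vec_eq_iff mat_nth)

lemma diag_matrix_vector: "diag_matrix d *v x = (\<chi> i. of_real (d $ i) * x $ i)"
  by (auto simp: diag_matrix_def vec_eq_iff matrix_vector_mult_nth if_times cong: if_cong)

lemma cinner_diag_matrix: "cinner x (diag_matrix d *v x) = of_real (\<Sum>i\<in>UNIV. d $ i * (cmod (x $ i))\<^sup>2)"
  by (simp add: diag_matrix_vector cinner_def complex_norm_square mult_ac del: of_real_power)

lemma pos_semidef_diag: "pos_semidef (diag_matrix d) \<longleftrightarrow> (\<forall>i. 0 \<le> d $ i)"
proof
  assume *: "pos_semidef (diag_matrix d)"
  show "\<forall>i. 0 \<le> d $ i"
  proof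
    fix i
    have "0 \<le> Re (cinner (axis i 1) (diag_matrix d *v axis i 1))"
      using * by (simp add: pos_semidef_iff)
    then show "0 \<le> d $ i"
      by (simp add: cinner_axis_left matrix_vector_axis_nth) (simp add: diag_matrix_def)
  qed
next
  assume "\<forall>i. 0 \<le> d $ i"
  then show "pos_semidef (diag_matrix d)"
    by (simp add: pos_semidef_iff cinner_diag_matrix sum_nonneg)
qed

text \<open>If \<open>U d V\<close> is a singular value decomposition of \<open>S\<close>, then
  \<open>V* d V\<close> is positive semidefinite with the same square as \<open>S\<close>, and
  uniqueness of the root identifies the two.\<close>

lemma pos_semidef_spectral:
  fixes S :: "complex^'n^'n"
  assumes S: "pos_semidef S"
  obtains V d where "V \<in> unitary_group" "\<And>i. 0 \<le> d $ i" "S = ct V ** diag_matrix d ** V"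
proof -
  obtain U d V where UV: "U \<in> unitary_group" "V \<in> unitary_group" "S = U ** diag_matrix d ** V" and d: "\<And>i. 0 \<le> d $ i"
    using singular_value_decomposition'[of S] by metis
  define T where "T = ct V ** diag_matrix d ** V"
  have T: "pos_semidef T"
    unfolding T_def by (rule pos_semidef_conj) (simp add: pos_semidef_diag d)
  have "S ** S = ct S ** S" using S by (simp add: pos_semidef_iff)
  also have "\<dots> = T ** T"
  proof -
    have "ct S ** S = (ct V ** diag_matrix d ** ct U) ** (U ** diag_matrix d ** V)"
      unfolding UV(3) ct_mult by (simp add: matrix_mul_assoc)
    also have "\<dots> = (ct V ** diag_matrix d) ** (diag_matrix d ** V)"
      using UV(1) by (simp flip: matrix_mul_assoc)
    also have "\<dots> = T ** T"
      using UV(2) by (simp add: T_def flip: matrix_mul_assoc)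
    finally show ?thesis .
  qed
  finally have "S = T" by (rule pos_semidef_sq_unique[OF S T])
  then show ?thesis using that[OF UV(2) d] T_def by simp
qed

lemma pos_semidef_sqrt:
  fixes S :: "complex^'n^'n"
  assumes S: "pos_semidef S"
  obtains R where "pos_semidef R" "R ** R = S"
proof -
  obtain V d where V: "V \<in> unitary_group" and d: "\<And>i. 0 \<le> d $ i" and S: "S = ct V ** diag_matrix d ** V"
    using pos_semidef_spectral[OF assms] by metis
  define R where "R = ct V ** diag_matrix (\<chi> i. sqrt (d $ i)) ** V"
  have "pos_semidef R"
    unfolding R_def by (rule pos_semidef_conj) (simp add: pos_semidef_diag d)
  moreover have "R ** R = ct V ** (diag_matrix (\<chi> i. sqrt (d $ i)) ** diag_matrix (\<chi> i. sqrt (d $ i))) ** V"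
    unfolding R_def using V by (simp flip: matrix_mul_assoc)
  then have "R ** R = S"
    by (simp add: diag_matrix_mult d S)
  ultimately show ?thesis by (rule that)
qed

text \<open>Polar decomposition turns \<open>X\<close> and \<open>Y\<close> into positive
  semidefinite roots of the same Gram matrix, which coincide.\<close>

lemma square_gram_eq:
  fixes X Y :: "complex^'n^'n"
  assumes "ct X ** X = ct Y ** Y"
  obtains U where "U \<in> unitary_group" "Y = U ** X"
proof -
  obtain u v where u: "u \<in> unitary_group" "pos_semidef (u ** X)" and v: "v \<in> unitary_group" "pos_semidef (v ** Y)"
    using polar_decomposition[of X] polar_decomposition[of Y] by metis
  have "(u ** X) ** (u ** X) = ct (u ** X) ** (u ** X)" using u by (simp add: pos_semidef_iff)
  also have "\<dots> = ct X ** X" using u by (simp add: ct_mult flip: matrix_mul_assoc)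
  also have "\<dots> = ct (v ** Y) ** (v ** Y)" using v assms by (simp add: ct_mult flip: matrix_mul_assoc)
  also have "\<dots> = (v ** Y) ** (v ** Y)" using v by (simp add: pos_semidef_iff)
  finally have "u ** X = v ** Y" by (rule pos_semidef_sq_unique[OF u(2) v(2)])
  then have "Y = ct v ** (u ** X)" using v by simp
  then have "Y = (ct v ** u) ** X" by (simp add: matrix_mul_assoc)
  then show ?thesis using that[of "ct v ** u"] u v unitary_ct unitary_mult by blast
qed

section \<open>Double cosets of the pseudo-unitary group\<close>

text \<open>The isometric inclusion of the first summand; its adjoint is the projection. Blocks
  become compressions, so block identities reduce to algebra with products. \<open>inr_mat\<close>
  does the same for the second summand.\<close>

definition inl_mat :: "complex^'a^('a::finite + 'b::finite)"
  where "inl_mat = (\<chi> i j. if i = Inl j then 1 else 0)"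

definition inr_mat :: "complex^'b^('a::finite + 'b::finite)"
  where "inr_mat = (\<chi> i j. if i = Inr j then 1 else 0)"

lemma sum_UNIV_sum_type:
  "(\<Sum>i\<in>(UNIV :: ('a::finite + 'b::finite) set). f i) = (\<Sum>k\<in>UNIV. f (Inl k)) + (\<Sum>k\<in>UNIV. f (Inr k))"
  by (simp add: UNIV_Plus_UNIV[symmetric] sum.Plus del: UNIV_Plus_UNIV)

lemma inl_mat_simps [simp]:
  "(inl_mat ** A) $ Inl k $ j = A $ k $ j" "(inl_mat ** A) $ Inr l $ j = 0"
  "(X ** inl_mat) $ i $ k = X $ i $ Inl k"
  "(ct inl_mat ** X') $ k $ j = X' $ Inl k $ j"
  "(B ** ct inl_mat) $ j $ Inl k = B $ j $ k" "(B ** ct inl_mat) $ j $ Inr l = 0"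
  by (simp_all add: inl_mat_def matrix_mult_nth sum_UNIV_sum_type if_distrib[of cnj]
      if_times times_if cong: if_cong)

lemma inr_mat_simps [simp]:
  "(inr_mat ** A) $ Inr k $ j = A $ k $ j" "(inr_mat ** A) $ Inl l $ j = 0"
  "(X ** inr_mat) $ i $ k = X $ i $ Inr k"
  "(ct inr_mat ** X') $ k $ j = X' $ Inr k $ j"
  "(B ** ct inr_mat) $ j $ Inr k = B $ j $ k" "(B ** ct inr_mat) $ j $ Inl l = 0"
  by (simp_all add: inr_mat_def matrix_mult_nth sum_UNIV_sum_type if_distrib[of cnj]
      if_times times_if cong: if_cong)

lemma inl_inr_mat [simp]:
  "ct inl_mat ** inl_mat = mat 1" "ct inr_mat ** inr_mat = mat 1"
  "ct inl_mat ** inr_mat = 0" "ct inr_mat ** inl_mat = 0"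
  by (simp_all add: vec_eq_iff mat_nth) (simp_all add: inl_mat_def inr_mat_def)

lemma inl_inr_cancel [simp]:
  "ct inl_mat ** (inl_mat ** X) = X" "ct inr_mat ** (inr_mat ** X) = X"
  "ct inl_mat ** (inr_mat ** Y) = 0" "ct inr_mat ** (inl_mat ** Z) = 0"
  by (simp_all add: matrix_mul_assoc)

lemma sum_matrix_eq_iff:
  fixes X Y :: "complex^'c^('a::finite + 'b::finite)"
  shows "X = Y \<longleftrightarrow> ct inl_mat ** X = ct inl_mat ** Y \<and> ct inr_mat ** X = ct inr_mat ** Y"
  by (auto simp: vec_eq_iff) (metis sum.exhaust)

lemma sum_matrix_eq_iff':
  fixes X Y :: "complex^('a::finite + 'b::finite)^'c"
  shows "X = Y \<longleftrightarrow> X ** inl_mat = Y ** inl_mat \<and> X ** inr_mat = Y ** inr_mat"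
  by (auto simp: vec_eq_iff) (metis sum.exhaust)

definition block_matrix ::
    "complex^'a^'a \<Rightarrow> complex^'b^'a \<Rightarrow> complex^'a^'b \<Rightarrow> complex^'b^'b \<Rightarrow> complex^('a::finite + 'b::finite)^('a + 'b)"
  where "block_matrix A B C D = inl_mat ** (A ** ct inl_mat + B ** ct inr_mat) + inr_mat ** (C ** ct inl_mat + D ** ct inr_mat)"

lemma block_matrix_nth [simp]:
  "block_matrix A B C D $ Inl i $ Inl j = A $ i $ j"
  "block_matrix A B C D $ Inl i $ Inr l = B $ i $ l"
  "block_matrix A B C D $ Inr k $ Inl j = C $ k $ j"
  "block_matrix A B C D $ Inr k $ Inr l = D $ k $ l"
  by (simp_all add: block_matrix_def)

lemma block_matrix_collapse:
  "block_matrix (ct inl_mat ** X ** inl_mat) (ct inl_mat ** X ** inr_mat)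
    (ct inr_mat ** X ** inl_mat) (ct inr_mat ** X ** inr_mat) = X"
proof -
  have "block_matrix (ct inl_mat ** X ** inl_mat) (ct inl_mat ** X ** inr_mat)
    (ct inr_mat ** X ** inl_mat) (ct inr_mat ** X ** inr_mat) $ i $ j = X $ i $ j" for i j
    by (cases i; cases j) simp_all
  then show ?thesis by (simp add: vec_eq_iff)
qed

lemma sum_matrix_ext:
  fixes X Y :: "complex^('a::finite + 'b::finite)^('a + 'b)"
  assumes "\<And>i j. X $ Inl i $ Inl j = Y $ Inl i $ Inl j" "\<And>i l. X $ Inl i $ Inr l = Y $ Inl i $ Inr l"
    "\<And>k j. X $ Inr k $ Inl j = Y $ Inr k $ Inl j" "\<And>k l. X $ Inr k $ Inr l = Y $ Inr k $ Inr l"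
  shows "X = Y"
proof -
  have "X $ i $ j = Y $ i $ j" for i j
    by (cases i; cases j) (simp_all add: assms)
  then show ?thesis by (simp add: vec_eq_iff)
qed

lemma block_matrix_eq_iff [simp]:
  "block_matrix A B C D = block_matrix A' B' C' D' \<longleftrightarrow> A = A' \<and> B = B' \<and> C = C' \<and> D = D'"
  by (metis block_matrix_nth vec_eq_iff)

lemma block_matrix_mult:
  "block_matrix A B C D ** block_matrix A' B' C' D' =
    block_matrix (A ** A' + B ** C') (A ** B' + B ** D') (C ** A' + D ** C') (C ** B' + D ** D')"
  by (rule sum_matrix_ext) (simp_all add: matrix_mult_nth sum_UNIV_sum_type)

lemma ct_block_matrix: "ct (block_matrix A B C D) = block_matrix (ct A) (ct C) (ct B) (ct D)"
  by (rule sum_matrix_ext) simp_all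

lemma block_matrix_1: "mat 1 = block_matrix (mat 1) 0 0 (mat 1)"
  by (rule sum_matrix_ext) (simp_all add: mat_nth)

lemma block_diag_eq: "block_diag u v = block_matrix u 0 0 v"
  by (rule sum_matrix_ext) (simp_all add: block_diag_def)

lemma signature_form_eq: "signature_form = block_matrix (mat 1) 0 0 (- mat 1)"
  by (rule sum_matrix_ext) (simp_all add: signature_form_def mat_nth)

lemma block_matrix_in_pseudo_unitary:
  "block_matrix A B C D \<in> pseudo_unitary_group \<longleftrightarrow>
    ct A ** A - ct C ** C = mat 1 \<and> ct A ** B = ct C ** D \<and> ct B ** A = ct D ** C \<and> ct D ** D - ct B ** B = mat 1"
  by (auto simp: pseudo_unitary_group_def signature_form_eq ct_block_matrix block_matrix_mult
      matrix_mult_minus_left matrix_mult_minus_right algebra_simps)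

lemma coset_rep_eq:
  "coset_rep t z = block_matrix
     (block_matrix (mat 1) 0 0 (mat (inverse (root_branch CARD('q) z)) ** cosh_diag t))
     (inr_mat ** sinh_diag t) (sinh_diag t ** ct inr_mat)
     (mat (root_branch CARD('q) z) ** cosh_diag (t :: real^'q))"
proof (rule sum_matrix_ext, goal_cases)
  case (1 i j)
  show ?case by (cases i; cases j) (simp_all add: coset_rep_def mat_nth mat_mult_nth)
next
  case (2 i j)
  show ?case by (cases i) (simp_all add: coset_rep_def)
next
  case (3 i j)
  show ?case by (cases j) (simp_all add: coset_rep_def)
next
  case (4 i j)
  show ?case by (simp add: coset_rep_def mat_mult_nth)
qed

lemma norm_root_branch [simp]: "cmod (root_branch n z) = 1"
  by (simp add: root_branch_def)

lemma root_branch_power: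
  assumes "n > 0" "cmod z = 1"
  shows "root_branch n z ^ n = z"
proof -
  have "root_branch n z ^ n = cis (real n * (Arg2pi z / real n))"
    unfolding root_branch_def by (rule Complex.DeMoivre)
  also have "\<dots> = cis (Arg2pi z)" using assms(1) by simp
  also have "\<dots> = z" using Arg2pi_eq[of z] assms(2) by (simp add: cis_conv_exp)
  finally show ?thesis .
qed

lemma mat_unit_gram: "cmod c = 1 \<Longrightarrow> ct (mat c ** X) ** (mat c ** Y) = ct X ** Y"
  by (metis ct_mult matrix_mul_assoc unitary_cancel(3) unitary_mat)

lemma cosh_sinh_diag: "cosh_diag t ** cosh_diag t - sinh_diag t ** sinh_diag t = mat 1"
proof -
  have "diag_matrix a - diag_matrix b = diag_matrix (a - b)" for a b :: "real^'a"
    by (auto simp: diag_matrix_def vec_eq_iff)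
  moreover have "(\<chi> i. cosh (t $ i) * cosh (t $ i)) - (\<chi> i. sinh (t $ i) * sinh (t $ i)) = (\<chi> i. 1)"
    by (simp add: vec_eq_iff hyperbolic_pythagoras flip: power2_eq_square)
  ultimately show ?thesis
    by (simp add: cosh_diag_def sinh_diag_def diag_matrix_mult diag_matrix_1)
qed

lemma cosh_sinh_commute: "cosh_diag t ** sinh_diag t = sinh_diag t ** cosh_diag t"
  by (simp add: cosh_diag_def sinh_diag_def diag_matrix_mult mult.commute)

lemma ct_cosh_sinh [simp]: "ct (cosh_diag t) = cosh_diag t" "ct (sinh_diag t) = sinh_diag t"
  by (simp_all add: cosh_diag_def sinh_diag_def)

text \<open>Conjugation inverts a phase, and the phases of the two cosh blocks are inverse to each
  other. Hence both sides of the mixed relation carry the same factor \<open>r\<close>, while in the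
  diagonal relations the phases cancel.\<close>

lemma coset_rep_in_group:
  fixes t :: "real^'q::finite"
  shows "(coset_rep t z :: complex^(('m::finite + 'q) + 'q)^(('m + 'q) + 'q)) \<in> pseudo_unitary_group"
proof -
  define r where "r = root_branch CARD('q) z"
  have r: "cmod r = 1" "cnj r = inverse r" "cmod (inverse r) = 1"
    by (simp_all add: r_def root_branch_def cis_cnj flip: cis_inverse)
      (simp add: norm_inverse flip: cis_inverse)
  let ?c = "cosh_diag t" and ?s = "sinh_diag t" and ?e = "inr_mat :: complex^'q^('m + 'q)"
  let ?A = "block_matrix (mat 1 :: complex^'m^'m) 0 0 (mat (inverse r) ** ?c)"
  have Ae: "?A ** ?e = ?e ** (mat (inverse r) ** ?c)" "ct ?A ** ?e = ?e ** (mat r ** ?c)"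
  proof -
    have *: "block_matrix (mat 1 :: complex^'m^'m) 0 0 X ** ?e = ?e ** X" for X
      by (simp add: block_matrix_def matrix_mult_add_left flip: matrix_mul_assoc)
    then show "?A ** ?e = ?e ** (mat (inverse r) ** ?c)" .
    have "ct ?A = block_matrix (mat 1 :: complex^'m^'m) 0 0 (mat r ** ?c)"
      using r by (simp add: ct_block_matrix ct_mult mat_commute)
    then show "ct ?A ** ?e = ?e ** (mat r ** ?c)" using * by simp
  qed
  have 1: "ct ?A ** ?A - ct (?s ** ct ?e) ** (?s ** ct ?e) = mat 1"
  proof -
    have "?e ** X ** ct ?e = block_matrix 0 0 0 X" for X :: "complex^'q^'q"
      by (simp add: block_matrix_def matrix_mul_assoc)
    then have "ct (?s ** ct ?e) ** (?s ** ct ?e) = block_matrix 0 0 0 (?s ** ?s)"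
      by (simp add: ct_mult matrix_mul_assoc) (metis matrix_mul_assoc)
    moreover have "ct ?A ** ?A = block_matrix (mat 1) 0 0 (?c ** ?c)"
      using r by (simp add: ct_block_matrix block_matrix_mult mat_unit_gram)
    moreover have "block_matrix A B C D - block_matrix A' B' C' D' = block_matrix (A - A') (B - B') (C - C') (D - D')"
      for A A' :: "complex^'m^'m" and B B' C C' and D D' :: "complex^'q^'q"
      by (rule sum_matrix_ext) simp_all
    ultimately show ?thesis
      by (simp add: cosh_sinh_diag block_matrix_1)
  qed
  have 2: "ct ?A ** (?e ** ?s) = ct (?s ** ct ?e) ** (mat r ** ?c)"
    by (simp add: ct_mult matrix_mul_assoc Ae)
       (metis cosh_sinh_commute mat_commute matrix_mul_assoc)
  have 3: "ct (?e ** ?s) ** ?A = ct (mat r ** ?c) ** (?s ** ct ?e)"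
    using arg_cong[OF 2, of ct] by (simp add: ct_mult)
  have 4: "ct (mat r ** ?c) ** (mat r ** ?c) - ct (?e ** ?s) ** (?e ** ?s) = mat 1"
    using r by (simp add: mat_unit_gram) (simp add: ct_mult cosh_sinh_diag flip: matrix_mul_assoc)
  show ?thesis
    unfolding coset_rep_eq block_matrix_in_pseudo_unitary r_def[symmetric] using 1 2 3 4 by blast
qed

text \<open>Padding with zero columns makes both matrices square and keeps the Gram matrices equal;
  the padding is removed again from the right.\<close>

lemma tall_gram_eq:
  fixes X Y :: "complex^'q^('m::finite + 'q::finite)"
  assumes "ct X ** X = ct Y ** Y"
  obtains U where "U \<in> unitary_group" "Y = U ** X"
proof -
  let ?e = "inr_mat :: complex^'q^('m + 'q)"
  have "ct (X ** ct ?e) ** (X ** ct ?e) = ct (Y ** ct ?e) ** (Y ** ct ?e)"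
    using assms by (simp add: ct_mult) (metis matrix_mul_assoc)
  then obtain U where U: "U \<in> unitary_group" "Y ** ct ?e = U ** (X ** ct ?e)"
    by (rule square_gram_eq)
  have "Y ** ct ?e ** ?e = U ** (X ** ct ?e) ** ?e" by (simp add: U)
  then have "Y = U ** X" by (simp flip: matrix_mul_assoc)
  with U show ?thesis using that by blast
qed

lemma pseudo_unitary_mult:
  "g \<in> pseudo_unitary_group \<Longrightarrow> h \<in> pseudo_unitary_group \<Longrightarrow> g ** h \<in> pseudo_unitary_group"
  unfolding pseudo_unitary_group_def by (simp add: ct_mult) (metis matrix_mul_assoc)

lemma block_diag_in_pseudo_unitary:
  "u \<in> unitary_group \<Longrightarrow> v \<in> unitary_group \<Longrightarrow> block_diag u v \<in> pseudo_unitary_group"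
  by (simp add: block_diag_eq block_matrix_in_pseudo_unitary)

text \<open>Equal corners give \<open>B* B = D* D - 1 = B'* B'\<close>, so a unitary factor on the
  left makes the last columns agree. The remaining factor fixes the last basis vectors, and the
  group relations force it to be block diagonal.\<close>

lemma same_corner:
  fixes g g' :: "complex^(('m::finite + 'q::finite) + 'q)^(('m + 'q) + 'q)"
  assumes g: "g \<in> pseudo_unitary_group" and g': "g' \<in> pseudo_unitary_group"
    and eq: "ct inr_mat ** g ** inr_mat = ct inr_mat ** g' ** inr_mat"
  obtains u1 u2 where "u1 \<in> unitary_group" "u2 \<in> unitary_group"
    "g = block_diag u1 (mat 1) ** g' ** block_diag u2 (mat 1)"
proof -
  let ?J = "signature_form :: complex^(('m + 'q) + 'q)^(('m + 'q) + 'q)"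
  have JJ: "?J ** ?J = mat 1"
    by (simp add: signature_form_eq block_matrix_mult block_matrix_1 matrix_mult_minus_left matrix_mult_minus_right)
  obtain A B C D where gb: "g = block_matrix A B C D"
    using block_matrix_collapse[of g] by metis
  obtain A' B' C' D' where gb': "g' = block_matrix A' B' C' D'"
    using block_matrix_collapse[of g'] by metis
  have DD: "D = D'"
    using eq by (simp add: gb gb' vec_eq_iff)
  have "ct B' ** B' = ct B ** B"
    using g g' unfolding gb gb' block_matrix_in_pseudo_unitary DD by (metis diff_left_imp_eq)
  then obtain u where u: "u \<in> unitary_group" "B = u ** B'"
    by (rule tall_gram_eq)
  define k where "k = block_matrix u 0 0 (mat 1 :: complex^'q^'q) ** g'"
  have kG: "k \<in> pseudo_unitary_group"
    unfolding k_def block_diag_eq[symmetric] by (intro pseudo_unitary_mult g' block_diag_in_pseudo_unitary u unitary_1)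
  have k: "ct k ** ?J ** k = ?J" using kG by (simp add: pseudo_unitary_group_def)
  have kb: "k = block_matrix (u ** A') B C' D"
    by (simp add: k_def gb' block_matrix_mult u DD)
  \<comment> \<open>For \<open>k\<close> in the group, \<open>J k* J\<close> is the inverse of
    \<open>k\<close>; thus \<open>h\<close> is the factor that takes \<open>k\<close> to
    \<open>g\<close> from the right.\<close>
  define h where "h = ?J ** ct k ** ?J ** g"
  have kinv: "?J ** ct k ** ?J ** k = mat 1"
    using k JJ by (simp flip: matrix_mul_assoc)
  then have kinv': "k ** (?J ** ct k ** ?J) = mat 1"
    using matrix_left_right_inverse by blast
  have kh: "k ** h = g"
    unfolding h_def using kinv' by (metis matrix_mul_assoc matrix_mul_lid)
  have hG: "ct h ** ?J ** h = ?J"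
  proof -
    have "ct h ** ?J ** h = ct h ** (ct k ** ?J ** k) ** h" by (simp add: k)
    also have "\<dots> = ct (k ** h) ** ?J ** (k ** h)" by (simp add: ct_mult matrix_mul_assoc)
    finally show ?thesis using g by (simp add: kh pseudo_unitary_group_def)
  qed
  have gk: "g ** inr_mat = k ** inr_mat"
    unfolding gb kb by (auto simp: sum_matrix_eq_iff vec_eq_iff)
  have hF: "h ** inr_mat = inr_mat"
  proof -
    have "h ** inr_mat = (?J ** ct k ** ?J ** k) ** inr_mat"
      unfolding h_def using gk by (simp flip: matrix_mul_assoc)
    then show ?thesis by (simp add: kinv)
  qed
  obtain a b c d where hb: "h = block_matrix a b c d"
    using block_matrix_collapse[of h] by metis
  have bd: "b = 0" "d = mat 1"
  proof -
    have 1: "block_matrix a b c d $ i $ Inr l = inr_mat $ i $ l" for i l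
      using arg_cong[OF hF, of "\<lambda>X. X $ i $ l"] by (simp add: hb)
    show "b = 0" using 1[of "Inl _"] by (simp add: vec_eq_iff inr_mat_def)
    show "d = mat 1" using 1[of "Inr _"] by (simp add: vec_eq_iff inr_mat_def mat_nth)
  qed
  have "h \<in> pseudo_unitary_group" using hG by (simp add: pseudo_unitary_group_def)
  then have "ct a ** a - ct c ** c = mat 1" "c = 0"
    unfolding hb block_matrix_in_pseudo_unitary bd by auto
  then have "a \<in> unitary_group" "h = block_matrix a 0 0 (mat 1)"
    by (auto simp: unitary_iff hb bd)
  then show ?thesis
    using that[of u a] u kh by (simp add: block_diag_eq k_def)
qed

section \<open>Reading \<open>sigma_sing\<close> off a singular value decomposition\<close>

lemma char_polynomial_unitary_conj:
  fixes M :: "complex^'n^'n"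
  assumes V: "V \<in> unitary_group"
  shows "char_polynomial (ct V ** M ** V) = char_polynomial M"
proof -
  let ?p = "map_matrix (\<lambda>c. [:c:]) :: complex^'n^'n \<Rightarrow> complex poly^'n^'n"
  let ?X = "mat [:0, 1:] :: complex poly^'n^'n"
  have p: "?p (A ** B) = ?p A ** ?p B" for A B :: "complex^'n^'n"
    by (simp add: vec_eq_iff matrix_mult_nth sum_to_poly mult.commute)
  have p1: "?p (ct V) ** ?p V = mat 1"
    unfolding p[symmetric] using V by (simp add: vec_eq_iff mat_nth one_pCons)
  have "?X - ?p (ct V ** M ** V) = ?p (ct V) ** (?X - ?p M) ** ?p V"
    by (simp add: p matrix_mult_diff_left matrix_mult_diff_right)
       (metis p1 mat_commute matrix_mul_assoc matrix_mul_rid)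
  then have "char_polynomial (ct V ** M ** V) = det (?p (ct V)) * det (?p V) * char_polynomial M"
    by (simp add: char_polynomial_def det_mul)
  also have "det (?p (ct V)) * det (?p V) = 1"
    using p1 by (metis det_I det_mul)
  finally show ?thesis by simp
qed

lemma spec_diag_matrix: "spec (diag_matrix d :: complex^'n^'n) = image_mset (\<lambda>i. of_real (d $ i)) (mset_set UNIV)"
proof -
  have "char_polynomial (diag_matrix d :: complex^'n^'n) = (\<Prod>i\<in>UNIV. [:- of_real (d $ i), 1:])"
    unfolding char_polynomial_def by (subst det_diagonal) (auto simp: mat_nth diag_matrix_def)
  then have "spec (diag_matrix d :: complex^'n^'n) = (\<Sum>i\<in>UNIV. proots [:- of_real (d $ i), 1:])"
    unfolding spec_def by (simp only:) (rule proots_prod, simp)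
  also have "\<dots> = (\<Sum>i\<in>UNIV. {#of_real (d $ i)#})" by simp
  also have "\<dots> = image_mset (\<lambda>i. of_real (d $ i)) (mset_set UNIV)"
    by (metis (no_types, lifting) sum_unfold_sum_mset sum_mset_singleton_mset image_mset.compositionality sum.cong comp_apply)
  finally show ?thesis .
qed

text \<open>The entries before \<open>i\<close> in the sorted list are exactly the smaller indices;
  this connects the positions used in \<open>sigma_sing\<close> with the indices themselves.\<close>

lemma sorted_list_of_set_nth_card:
  "sorted_list_of_set (UNIV :: 'q::{finite,linorder} set) ! card {..<i} = i \<and> card {..<i} < CARD('q)"
proof -
  let ?L = "sorted_list_of_set (UNIV :: 'q set)"
  have len: "length ?L = CARD('q)" by simp
  have "i \<in> set ?L" by simp
  then obtain n where n: "n < length ?L" "?L ! n = i" by (metis in_set_conv_nth)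
  have "{..<i} = (!) ?L ` {..<n}"
  proof (intro equalityI subsetI)
    fix x assume "x \<in> {..<i}"
    then have "x < i" by simp
    obtain k where k: "k < length ?L" "?L ! k = x"
      using in_set_conv_nth[of x ?L] by auto
    have "k < n"
    proof (rule ccontr)
      assume "\<not> k < n"
      then have "?L ! n \<le> ?L ! k" using k by (intro sorted_nth_mono) auto
      then show False using n k \<open>x < i\<close> by simp
    qed
    then show "x \<in> (!) ?L ` {..<n}" using k by auto
  next
    fix x assume "x \<in> (!) ?L ` {..<n}"
    then obtain k where k: "k < n" "x = ?L ! k" by auto
    then have "x < i"
      using n sorted_wrt_nth_less[OF strict_sorted_list_of_set[of "UNIV :: 'q set"], of k n] by simp
    then show "x \<in> {..<i}" by simp
  qed
  moreover have "inj_on ((!) ?L) {..<n}"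
    using n by (intro inj_on_nth) auto
  ultimately have "card {..<i} = n"
    by (simp add: card_image)
  then show ?thesis using n len by simp
qed

lemma sigma_sing_svd:
  fixes U V :: "complex^'q::{finite,linorder}^'q::{finite,linorder}"
  assumes U: "U \<in> unitary_group" and V: "V \<in> unitary_group"
    and d: "\<And>i. 0 \<le> d $ i" "\<And>i j. i \<le> j \<Longrightarrow> d $ j \<le> d $ i"
  shows "sigma_sing (U ** diag_matrix d ** V) = d"
proof -
  let ?D = "U ** diag_matrix d ** V" and ?L = "sorted_list_of_set (UNIV :: 'q set)"
  have "ct ?D ** ?D = (ct V ** diag_matrix d) ** (ct U ** (U ** (diag_matrix d ** V)))"
    by (simp add: ct_mult matrix_mul_assoc)
  also have "\<dots> = ct V ** (diag_matrix d ** diag_matrix d) ** V"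
    using U by (simp add: matrix_mul_assoc)
  also have "diag_matrix d ** diag_matrix d = diag_matrix (\<chi> i. d $ i * d $ i)"
    by (rule diag_matrix_mult)
  finally have "spec (ct ?D ** ?D) = spec (diag_matrix (\<chi> i. d $ i * d $ i) :: ((complex, 'q) vec, 'q) vec)"
    using V by (simp add: spec_def char_polynomial_unitary_conj)
  then have "image_mset (\<lambda>x. sqrt (Re x)) (spec (ct ?D ** ?D)) = image_mset (\<lambda>i. d $ i) (mset_set UNIV)"
    by (simp add: spec_diag_matrix multiset.map_comp comp_def d(1))
  also have "\<dots> = mset (map (\<lambda>i. d $ i) ?L)"
    by (simp flip: mset_set_set)
  also have "sorted_list_of_multiset \<dots> = sort (map (\<lambda>i. d $ i) ?L)"
    by (simp only: sorted_list_of_multiset_mset)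
  \<comment> \<open>\<open>d\<close> decreases along the enumeration, so sorting upwards reverses
    the list; the \<open>rev\<close> in \<open>sigma_sing\<close> undoes this.\<close>
  also have "\<dots> = rev (map (\<lambda>i. d $ i) ?L)"
  proof (rule properties_for_sort)
    show "mset (rev (map (($) d) ?L)) = mset (map (($) d) ?L)" by simp
    have "sorted_wrt (\<lambda>x y. x \<ge> y) (map (($) d) ?L)"
      unfolding sorted_wrt_map
      by (rule sorted_wrt_mono_rel[OF _ sorted_sorted_list_of_set]) (use d(2) in auto)
    then show "sorted (rev (map (($) d) ?L))"
      by (simp add: sorted_wrt_rev)
  qed
  finally show ?thesis
    using sorted_list_of_set_nth_card[where ?'q = 'q] by (simp add: sigma_sing_def vec_eq_iff)
qed

lemma K_tilde_corner: 
  "u \<in> unitary_group \<Longrightarrow> block_diag u (mat 1) \<in> K_tilde"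
  "v \<in> special_unitary_group \<Longrightarrow> block_diag (mat 1) v \<in> K_tilde"
  unfolding K_tilde_def using special_unitary_iff[of "mat 1"] unitary_1 by (auto, blast)

lemma K_tilde_mult: "k \<in> K_tilde \<Longrightarrow> k' \<in> K_tilde \<Longrightarrow> k ** k' \<in> K_tilde"
proof -
  assume "k \<in> K_tilde" "k' \<in> K_tilde"
  then obtain u v u' v' where *: "k = block_diag u v" "k' = block_diag u' v'"
    "u \<in> unitary_group" "v \<in> special_unitary_group" "u' \<in> unitary_group" "v' \<in> special_unitary_group"
    unfolding K_tilde_def by blast
  then have "k ** k' = block_diag (u ** u') (v ** v')"
    by (simp add: block_diag_eq block_matrix_mult)
  moreover have "u ** u' \<in> unitary_group" "v ** v' \<in> special_unitary_group"
    using * by (auto simp: special_unitary_iff unitary_mult det_mul)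
  ultimately show ?thesis unfolding K_tilde_def by blast
qed

lemma K_tilde_subset: "K_tilde \<subseteq> pseudo_unitary_group"
  by (auto simp: K_tilde_def special_unitary_iff intro!: block_diag_in_pseudo_unitary)

text \<open>By \<open>same_corner\<close> it suffices to write the corner of \<open>g\<close> as
  that of the representative between two elements of SU(q). The determinant of \<open>U\<close> in
  \<open>D = U d V\<close> is carried past \<open>d\<close> by a diagonal matrix. The second
  parameter is the phase of the determinant of \<open>mat \<rho> ** D\<close>, which is what gives
  the right factor determinant 1.\<close>

lemma biinvariant_coset_rep:
  fixes g :: "complex^(('m::finite + 'q::{finite,linorder}) + 'q)^(('m + 'q) + 'q)"
  assumes inv: "\<And>g k k'. g \<in> pseudo_unitary_group \<Longrightarrow> k \<in> K_tilde \<Longrightarrow> k' \<in> K_tilde \<Longrightarrow> \<phi> (k ** g ** k') = \<phi> g"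
    and g: "g \<in> pseudo_unitary_group"
    and corner: "ct inr_mat ** g ** inr_mat = mat \<rho> ** D" and \<rho>: "cmod \<rho> = 1"
  shows "\<phi> g = \<phi> (coset_rep (arcosh_vec (sigma_sing D)) (\<rho> ^ CARD('q) * sgn (det D)))"
proof -
  \<comment> \<open>Weights that decrease along the index order make the singular values come out in
    decreasing order.\<close>
  define c :: "'q \<Rightarrow> real" where "c i = CARD('q) - card {..<i}" for i
  have c_less: "card {..<i} < CARD('q)" for i :: 'q
    using sorted_list_of_set_nth_card by blast
  have c_mono: "c j \<le> c i" if "i \<le> j" for i j
    using that c_less by (auto simp: c_def intro!: diff_le_mono2 card_mono)
  have "inj c"
  proof (rule injI)
    fix i j assume "c i = c j"
    then have "card {..<i} = card {..<j}" using c_less[of i] c_less[of j] by (simp add: c_def)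
    then show "i = j" by (metis sorted_list_of_set_nth_card)
  qed
  moreover have "0 < c i" for i using c_less[of i] by (simp add: c_def)
  ultimately obtain U d V where U: "U \<in> unitary_group" and V: "V \<in> unitary_group" and D: "D = U ** diag_matrix d ** V"
    and d: "\<And>i. 0 \<le> d $ i" "\<And>i j. c i \<le> c j \<Longrightarrow> d $ i \<le> d $ j"
    by (rule singular_value_decomposition[of c D]) blast
  have sigma: "sigma_sing D = d"
    unfolding D using U V d c_mono by (intro sigma_sing_svd) auto
  \<comment> \<open>\<open>D* D = 1 + B* B\<close> keeps every singular value at least 1, where
    \<open>cosh\<close> undoes \<open>arcosh\<close>.\<close>
  have d1: "1 \<le> d $ i" for i
  proof -
    obtain A B C E where gb: "g = block_matrix A B C E"
      using block_matrix_collapse[of g] by metis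
    have "E = mat \<rho> ** D" using corner by (simp add: gb vec_eq_iff)
    then have "ct D ** D = mat 1 + ct B ** B"
      using g \<rho> by (simp add: gb block_matrix_in_pseudo_unitary mat_unit_gram diff_eq_eq)
    moreover have "ct D ** D = ct V ** (diag_matrix d ** diag_matrix d) ** V"
    proof -
      have "ct D ** D = (ct V ** diag_matrix d) ** (ct U ** (U ** (diag_matrix d ** V)))"
        by (simp add: D ct_mult matrix_mul_assoc)
      then show ?thesis using U by (simp add: matrix_mul_assoc)
    qed
    ultimately have "diag_matrix d ** diag_matrix d = V ** (mat 1 + ct B ** B) ** ct V"
      using V by (metis matrix_mul_assoc matrix_mul_rid unitary_cancel(2,4))
    also have "\<dots> = mat 1 + ct (B ** ct V) ** (B ** ct V)"
      using V by (simp add: matrix_mult_add_left matrix_mult_add_right ct_mult matrix_mul_assoc)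
    finally have "diag_matrix d ** diag_matrix d - mat 1 = ct (B ** ct V) ** (B ** ct V)" by simp
    moreover have "diag_matrix (\<chi> i. d $ i * d $ i - 1) = diag_matrix d ** diag_matrix d - mat 1"
      unfolding diag_matrix_mult by (auto simp: diag_matrix_def vec_eq_iff mat_nth)
    ultimately have "diag_matrix (\<chi> i. d $ i * d $ i - 1) = ct (B ** ct V) ** (B ** ct V)"
      by simp
    then have "pos_semidef (diag_matrix (\<chi> i. d $ i * d $ i - 1) :: ((complex, 'q) vec, 'q) vec)"
      using pos_semidef_gram by metis
    then have "0 \<le> d $ i * d $ i - 1" by (simp add: pos_semidef_diag)
    then have "1\<^sup>2 \<le> (d $ i)\<^sup>2" by (simp add: power2_eq_square)
    then show ?thesis using d(1)[of i] by (rule power2_le_imp_le)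
  qed
  define t where "t = arcosh_vec (sigma_sing D)"
  define z where "z = \<rho> ^ CARD('q) * sgn (det D)"
  define r where "r = root_branch CARD('q) z"
  have ch: "diag_matrix d = cosh_diag t"
    using d1 by (simp add: cosh_diag_def t_def sigma arcosh_vec_def)
  have crcorner: "ct inr_mat ** (coset_rep t z :: complex^(('m + 'q) + 'q)^(('m + 'q) + 'q)) ** inr_mat = mat r ** diag_matrix d"
    unfolding ch by (subst coset_rep_eq) (simp add: r_def vec_eq_iff)
  have prod: "0 < (\<Prod>i\<in>UNIV. d $ i)"
    using d1 by (intro prod_pos) (metis less_le_trans zero_less_one)
  have detUV: "cmod (det U * det V) = 1"
    using U V by (simp add: norm_mult norm_det_unitary)
  have "det D = (\<Prod>i\<in>UNIV. d $ i) *\<^sub>R (det U * det V)"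
    by (simp add: D det_mul det_diag_matrix scaleR_conv_of_real)
  then have sgn: "sgn (det D) = det U * det V"
    using prod detUV by (simp add: sgn_scaleR) (simp add: sgn_div_norm)
  have z: "cmod z = 1" "z = \<rho> ^ CARD('q) * (det U * det V)"
    using \<rho> detUV by (simp_all add: z_def sgn norm_mult norm_power)
  have r: "cmod r = 1" "r ^ CARD('q) = z"
    using z root_branch_power[of "CARD('q)" z] by (simp_all add: r_def)
  obtain i0 :: 'q where True by blast
  \<comment> \<open>A determinant \<open>a\<close> sitting in one diagonal slot commutes with
    \<open>d\<close>, so it can pass from the left unitary factor to the right one.\<close>
  define th :: "complex \<Rightarrow> ((complex, 'q) vec, 'q) vec" where "th a = (\<chi> i j. if i = j then (if i = i0 then a else 1) else 0)" for a
  have th_mult: "th a ** th b = th (a * b)" for a b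
    by (auto simp: th_def vec_eq_iff matrix_mult_nth if_times times_if cong: if_cong)
  have th_ct: "ct (th a) = th (cnj a)" for a
    by (auto simp: th_def vec_eq_iff)
  have th_1: "th 1 = mat 1" by (auto simp: th_def vec_eq_iff mat_nth)
  have th_det: "det (th a) = a" for a
    by (subst det_diagonal) (auto simp: th_def)
  have th_diag: "th a ** diag_matrix d = diag_matrix d ** th a" for a
    by (auto simp: th_def diag_matrix_def vec_eq_iff matrix_mult_nth if_times times_if cong: if_cong)
  have th_unitary: "th a \<in> unitary_group" if "cmod a = 1" for a
    using that by (simp add: unitary_iff th_ct th_mult mult.commute th_1 flip: complex_norm_square)
  define a where "a = det U"
  have a: "cmod a = 1" using U by (simp add: a_def norm_det_unitary)
  then have ca: "cnj a * a = 1" by (simp add: mult.commute flip: complex_norm_square)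
  define u where "u = U ** th (cnj a)"
  \<comment> \<open>Since \<open>r ^ CARD('q) = \<rho> ^ CARD('q) * (det U * det V)\<close>, the
    scalar \<open>\<rho> / r\<close> cancels the determinant \<open>a * det V\<close>.\<close>
  define v where "v = mat (\<rho> / r) ** (th a ** V)"
  have u: "u \<in> special_unitary_group"
    using U a ca by (simp add: u_def special_unitary_iff unitary_mult th_unitary det_mul th_det mult.commute flip: a_def)
  have "det v = (\<rho> ^ CARD('q) / z) * (a * det V)"
    by (simp add: v_def det_mul det_mat th_det power_divide r)
  also have "\<dots> = 1" using z \<rho> detUV by (auto simp: a_def)
  finally have v: "v \<in> special_unitary_group"
    using V a r \<rho> by (simp add: v_def special_unitary_iff unitary_mult th_unitary unitary_mat norm_divide)
  define g' :: "complex^(('m + 'q) + 'q)^(('m + 'q) + 'q)" where "g' = block_diag (mat 1) u ** coset_rep t z ** block_diag (mat 1) v"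
  have k: "block_diag (mat 1) u \<in> (K_tilde :: (complex^(('m + 'q) + 'q)^(('m + 'q) + 'q)) set)"
    "block_diag (mat 1) v \<in> (K_tilde :: (complex^(('m + 'q) + 'q)^(('m + 'q) + 'q)) set)"
    using u v by (auto intro: K_tilde_corner)
  have g': "g' \<in> pseudo_unitary_group"
    unfolding g'_def using k K_tilde_subset coset_rep_in_group by (intro pseudo_unitary_mult) auto
  have g'corner: "ct inr_mat ** g' ** inr_mat = u ** (mat r ** diag_matrix d) ** v"
  proof -
    have 1: "ct inr_mat ** block_diag (mat 1) u = u ** ct inr_mat" for u :: "((complex, 'q) vec, 'q) vec"
      by (auto simp: sum_matrix_eq_iff' block_diag_eq vec_eq_iff)
    have 2: "block_diag (mat 1) v ** inr_mat = inr_mat ** v" for v :: "((complex, 'q) vec, 'q) vec"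
      by (auto simp: sum_matrix_eq_iff block_diag_eq vec_eq_iff matrix_mul_assoc)
    let ?cr = "coset_rep t z :: complex^(('m + 'q) + 'q)^(('m + 'q) + 'q)"
    have "ct inr_mat ** g' ** inr_mat = (ct inr_mat ** block_diag (mat 1) u) ** ?cr ** (block_diag (mat 1) v ** inr_mat)"
      by (simp only: g'_def matrix_mul_assoc)
    also have "\<dots> = u ** (ct inr_mat ** ?cr ** inr_mat) ** v"
      by (simp only: 1 2 matrix_mul_assoc)
    finally show ?thesis by (simp only: crcorner)
  qed
  also have "\<dots> = mat r ** mat (\<rho> / r) ** (U ** (th (cnj a) ** diag_matrix d ** th a) ** V)"
  proof -
    have "u ** (mat r ** diag_matrix d) ** v = (u ** mat r) ** (diag_matrix d ** mat (\<rho> / r)) ** (th a ** V)"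
      by (simp only: v_def matrix_mul_assoc)
    also have "\<dots> = (mat r ** u) ** (mat (\<rho> / r) ** diag_matrix d) ** (th a ** V)"
      by (simp only: mat_commute)
    also have "\<dots> = mat r ** (u ** mat (\<rho> / r)) ** (diag_matrix d ** (th a ** V))"
      by (simp only: matrix_mul_assoc)
    also have "\<dots> = mat r ** (mat (\<rho> / r) ** u) ** (diag_matrix d ** (th a ** V))"
      by (simp only: mat_commute)
    finally show ?thesis by (simp only: u_def matrix_mul_assoc)
  qed
  also have "mat r ** mat (\<rho> / r) = (mat \<rho> :: ((complex, 'q) vec, 'q) vec)"
    using r by (auto simp: mat_mult_mat)
  also have "th (cnj a) ** diag_matrix d ** th a = diag_matrix d"
    by (simp add: th_diag ca th_1 th_mult flip: matrix_mul_assoc)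
  finally have "ct inr_mat ** g ** inr_mat = ct inr_mat ** g' ** inr_mat"
    by (simp add: corner D)
  with g g' obtain u1 u2 where "u1 \<in> unitary_group" "u2 \<in> unitary_group"
    "g = block_diag u1 (mat 1) ** g' ** block_diag u2 (mat 1)"
    by (rule same_corner)
  then have "\<phi> g = \<phi> g'"
    using inv[OF g'] K_tilde_corner(1) by metis
  also have "\<dots> = \<phi> (coset_rep t z)"
    unfolding g'_def using inv k coset_rep_in_group by metis
  finally show ?thesis by (simp add: t_def z_def)
qed

section \<open>Lebesgue measure on spaces of matrices\<close>

lemma borel_measurable_matrix_mult [measurable (raw)]:
  fixes f :: "'a \<Rightarrow> complex^'n^'m" and g :: "'a \<Rightarrow> complex^'k^'n"
  assumes "f \<in> borel_measurable M" "g \<in> borel_measurable M"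
  shows "(\<lambda>x. f x ** g x) \<in> borel_measurable M"
  by (rule borel_measurable_continuous_Pair[OF assms]) (intro continuous_intros)

lemma borel_measurable_ct [measurable (raw)]:
  fixes f :: "'a \<Rightarrow> complex^'n^'m"
  assumes "f \<in> borel_measurable M"
  shows "(\<lambda>x. ct (f x)) \<in> borel_measurable M"
  by (rule measurable_compose[OF assms borel_measurable_continuous_onI]) (intro continuous_intros)

lemma borel_measurable_det [measurable (raw)]:
  fixes f :: "'a \<Rightarrow> complex^'n^'n"
  assumes "f \<in> borel_measurable M"
  shows "(\<lambda>x. det (f x)) \<in> borel_measurable M"
  by (rule measurable_compose[OF assms borel_measurable_continuous_onI]) (intro continuous_intros)

lemma nn_integral_lborel_translate:
  fixes f :: "'a::euclidean_space \<Rightarrow> ennreal"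
  assumes [measurable]: "f \<in> borel_measurable borel"
  shows "(\<integral>\<^sup>+x. f (a + x) \<partial>lborel) = (\<integral>\<^sup>+x. f x \<partial>lborel)"
  by (subst (2) lborel_distr_plus[of a, symmetric]) (simp add: nn_integral_distr)

lemma nn_integral_lborel_translate':
  fixes f :: "'a::euclidean_space \<Rightarrow> ennreal"
  assumes "f \<in> borel_measurable borel"
  shows "(\<integral>\<^sup>+x. f (x + a) \<partial>lborel) = (\<integral>\<^sup>+x. f x \<partial>lborel)"
  using nn_integral_lborel_translate[OF assms, of a] by (simp add: add.commute)

lemma emeasure_lborel_open_nonzero:
  fixes S :: "'a::euclidean_space set"
  assumes "open S" "x \<in> S"
  shows "emeasure lborel S \<noteq> 0"
proof -
  obtain e where e: "e > 0" "ball x e \<subseteq> S"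
    using assms open_contains_ball by blast
  have "0 < emeasure lborel (ball x e)"
    using e unit_ball_vol_pos[of "real DIM('a)"] by (simp add: emeasure_ball ennreal_zero_less_mult_iff)
  also have "\<dots> \<le> emeasure lborel S"
    using e assms by (intro emeasure_mono) auto
  finally show ?thesis by simp
qed

lemma emeasure_lborel_bounded_finite:
  fixes S :: "'a::euclidean_space set"
  assumes "bounded S" "S \<in> sets borel"
  shows "emeasure lborel S \<noteq> \<infinity>"
  using emeasure_bounded_finite[OF assms(1)] by auto

lemma borel_measurable_linear:
  fixes L :: "'a::euclidean_space \<Rightarrow> 'b::euclidean_space"
  shows "linear L \<Longrightarrow> L \<in> borel_measurable borel"
  by (intro borel_measurable_continuous_onI linear_continuous_on) (simp add: linear_conv_bounded_linear)

text \<open>Uniqueness of translation invariant measures: integrate \<open>g (L x) h (y - L x)\<close> over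
  \<open>x\<close> and \<open>y\<close> in both orders.\<close>
lemma nn_integral_linear_bij:
  fixes L :: "'a::euclidean_space \<Rightarrow> 'b::euclidean_space"
  assumes L: "linear L" and bij: "bij L"
  obtains c where "c \<noteq> 0" "c \<noteq> \<infinity>"
    "\<And>f. f \<in> borel_measurable borel \<Longrightarrow> (\<integral>\<^sup>+x. f (L x) \<partial>lborel) = c * (\<integral>\<^sup>+y. f y \<partial>lborel)"
proof -
  have [measurable]: "L \<in> borel_measurable borel" by (rule borel_measurable_linear[OF L])
  define L' where "L' = inv L"
  have LL': "L (L' y) = y" for y unfolding L'_def by (meson bij bij_inv_eq_iff)
  have L': "linear L'"
    by (intro linearI; rule injD[OF bij_is_inj[OF bij]]) (simp_all add: LL' linear_add[OF L] linear_scale[OF L])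
  \<comment> \<open>A test function of finite nonzero mass \<open>H\<close>; with \<open>N\<close>
    its mass seen through \<open>L\<close>, the constant is \<open>N / H\<close>.\<close>
  define h :: "'b \<Rightarrow> ennreal" where "h = indicator (ball 0 1)"
  have [measurable]: "h \<in> borel_measurable borel" unfolding h_def by (intro borel_measurable_indicator borel_open open_ball)
  define H where "H = (\<integral>\<^sup>+y. h y \<partial>lborel)"
  have H: "H = emeasure lborel (ball 0 1 :: 'b set)" by (simp add: H_def h_def)
  have "H \<noteq> 0" "H \<noteq> \<infinity>"
    unfolding H by (rule emeasure_lborel_open_nonzero[of _ 0], simp, simp)
      (rule emeasure_lborel_bounded_finite, simp, simp)
  define N where "N = (\<integral>\<^sup>+x. h (- L x) \<partial>lborel)"
  have op: "open (L -` ball 0 1)"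
    using L by (intro open_vimage linear_continuous_on) (auto simp: linear_conv_bounded_linear)
  have N: "N = emeasure lborel (L -` ball 0 1)"
  proof -
    have "N = (\<integral>\<^sup>+x. indicator (L -` ball 0 1) x \<partial>lborel)"
      unfolding N_def h_def by (intro nn_integral_cong) (auto simp: indicator_def)
    then show ?thesis using op by (simp add: borel_open)
  qed
  have "N \<noteq> 0"
    unfolding N using L by (intro emeasure_lborel_open_nonzero[OF op, of 0]) (simp add: linear_0)
  moreover have "N \<noteq> \<infinity>"
  proof -
    have "L -` ball 0 1 \<subseteq> L' ` ball 0 1"
    proof
      fix x assume "x \<in> L -` ball 0 1"
      moreover have "x = L' (L x)" unfolding L'_def by (simp add: bij_is_inj[OF bij])
      ultimately show "x \<in> L' ` ball 0 1" by blast
    qed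
    moreover have "bounded (L' ` ball 0 1)"
      using L' by (intro bounded_linear_image) (auto simp: linear_conv_bounded_linear)
    ultimately have "bounded (L -` ball 0 1)" using bounded_subset by blast
    then show ?thesis unfolding N using op by (intro emeasure_lborel_bounded_finite) auto
  qed
  moreover have "H * (\<integral>\<^sup>+x. g (L x) \<partial>lborel) = N * (\<integral>\<^sup>+y. g y \<partial>lborel)"
    if [measurable]: "g \<in> borel_measurable borel" for g
  proof -
    have "H * (\<integral>\<^sup>+x. g (L x) \<partial>lborel) = (\<integral>\<^sup>+x. g (L x) * H \<partial>lborel)"
      by (subst nn_integral_multc) (auto simp: mult.commute)
    also have "\<dots> = (\<integral>\<^sup>+x. (\<integral>\<^sup>+y. g (L x) * h (y + (- L x)) \<partial>lborel) \<partial>lborel)"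
      by (subst nn_integral_cmult, measurable, subst nn_integral_lborel_translate') (auto simp: H_def)
    also have "\<dots> = (\<integral>\<^sup>+y. (\<integral>\<^sup>+x. g (L x) * h (y + (- L x)) \<partial>lborel) \<partial>lborel)"
      by (rule lborel_pair.Fubini'[symmetric]) measurable
    also have "\<dots> = (\<integral>\<^sup>+y. (\<integral>\<^sup>+x. g (L (L' y + x)) * h (y + (- L (L' y + x))) \<partial>lborel) \<partial>lborel)"
      by (subst nn_integral_lborel_translate) auto
    also have "\<dots> = (\<integral>\<^sup>+y. (\<integral>\<^sup>+x. g (y + L x) * h (- L x) \<partial>lborel) \<partial>lborel)"
      by (simp add: linear_add[OF L] LL')
    also have "\<dots> = (\<integral>\<^sup>+x. (\<integral>\<^sup>+y. g (y + L x) * h (- L x) \<partial>lborel) \<partial>lborel)"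
      by (rule lborel_pair.Fubini') measurable
    also have "\<dots> = (\<integral>\<^sup>+x. (\<integral>\<^sup>+y. g y \<partial>lborel) * h (- L x) \<partial>lborel)"
      by (subst nn_integral_multc, measurable, subst nn_integral_lborel_translate') auto
    also have "\<dots> = N * (\<integral>\<^sup>+y. g y \<partial>lborel)"
      by (subst nn_integral_cmult) (auto simp: N_def mult.commute)
    finally show ?thesis .
  qed
  then have "(\<integral>\<^sup>+x. g (L x) \<partial>lborel) = N / H * (\<integral>\<^sup>+y. g y \<partial>lborel)"
    if "g \<in> borel_measurable borel" for g
    using that \<open>H \<noteq> 0\<close> \<open>H \<noteq> \<infinity>\<close>
    by (metis ennreal_mult_divide_eq ennreal_times_divide infinity_ennreal_def mult.commute)
  ultimately show ?thesis
    using that[of "N / H"] \<open>H \<noteq> 0\<close> \<open>H \<noteq> \<infinity>\<close>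
    by (simp add: ennreal_divide_eq_top_iff ennreal_divide_eq_0_iff)
qed

text \<open>The constant belonging to \<open>L\<close> is 1, because the indicator of the unit ball
  does not change and the ball has finite positive measure.\<close>

lemma nn_integral_isometry:
  fixes L :: "'a::euclidean_space \<Rightarrow> 'a"
  assumes L: "linear L" and norm: "\<And>x. norm (L x) = norm x"
    and f: "f \<in> borel_measurable borel"
  shows "(\<integral>\<^sup>+x. f (L x) \<partial>lborel) = (\<integral>\<^sup>+x. f x \<partial>lborel)"
proof -
  have "inj L" using norm L by (metis linear_injective_0 norm_eq_zero)
  then have "bij L" using L linear_injective_imp_surjective by (auto simp: bij_def)
  then obtain c where c: "\<And>f. f \<in> borel_measurable borel \<Longrightarrow> (\<integral>\<^sup>+x. f (L x) \<partial>lborel) = c * (\<integral>\<^sup>+y. f y \<partial>lborel)"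
    using nn_integral_linear_bij[OF L] by metis
  have "(\<integral>\<^sup>+x. indicator (ball 0 1) (L x) \<partial>lborel) = (\<integral>\<^sup>+x. indicator (ball 0 1 :: 'a set) x \<partial>lborel)"
    by (rule nn_integral_cong) (simp add: indicator_def norm)
  then have "emeasure lborel (ball 0 1 :: 'a set) = c * emeasure lborel (ball 0 1 :: 'a set)"
    using c[of "indicator (ball 0 1)"] by (simp add: borel_measurable_indicator)
  moreover have "emeasure lborel (ball 0 1 :: 'a set) \<noteq> 0" "emeasure lborel (ball 0 1 :: 'a set) \<noteq> \<infinity>"
    by (rule emeasure_lborel_open_nonzero[of _ 0], simp, simp)
      (rule emeasure_lborel_bounded_finite, simp, simp)
  ultimately have "c = 1"
    by (metis ennreal_mult_divide_eq infinity_ennreal_def mult_1 divide_eq_1_ennreal)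
  then show ?thesis using c[OF f] by simp
qed

lemma linear_matrix_mult:
  "linear (\<lambda>Z :: complex^'n^'m. Z ** A)" "linear (\<lambda>Z :: complex^'k^'l. B ** Z)"
  by (intro linearI; simp add: matrix_mult_add_left matrix_mult_add_right matrix_mult_scaleR_left matrix_mult_scaleR_right)+

lemma linear_ct: "linear (ct :: complex^'n^'m \<Rightarrow> _)"
  by (intro linearI) (simp_all add: ct_add ct_scaleR)

lemma Basis_matrix_eq:
  "(Basis :: (complex^'n^'m) set) = (\<lambda>(i, k, b). axis i (axis k b)) ` (UNIV \<times> UNIV \<times> Basis)"
  by (auto simp: Basis_vec_def image_iff) blast

text \<open>Column \<open>k\<close> has \<open>CARD('n)\<close> complex entries, hence twice as many
  real coordinates, each scaled by \<open>d $ k\<close>; this is the origin of the exponent.\<close>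

lemma nn_integral_matrix_diag:
  fixes f :: "complex^'q^'n \<Rightarrow> ennreal"
  assumes d: "\<And>k. 0 < d $ k" and [measurable]: "f \<in> borel_measurable borel"
  shows "(\<integral>\<^sup>+Z. f Z \<partial>lborel) = ennreal ((\<Prod>k\<in>UNIV. d $ k) ^ (2 * CARD('n))) * (\<integral>\<^sup>+Z. f (Z ** diag_matrix d) \<partial>lborel)"
proof -
  \<comment> \<open>A scaling factor is needed for each basis vector; this expression equals
    \<open>d $ k\<close> on \<open>axis i (axis k b)\<close> without decoding the indices.\<close>
  define c :: "complex^'q^'n \<Rightarrow> real" where "c j = (\<Sum>i\<in>UNIV. \<Sum>k\<in>UNIV. d $ k * (cmod (j $ i $ k))\<^sup>2)" for j
  have c: "c (axis i (axis k b)) = d $ k" if "b \<in> Basis" for i k and b :: complex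
  proof -
    have "c (axis i (axis k b)) = (\<Sum>i'\<in>UNIV. if i' = i then d $ k else 0)"
      unfolding c_def
    proof (intro sum.cong refl)
      fix i'
      show "(\<Sum>k'\<in>UNIV. d $ k' * (cmod (axis i (axis k b) $ i' $ k'))\<^sup>2) = (if i' = i then d $ k else 0)"
      proof (cases "i' = i")
        case True
        have "(\<Sum>k'\<in>UNIV. d $ k' * (cmod (axis i (axis k b) $ i' $ k'))\<^sup>2) = (\<Sum>k'\<in>UNIV. if k' = k then d $ k else 0)"
          using that by (intro sum.cong) (auto simp: True axis_def Basis_complex_def)
        then show ?thesis by (simp add: True)
      qed (simp add: axis_def)
    qed
    then show ?thesis by simp
  qed
  define T where "T = (\<lambda>x :: complex^'q^'n. 0 + (\<Sum>j\<in>Basis. (c j * (x \<bullet> j)) *\<^sub>R j))"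
  have T: "T Z = Z ** diag_matrix d" for Z
  proof (rule euclidean_eqI)
    fix j :: "complex^'q^'n" assume "j \<in> Basis"
    then obtain i k b where j: "j = axis i (axis k b)" "b \<in> Basis" by (auto simp: Basis_matrix_eq)
    have "T Z \<bullet> j = c j * (Z \<bullet> j)"
      using \<open>j \<in> Basis\<close> by (simp add: T_def inner_sum_left inner_Basis if_distrib cong: if_cong)
    also have "\<dots> = (d $ k *\<^sub>R (Z $ i $ k)) \<bullet> b"
      using j by (simp add: c inner_axis)
    also have "\<dots> = (Z ** diag_matrix d) \<bullet> j"
      by (simp add: j inner_axis matrix_mult_nth diag_matrix_def times_if scaleR_conv_of_real mult.commute cong: if_cong)
    finally show "T Z \<bullet> j = (Z ** diag_matrix d) \<bullet> j" .
  qed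
  have inj: "inj_on (\<lambda>(i, k, b). axis i (axis k b) :: complex^'q^'n) (UNIV \<times> UNIV \<times> Basis)"
    by (auto simp: inj_on_def axis_eq_axis)
  have "(\<Prod>j\<in>Basis. \<bar>c j\<bar>) = (\<Prod>(i, k, b)\<in>(UNIV::'n set) \<times> (UNIV::'q set) \<times> (Basis::complex set). d $ k)"
    unfolding Basis_matrix_eq prod.reindex[OF inj]
    by (intro prod.cong) (use d in \<open>auto simp: c less_imp_le\<close>)
  also have "\<dots> = (\<Prod>k\<in>UNIV. d $ k) ^ (2 * CARD('n))"
    by (simp add: prod.cartesian_product[symmetric] prod_power_distrib Basis_complex_def power_mult power2_eq_square prod.distrib)
  finally have prod: "(\<Prod>j\<in>Basis. \<bar>c j\<bar>) = (\<Prod>k\<in>UNIV. d $ k) ^ (2 * CARD('n))" .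
  have "lborel = density (distr lborel borel T) (\<lambda>_. ennreal (\<Prod>j\<in>Basis. \<bar>c j\<bar>))"
    unfolding T_def
  proof (rule lborel_affine_euclidean)
    fix j :: "complex^'q^'n" assume "j \<in> Basis"
    then show "c j \<noteq> 0" using c d by (auto simp: Basis_matrix_eq) (metis less_irrefl)
  qed
  then have "(\<integral>\<^sup>+Z. f Z \<partial>lborel) = (\<integral>\<^sup>+Z. f Z \<partial>density (distr lborel borel T) (\<lambda>_. ennreal (\<Prod>j\<in>Basis. \<bar>c j\<bar>)))"
    by simp
  also have "\<dots> = ennreal (\<Prod>j\<in>Basis. \<bar>c j\<bar>) * (\<integral>\<^sup>+Z. f (T Z) \<partial>lborel)"
  proof -
    have [measurable]: "T \<in> borel_measurable borel" unfolding T by measurable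
    show ?thesis
      by (subst nn_integral_density) (auto simp: nn_integral_distr nn_integral_cmult)
  qed
  finally show ?thesis by (simp add: prod T)
qed

text \<open>A singular value decomposition splits right multiplication into two isometries and a
  diagonal scaling, and \<open>cmod (det A)\<close> is the product of the singular values.\<close>

lemma nn_integral_matrix_right:
  fixes f :: "complex^'q^'n \<Rightarrow> ennreal" and A :: "complex^'q^'q"
  assumes A: "det A \<noteq> 0" and f [measurable]: "f \<in> borel_measurable borel"
  shows "(\<integral>\<^sup>+Z. f Z \<partial>lborel) = ennreal (cmod (det A) ^ (2 * CARD('n))) * (\<integral>\<^sup>+Z. f (Z ** A) \<partial>lborel)"
proof -
  obtain U d V where U: "U \<in> unitary_group" and V: "V \<in> unitary_group" and Aeq: "A = U ** diag_matrix d ** V"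
    and d: "\<And>i. 0 \<le> d $ i"
    using singular_value_decomposition'[of A] by metis
  have "det A = det U * of_real (\<Prod>i\<in>UNIV. d $ i) * det V"
    by (simp add: Aeq det_mul det_diag_matrix)
  then have detA: "cmod (det A) = (\<Prod>i\<in>UNIV. d $ i)"
    using U V d by (simp add: norm_mult norm_det_unitary prod_nonneg flip: of_real_prod)
  have "d $ k \<noteq> 0" for k
  proof
    assume "d $ k = 0"
    then have "(\<Prod>i\<in>UNIV. d $ i) = 0" by (intro prod_zero) auto
    then have "cmod (det A) = 0" unfolding detA .
    then show False using A by simp
  qed
  then have d': "\<And>k. 0 < d $ k" using d by (metis less_eq_real_def)
  have "(\<integral>\<^sup>+Z. f Z \<partial>lborel) = (\<integral>\<^sup>+Z. f (Z ** V) \<partial>lborel)"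
    using V by (intro nn_integral_isometry[symmetric] linear_matrix_mult f) auto
  also have "\<dots> = ennreal ((\<Prod>k\<in>UNIV. d $ k) ^ (2 * CARD('n))) * (\<integral>\<^sup>+Z. f (Z ** diag_matrix d ** V) \<partial>lborel)"
    by (intro nn_integral_matrix_diag d') measurable
  also have "(\<integral>\<^sup>+Z. f (Z ** diag_matrix d ** V) \<partial>lborel) = (\<integral>\<^sup>+Z. f (Z ** U ** diag_matrix d ** V) \<partial>lborel)"
    using U by (intro nn_integral_isometry[symmetric, where L = "\<lambda>Z. Z ** U"] linear_matrix_mult) auto
  finally show ?thesis
    unfolding detA by (simp add: Aeq matrix_mul_assoc)
qed

text \<open>The adjoint is an isometry that exchanges left and right multiplication.\<close>

lemma nn_integral_matrix_left:
  fixes f :: "complex^'q^'q \<Rightarrow> ennreal" and A :: "complex^'q^'q"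
  assumes A: "det A \<noteq> 0" and f [measurable]: "f \<in> borel_measurable borel"
  shows "(\<integral>\<^sup>+Z. f Z \<partial>lborel) = ennreal (cmod (det A) ^ (2 * CARD('q))) * (\<integral>\<^sup>+Z. f (A ** Z) \<partial>lborel)"
proof -
  have ct: "(\<integral>\<^sup>+Z. g (ct Z) \<partial>lborel) = (\<integral>\<^sup>+Z. g Z \<partial>lborel)"
    if "g \<in> borel_measurable borel" for g :: "complex^'q^'q \<Rightarrow> ennreal"
    using that by (intro nn_integral_isometry linear_ct) auto
  have "(\<integral>\<^sup>+Z. f Z \<partial>lborel) = (\<integral>\<^sup>+Z. f (ct Z) \<partial>lborel)"
    by (rule ct[symmetric]) measurable
  also have "\<dots> = ennreal (cmod (det (ct A)) ^ (2 * CARD('q))) * (\<integral>\<^sup>+Z. f (ct (Z ** ct A)) \<partial>lborel)"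
    using A by (intro nn_integral_matrix_right) (auto simp: det_ct)
  also have "(\<integral>\<^sup>+Z. f (ct (Z ** ct A)) \<partial>lborel) = (\<integral>\<^sup>+Z. f (A ** ct Z) \<partial>lborel)"
    by (simp add: ct_mult)
  also have "\<dots> = (\<integral>\<^sup>+Z. f (A ** Z) \<partial>lborel)"
    by (rule ct) measurable
  finally show ?thesis by (simp add: det_ct)
qed

section \<open>Hermitian and skew-Hermitian parts\<close>

definition herm :: "complex^'q^'q \<Rightarrow> complex^'q^'q"
  where "herm X = mat (1/2) ** (X + ct X)"

text \<open>This matrix is itself Hermitian; the skew-Hermitian part of \<open>X\<close> is
  \<open>\<i>\<close> times it.\<close>

definition skew :: "complex^'q^'q \<Rightarrow> complex^'q^'q"
  where "skew X = mat (- \<i> / 2) ** (X - ct X)"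

lemma ct_herm [simp]: "ct (herm X) = herm X"
  by (simp add: herm_def ct_mult ct_add vec_eq_iff mat_mult_nth mult_mat_nth add.commute)

lemma ct_skew [simp]: "ct (skew X) = skew X"
  by (simp add: skew_def ct_mult ct_diff vec_eq_iff mat_mult_nth mult_mat_nth algebra_simps)

lemma herm_skew: "X = herm X + mat \<i> ** skew X"
  by (simp add: vec_eq_iff herm_def skew_def mat_mult_nth) (simp add: field_simps)

lemma herm_skew_combine:
  assumes "ct S = S" "ct T = T"
  shows "herm (S + mat \<i> ** T) = S" "skew (S + mat \<i> ** T) = T"
proof -
  have "cnj (S $ j $ i) = S $ i $ j" "cnj (T $ j $ i) = T $ i $ j" for i j
    using arg_cong[OF assms(1), of "\<lambda>X. X $ i $ j"] arg_cong[OF assms(2), of "\<lambda>X. X $ i $ j"] by auto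
  then show "herm (S + mat \<i> ** T) = S" "skew (S + mat \<i> ** T) = T"
    by (simp_all add: vec_eq_iff herm_def skew_def mat_mult_nth)
qed

lemma herm_conj: "herm (ct A ** X ** A) = ct A ** herm X ** A"
  and skew_conj: "skew (ct A ** X ** A) = ct A ** skew X ** A"
proof -
  have *: "ct (ct A ** X ** A) = ct A ** ct X ** A" by (simp add: ct_mult matrix_mul_assoc)
  show "herm (ct A ** X ** A) = ct A ** herm X ** A"
    unfolding herm_def * by (simp only: matrix_mult_add_left[symmetric] matrix_mult_add_right[symmetric] matrix_mul_assoc mat_commute[of _ "ct A"])
  show "skew (ct A ** X ** A) = ct A ** skew X ** A"
    unfolding skew_def * by (simp only: matrix_mult_diff_left[symmetric] matrix_mult_diff_right[symmetric] matrix_mul_assoc mat_commute[of _ "ct A"])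
qed

lemma herm_add_hermitian: "ct H = H \<Longrightarrow> herm (X + H) = herm X + H" "ct H = H \<Longrightarrow> skew (X + H) = skew X"
  by (simp_all add: herm_def skew_def ct_add vec_eq_iff mat_mult_nth)

lemma linear_herm: "linear herm"
  by (intro linearI) (simp_all add: herm_def ct_add ct_scaleR vec_eq_iff mat_mult_nth algebra_simps)

lemma linear_skew: "linear skew"
  by (intro linearI) (simp_all add: skew_def ct_add ct_scaleR vec_eq_iff mat_mult_nth algebra_simps)

lemma borel_measurable_herm [measurable (raw)]: "f \<in> borel_measurable M \<Longrightarrow> (\<lambda>x. herm (f x)) \<in> borel_measurable M"
  and borel_measurable_skew [measurable (raw)]: "f \<in> borel_measurable M \<Longrightarrow> (\<lambda>x. skew (f x)) \<in> borel_measurable M"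
  using measurable_compose[OF _ borel_measurable_linear[OF linear_herm]]
    measurable_compose[OF _ borel_measurable_linear[OF linear_skew]] by blast+

lemma borel_measurable_skew_cball [measurable]:
  "(\<lambda>X. indicator (cball 0 1) (skew X) :: ennreal) \<in> borel_measurable borel"
  using measurable_compose[OF borel_measurable_linear[OF linear_skew], of "indicator (cball 0 1)" borel]
  by (simp add: borel_measurable_indicator borel_closed)

text \<open>The cross terms of the Gram matrix form a commutator, which has trace zero: the two
  parts are orthogonal.\<close>

lemma norm_herm_skew:
  assumes "ct S = S" "ct T = T"
  shows "(norm (S + mat \<i> ** T))\<^sup>2 = (norm S)\<^sup>2 + (norm T)\<^sup>2"
proof -
  have "ct (S + mat \<i> ** T) ** (S + mat \<i> ** T) = S ** S + T ** T + (S ** (mat \<i> ** T) - (mat \<i> ** T) ** S)"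
  proof -
    have c: "ct (S + mat \<i> ** T) = S - mat \<i> ** T"
      by (simp add: ct_add ct_mult assms vec_eq_iff mult_mat_nth mat_mult_nth)
    have "(mat \<i> ** T) ** (mat \<i> ** T) = - (T ** T)"
    proof -
      have "(mat \<i> ** T) ** (mat \<i> ** T) = mat \<i> ** mat \<i> ** (T ** T)"
        by (metis mat_commute matrix_mul_assoc)
      then show ?thesis by (simp add: mat_mult_mat vec_eq_iff mat_mult_nth)
    qed
    then show ?thesis
      unfolding c by (simp add: matrix_mult_diff_left matrix_mult_add_right)
  qed
  then have "complex_of_real ((norm (S + mat \<i> ** T))\<^sup>2) = trace (S ** S) + trace (T ** T) + (trace (S ** (mat \<i> ** T)) - trace ((mat \<i> ** T) ** S))"
    unfolding norm_sq_trace by (simp only: trace_add trace_sub)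
  also have "trace ((mat \<i> ** T) ** S) = trace (S ** (mat \<i> ** T))" by (rule trace_mul_sym)
  also have "trace (S ** S) = of_real ((norm S)\<^sup>2)" using norm_sq_trace[of S] assms by simp
  also have "trace (T ** T) = of_real ((norm T)\<^sup>2)" using norm_sq_trace[of T] assms by simp
  finally have "complex_of_real ((norm (S + mat \<i> ** T))\<^sup>2) = complex_of_real ((norm S)\<^sup>2 + (norm T)\<^sup>2)" by simp
  then show ?thesis by (simp only: of_real_eq_iff)
qed

lemma norm_sq_herm_skew: "(norm X)\<^sup>2 = (norm (herm X))\<^sup>2 + (norm (skew X))\<^sup>2"
  by (subst herm_skew) (simp add: norm_herm_skew)

lemma ennreal_square_cancel:
  fixes x y :: ennreal
  assumes "x * x = y * y"
  shows "x = y"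
proof (cases x; cases y)
  fix a b :: real assume ab: "0 \<le> a" "x = ennreal a" "0 \<le> b" "y = ennreal b"
  then have "a * a = b * b" using assms by (simp flip: ennreal_mult)
  then show ?thesis using ab by (auto simp: square_eq_iff)
qed (use assms in \<open>auto simp: ennreal_mult_eq_top_iff ennreal_top_mult ennreal_mult_top simp flip: ennreal_mult\<close>)

text \<open>On pairs \<open>(S + i T, S' + i T')\<close> the exchange of \<open>T\<close> and \<open>S'\<close> is an isometry. The resulting identity
  replaces the computation of the Jacobian of \<open>S \<mapsto> A* S A\<close> on Hermitian matrices.\<close>
lemma nn_integral_herm_skew_square:
  fixes a b :: "complex^'q^'q \<Rightarrow> ennreal"
  assumes [measurable]: "a \<in> borel_measurable borel" "b \<in> borel_measurable borel"
  shows "(\<integral>\<^sup>+X. a (herm X) * b (skew X) \<partial>lborel) * (\<integral>\<^sup>+X. a (herm X) * b (skew X) \<partial>lborel)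
    = (\<integral>\<^sup>+X. a (herm X) * a (skew X) \<partial>lborel) * (\<integral>\<^sup>+X. b (herm X) * b (skew X) \<partial>lborel)"
proof -
  have prod: "(\<integral>\<^sup>+X. u X \<partial>lborel) * (\<integral>\<^sup>+X. v X \<partial>lborel) = (\<integral>\<^sup>+P. u (fst P) * v (snd P) \<partial>lborel)"
    if [measurable]: "u \<in> borel_measurable borel" "v \<in> borel_measurable borel" for u v :: "complex^'q^'q \<Rightarrow> ennreal"
  proof -
    have "(\<integral>\<^sup>+P. u (fst P) * v (snd P) \<partial>lborel) = (\<integral>\<^sup>+P. u (fst P) * v (snd P) \<partial>(lborel \<Otimes>\<^sub>M lborel))"
      by (simp add: lborel_prod)
    also have "\<dots> = (\<integral>\<^sup>+X. (\<integral>\<^sup>+Y. u X * v Y \<partial>lborel) \<partial>lborel)"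
      by (subst lborel.nn_integral_fst[symmetric]) auto
    also have "\<dots> = (\<integral>\<^sup>+X. u X \<partial>lborel) * (\<integral>\<^sup>+X. v X \<partial>lborel)"
      by (simp add: nn_integral_cmult nn_integral_multc)
    finally show ?thesis by simp
  qed
  define \<sigma> where "\<sigma> = (\<lambda>P :: (complex^'q^'q) \<times> (complex^'q^'q). (herm (fst P) + mat \<i> ** herm (snd P), skew (fst P) + mat \<i> ** skew (snd P)))"
  have lin: "linear \<sigma>"
    by (intro linearI) (simp_all add: \<sigma>_def linear_add[OF linear_herm] linear_add[OF linear_skew]
        linear_scale[OF linear_herm] linear_scale[OF linear_skew] matrix_mult_add_right matrix_mult_scaleR_right algebra_simps)
  have norm: "norm (\<sigma> P) = norm P" for P
  proof -
    have "(norm (\<sigma> P))\<^sup>2 = (norm P)\<^sup>2"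
      using norm_sq_herm_skew[of "fst P"] norm_sq_herm_skew[of "snd P"]
      by (cases P) (simp add: \<sigma>_def norm_Pair norm_herm_skew)
    then show ?thesis by simp
  qed
  let ?f = "\<lambda>P. (a (herm (fst P)) * a (skew (fst P))) * (b (herm (snd P)) * b (skew (snd P)))"
  have [measurable]: "?f \<in> borel_measurable borel"
    unfolding borel_prod[symmetric] by measurable
  have "(\<integral>\<^sup>+X. a (herm X) * a (skew X) \<partial>lborel) * (\<integral>\<^sup>+X. b (herm X) * b (skew X) \<partial>lborel) = (\<integral>\<^sup>+P. ?f P \<partial>lborel)"
    by (rule prod) measurable
  also have "\<dots> = (\<integral>\<^sup>+P. ?f (\<sigma> P) \<partial>lborel)"
    by (rule nn_integral_isometry[symmetric]) (use lin norm in auto)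
  also have "\<dots> = (\<integral>\<^sup>+P. (a (herm (fst P)) * b (skew (fst P))) * (a (herm (snd P)) * b (skew (snd P))) \<partial>lborel)"
    by (intro nn_integral_cong) (simp add: \<sigma>_def herm_skew_combine mult_ac)
  also have "\<dots> = (\<integral>\<^sup>+X. a (herm X) * b (skew X) \<partial>lborel) * (\<integral>\<^sup>+X. a (herm X) * b (skew X) \<partial>lborel)"
    by (rule prod[symmetric]) measurable
  finally show ?thesis by simp
qed

text \<open>The map \<open>X \<mapsto> A* X A\<close> has Jacobian \<open>|det A| ^ (4 q)\<close>
  and acts alike on \<open>herm X\<close> and \<open>skew X\<close>. As the square of a mixed
  integral is a product of unmixed ones, each part accounts for the square root
  \<open>|det A| ^ (2 q)\<close>.\<close>

lemma nn_integral_herm_conj: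
  fixes g k :: "complex^'q^'q \<Rightarrow> ennreal" and A :: "complex^'q^'q"
  assumes A: "det A \<noteq> 0" and [measurable]: "g \<in> borel_measurable borel" "k \<in> borel_measurable borel"
  shows "(\<integral>\<^sup>+X. g (herm X) * k (skew X) \<partial>lborel) =
    ennreal (cmod (det A) ^ (2 * CARD('q))) * (\<integral>\<^sup>+X. g (ct A ** herm X ** A) * k (skew X) \<partial>lborel)"
proof -
  define gA where "gA = (\<lambda>S. g (ct A ** S ** A))"
  have [measurable]: "gA \<in> borel_measurable borel" unfolding gA_def by measurable
  define I where "I = (\<lambda>g k :: complex^'q^'q \<Rightarrow> ennreal. \<integral>\<^sup>+X. g (herm X) * k (skew X) \<partial>lborel)"
  define c where "c = ennreal (cmod (det A) ^ (2 * CARD('q)))"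
  have "I g g = c * (\<integral>\<^sup>+X. g (herm (X ** A)) * g (skew (X ** A)) \<partial>lborel)"
    unfolding I_def c_def by (rule nn_integral_matrix_right[OF A]) measurable
  also have "(\<integral>\<^sup>+X. g (herm (X ** A)) * g (skew (X ** A)) \<partial>lborel) =
    c * (\<integral>\<^sup>+X. g (herm (ct A ** X ** A)) * g (skew (ct A ** X ** A)) \<partial>lborel)"
    using nn_integral_matrix_left[of "ct A" "\<lambda>X. g (herm (X ** A)) * g (skew (X ** A))"] A
    by (simp add: c_def det_ct)
  finally have "I g g = c * c * I gA gA"
    by (simp add: I_def gA_def herm_conj skew_conj mult.assoc)
  then have "(c * I gA k) * (c * I gA k) = I g g * I k k"
    using nn_integral_herm_skew_square[of gA k] by (simp add: I_def mult_ac)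
  also have "\<dots> = I g k * I g k"
    using nn_integral_herm_skew_square[of g k] by (simp add: I_def)
  finally have "c * I gA k = I g k" by (rule ennreal_square_cancel)
  then show ?thesis by (simp add: I_def c_def gA_def)
qed

section \<open>Invariant measures on the cone of positive definite matrices\<close>

text \<open>The value 0 on singular matrices makes the inverse a total Borel function.\<close>

definition minv :: "complex^'q^'q \<Rightarrow> complex^'q^'q"
  where "minv A = (if det A = 0 then 0 else matrix_inv A)"

lemma minv_mult:
  assumes "det A \<noteq> 0"
  shows "minv A ** A = mat 1" "A ** minv A = mat 1" "minv A ** (A ** X) = X" "A ** (minv A ** X) = X"
    "Y ** A ** minv A = Y" "Y ** minv A ** A = Y"
proof -
  show 1: "minv A ** A = mat 1" "A ** minv A = mat 1"
    using assms by (simp_all add: minv_def matrix_inv_left matrix_inv_right)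
  show "minv A ** (A ** X) = X" "A ** (minv A ** X) = X"
    by (simp_all add: matrix_mul_assoc 1)
  show "Y ** A ** minv A = Y" "Y ** minv A ** A = Y"
    using 1 by (simp_all flip: matrix_mul_assoc)
qed

lemma det_minv:
  fixes A :: "complex^'q^'q"
  shows "det (minv A) = inverse (det A)"
proof -
  have "(0 :: complex^'q^'q) = mat 0" by (simp add: vec_eq_iff mat_nth)
  then have "det (0 :: complex^'q^'q) = 0" by (metis det_0)
  then show ?thesis by (simp add: minv_def det_matrix_inv)
qed

lemma minv_eqI: "det A \<noteq> 0 \<Longrightarrow> X ** A = mat 1 \<Longrightarrow> minv A = X"
  by (metis matrix_mul_lid minv_mult(5))

text \<open>Cramer's rule shows the inverse to be continuous on the open set of nonsingular
  matrices.\<close>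

lemma borel_measurable_minv [measurable (raw)]:
  fixes f :: "'a \<Rightarrow> complex^'q^'q"
  assumes "f \<in> borel_measurable M"
  shows "(\<lambda>x. minv (f x)) \<in> borel_measurable M"
proof -
  define G :: "complex^'q^'q \<Rightarrow> complex^'q^'q" where
    "G A = (\<chi> k l. det (\<chi> i j. if j = k then axis l 1 $ i else A $ i $ j) / det A)" for A
  have G: "minv A = indicator {A. det A \<noteq> 0} A *\<^sub>R G A" for A
  proof (cases "det A = 0")
    case False
    have "minv A $ k $ l = G A $ k $ l" for k l
    proof -
      have "A *v (minv A *v axis l 1) = axis l 1"
        by (simp add: matrix_vector_mul_assoc minv_mult[OF False])
      then have "minv A *v axis l 1 = (\<chi> k. det (\<chi> i j. if j = k then axis l 1 $ i else A $ i $ j) / det A)"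
        using cramer[OF False] by blast
      then show ?thesis
        by (metis (no_types, lifting) G_def matrix_vector_axis_nth mult.right_neutral vec_lambda_beta)
    qed
    then show ?thesis using False by (simp add: vec_eq_iff)
  qed (simp add: minv_def)
  have "(\<lambda>A. indicator {A. det A \<noteq> 0} A *\<^sub>R G A) \<in> borel_measurable borel"
  proof (rule borel_measurable_continuous_on_indicator)
    show "continuous_on {A. det A \<noteq> 0} G"
      unfolding G_def
    proof (intro continuous_intros)
      fix k l i j
      show "continuous_on {A. det A \<noteq> 0} (\<lambda>A :: complex^'q^'q. if j = k then axis l 1 $ i else A $ i $ j)"
        by (cases "j = k") (auto intro!: continuous_intros)
    qed auto
    show "{A :: complex^'q^'q. det A \<noteq> 0} \<in> sets borel"
      by (intro borel_open open_Collect_neq continuous_intros)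
  qed
  then have "(minv :: complex^'q^'q \<Rightarrow> _) \<in> borel_measurable borel"
    unfolding G[abs_def] .
  then show ?thesis by (rule measurable_compose[OF assms])
qed

definition pos_def :: "(complex^'q^'q) set"
  where "pos_def = {S. pos_semidef S \<and> det S \<noteq> 0}"

lemma continuous_on_cinner_mult [continuous_intros]:
  fixes f :: "'a::topological_space \<Rightarrow> complex^'q^'q"
  assumes "continuous_on X f"
  shows "continuous_on X (\<lambda>S. cinner x (f S *v x))"
  unfolding cinner_def matrix_vector_mult_nth by (intro continuous_intros assms)

lemma closed_pos_semidef: "closed {S :: complex^'q^'q. pos_semidef S}"
  unfolding pos_semidef_iff
  by (intro closed_Collect_conj closed_Collect_all closed_Collect_eq closed_Collect_le continuous_intros)

lemma pos_def_borel [measurable]: "pos_def \<in> sets borel"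
proof -
  have "{A :: complex^'q^'q. det A \<noteq> 0} \<in> sets borel"
    by (intro borel_open open_Collect_neq continuous_intros)
  moreover have "pos_def = {S :: complex^'q^'q. pos_semidef S} \<inter> {A. det A \<noteq> 0}"
    by (auto simp: pos_def_def)
  ultimately show ?thesis using closed_pos_semidef by (metis borel_closed sets.Int)
qed

lemma pos_def_root:
  assumes "S \<in> pos_def"
  obtains R where "pos_semidef R" "R ** R = S" "ct R = R" "det R \<noteq> 0"
proof -
  obtain R where R: "pos_semidef R" "R ** R = S"
    using assms pos_semidef_sqrt[of S] by (auto simp: pos_def_def)
  then have "det R \<noteq> 0" using assms by (auto simp: pos_def_def det_mul)
  then show ?thesis using that R by (auto simp: pos_semidef_iff)
qed

lemma gram_in_pos_def: "ct A ** A \<in> pos_def \<longleftrightarrow> det (ct A ** A) \<noteq> 0"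
  by (simp add: pos_def_def pos_semidef_gram)

lemma conj_in_pos_def:
  assumes "det A \<noteq> 0"
  shows "ct A ** S ** A \<in> pos_def \<longleftrightarrow> S \<in> pos_def"
proof
  assume *: "ct A ** S ** A \<in> pos_def"
  have "S = ct (minv A) ** (ct A ** S ** A) ** minv A"
  proof -
    have "ct (minv A) ** (ct A ** S ** A) ** minv A = ct (A ** minv A) ** S ** (A ** minv A)"
      by (simp only: ct_mult matrix_mul_assoc)
    then show ?thesis using minv_mult[OF assms] by simp
  qed
  then show "S \<in> pos_def"
    using * pos_semidef_conj[of "ct A ** S ** A" "minv A"] by (auto simp: pos_def_def det_mul)
qed (use assms pos_semidef_conj in \<open>auto simp: pos_def_def det_mul det_ct\<close>)

text \<open>As \<open>0 powr a = 0\<close> even for \<open>a = 0\<close>, this weight vanishes on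
  singular matrices for every exponent.\<close>

definition det_powr :: "complex^'q^'q \<Rightarrow> real \<Rightarrow> ennreal"
  where "det_powr A a = ennreal (cmod (det A) powr a)"

lemma borel_measurable_det_powr [measurable (raw)]:
  assumes [measurable]: "f \<in> borel_measurable M"
  shows "(\<lambda>x. det_powr (f x) a) \<in> borel_measurable M"
  unfolding det_powr_def by measurable

lemma det_powr_mult: "det_powr (A ** B) a = det_powr A a * det_powr B a"
  by (simp add: det_powr_def det_mul norm_mult powr_mult ennreal_mult)

lemma det_powr_add: "det_powr A (a + b) = det_powr A a * det_powr A b"
  by (simp add: det_powr_def powr_add ennreal_mult)

lemma det_powr_ct [simp]: "det_powr (ct A) a = det_powr A a"
  by (simp add: det_powr_def det_ct)

lemma det_powr_minus: "det A \<noteq> 0 \<Longrightarrow> det_powr A a * det_powr A (- a) = 1"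
  by (simp add: det_powr_def powr_minus flip: ennreal_mult)

lemma det_powr_0: "det A \<noteq> 0 \<Longrightarrow> det_powr A 0 = 1"
  by (simp add: det_powr_def)

lemma det_powr_singular: "det A = 0 \<Longrightarrow> det_powr A a = 0"
  by (simp add: det_powr_def)

lemma det_powr_nat: "det A \<noteq> 0 \<Longrightarrow> ennreal (cmod (det A) ^ n) = det_powr A (real n)"
  by (simp add: det_powr_def powr_realpow)

lemma det_powr_double: "det_powr (A ** A) a = det_powr A (2 * a)"
  by (simp add: det_powr_mult flip: det_powr_add)

text \<open>\<open>|det B| ^ (- 2 q) dB\<close> is a Haar measure of the general linear group; its
  image under the Gram matrix of the inverse is the measure on the cone invariant under
  \<open>S \<mapsto> A* S A\<close>.\<close>

definition cone_haar :: "(complex^'q^'q \<Rightarrow> ennreal) \<Rightarrow> ennreal"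
  where "cone_haar g = (\<integral>\<^sup>+B. det_powr B (- 2 * real CARD('q)) * g (ct (minv B) ** minv B) \<partial>lborel)"

text \<open>Uniqueness of relatively invariant measures on a homogeneous space of the general linear
  group: integrate \<open>g (s) h (B* s B)\<close> over \<open>s\<close> and over the group in both orders.\<close>
lemma cone_relatively_invariant:
  fixes s :: "'o \<Rightarrow> complex^'q^'q" and b :: "'o \<Rightarrow> ennreal" and r :: nat
  assumes sf: "sigma_finite_measure N"
    and [measurable]: "s \<in> borel_measurable N" "b \<in> borel_measurable N"
    and inv: "\<And>A g. det A \<noteq> 0 \<Longrightarrow> g \<in> borel_measurable borel \<Longrightarrow>
      (\<integral>\<^sup>+x. g (s x) * b x \<partial>N) = ennreal (cmod (det A) ^ (2 * r)) * (\<integral>\<^sup>+x. g (ct A ** s x ** A) * b x \<partial>N)"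
    and [measurable]: "g \<in> borel_measurable borel" "h \<in> borel_measurable borel"
    and g0: "\<And>S. S \<notin> pos_def \<Longrightarrow> g S = 0" and h0: "\<And>S. S \<notin> pos_def \<Longrightarrow> h S = 0"
  shows "(\<integral>\<^sup>+C. h (ct C ** C) * det_powr C (2 * real r - 2 * real CARD('q)) \<partial>lborel) *
      (\<integral>\<^sup>+x. g (s x) * det_powr (s x) (- real r) * b x \<partial>N)
    = cone_haar g * (\<integral>\<^sup>+x. h (s x) * b x \<partial>N)"
proof -
  interpret sigma_finite_measure N by fact
  interpret P: pair_sigma_finite N "lborel :: (complex^'q^'q) measure" ..
  let ?q = "real CARD('q)"
  define H where "H = (\<integral>\<^sup>+C. h (ct C ** C) * det_powr C (2 * real r - 2 * ?q) \<partial>lborel)"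
  \<comment> \<open>The weight in \<open>B\<close> is the Haar density times
    \<open>|det B| ^ (2 r)\<close>. Integrating over \<open>B\<close> first turns the extra factor
    into the power \<open>- r\<close> of \<open>det (s x)\<close>; substituting in \<open>x\<close>
    first cancels it by relative invariance.\<close>
  define J where "J = (\<integral>\<^sup>+x. (\<integral>\<^sup>+B. g (s x) * h (ct B ** s x ** B) * b x * det_powr B (2 * real r - 2 * ?q) \<partial>lborel) \<partial>N)"
  have "J = (\<integral>\<^sup>+x. H * (g (s x) * det_powr (s x) (- real r) * b x) \<partial>N)"
    unfolding J_def
  proof (rule nn_integral_cong)
    fix x assume x: "x \<in> space N"
    show "(\<integral>\<^sup>+B. g (s x) * h (ct B ** s x ** B) * b x * det_powr B (2 * real r - 2 * ?q) \<partial>lborel) =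
      H * (g (s x) * det_powr (s x) (- real r) * b x)"
    proof (cases "s x \<in> pos_def")
      case True
      then obtain A where A: "A ** A = s x" "ct A = A" "det A \<noteq> 0" by (rule pos_def_root)
      define I where "I = (\<integral>\<^sup>+B. h (ct B ** s x ** B) * det_powr B (2 * real r - 2 * ?q) \<partial>lborel)"
      have "H = det_powr A (2 * ?q) * (\<integral>\<^sup>+B. h (ct (A ** B) ** (A ** B)) * det_powr (A ** B) (2 * real r - 2 * ?q) \<partial>lborel)"
        unfolding H_def using A by (subst nn_integral_matrix_left[OF A(3)]) (auto simp: det_powr_nat)
      also have "(\<integral>\<^sup>+B. h (ct (A ** B) ** (A ** B)) * det_powr (A ** B) (2 * real r - 2 * ?q) \<partial>lborel) =
        (\<integral>\<^sup>+B. det_powr A (2 * real r - 2 * ?q) * (h (ct B ** s x ** B) * det_powr B (2 * real r - 2 * ?q)) \<partial>lborel)"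
        unfolding A(1)[symmetric] by (intro nn_integral_cong) (simp add: ct_mult A(2) matrix_mul_assoc det_powr_mult mult_ac)
      also have "\<dots> = det_powr A (2 * real r - 2 * ?q) * I"
        unfolding I_def by (rule nn_integral_cmult) measurable
      also have "det_powr A (2 * ?q) * \<dots> = det_powr A (2 * real r) * I"
        by (simp flip: mult.assoc det_powr_add)
      also have "det_powr A (2 * real r) = det_powr (s x) (real r)"
        unfolding A(1)[symmetric] by (simp add: det_powr_double)
      finally have HI: "H = det_powr (s x) (real r) * I" .
      have "det (s x) \<noteq> 0" using True by (simp add: pos_def_def)
      then have "H * det_powr (s x) (- real r) = I"
        unfolding HI using det_powr_minus[of "s x" "real r"] by (metis mult.commute mult.left_commute mult_1)
      moreover have "(\<integral>\<^sup>+B. g (s x) * h (ct B ** s x ** B) * b x * det_powr B (2 * real r - 2 * ?q) \<partial>lborel) = (g (s x) * b x) * I"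
        unfolding I_def by (subst nn_integral_cmult[symmetric]) (auto simp: mult_ac)
      ultimately show ?thesis by (metis mult.assoc mult.commute)
    qed (simp add: g0)
  qed
  also have "\<dots> = H * (\<integral>\<^sup>+x. g (s x) * det_powr (s x) (- real r) * b x \<partial>N)"
    by (rule nn_integral_cmult) measurable
  finally have J1: "J = H * (\<integral>\<^sup>+x. g (s x) * det_powr (s x) (- real r) * b x \<partial>N)" .
  have "J = (\<integral>\<^sup>+B. (\<integral>\<^sup>+x. g (s x) * h (ct B ** s x ** B) * b x * det_powr B (2 * real r - 2 * ?q) \<partial>N) \<partial>lborel)"
    unfolding J_def by (rule P.Fubini'[symmetric]) measurable
  also have "\<dots> = (\<integral>\<^sup>+B. (\<integral>\<^sup>+x. det_powr B (- 2 * ?q) * (g (ct (minv B) ** s x ** minv B) * h (s x) * b x) \<partial>N) \<partial>lborel)"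
  proof (rule nn_integral_cong)
    fix B :: "complex^'q^'q"
    show "(\<integral>\<^sup>+x. g (s x) * h (ct B ** s x ** B) * b x * det_powr B (2 * real r - 2 * ?q) \<partial>N) =
      (\<integral>\<^sup>+x. det_powr B (- 2 * ?q) * (g (ct (minv B) ** s x ** minv B) * h (s x) * b x) \<partial>N)"
    proof (cases "det B = 0")
      case False
      have BB: "ct (minv B) ** (ct B ** S ** B) ** minv B = S" for S
      proof -
        have "ct (minv B) ** (ct B ** S ** B) ** minv B = ct (B ** minv B) ** S ** (B ** minv B)"
          by (simp only: ct_mult matrix_mul_assoc)
        then show ?thesis using minv_mult[OF False] by simp
      qed
      have "(\<integral>\<^sup>+x. g (ct (minv B) ** s x ** minv B) * h (s x) * b x \<partial>N) =
        det_powr B (2 * real r) * (\<integral>\<^sup>+x. g (s x) * h (ct B ** s x ** B) * b x \<partial>N)"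
        using inv[OF False, of "\<lambda>S. g (ct (minv B) ** S ** minv B) * h S"]
        by (simp add: BB det_powr_nat[OF False])
      then have "det_powr B (- 2 * ?q) * (\<integral>\<^sup>+x. g (ct (minv B) ** s x ** minv B) * h (s x) * b x \<partial>N) =
        det_powr B (2 * real r - 2 * ?q) * (\<integral>\<^sup>+x. g (s x) * h (ct B ** s x ** B) * b x \<partial>N)"
        by (simp flip: mult.assoc det_powr_add)
      then show ?thesis
        by (subst nn_integral_cmult, measurable, subst nn_integral_multc, measurable) (simp add: mult.commute)
    qed (simp add: det_powr_singular)
  qed
  also have "\<dots> = (\<integral>\<^sup>+x. (\<integral>\<^sup>+B. det_powr B (- 2 * ?q) * (g (ct (minv B) ** s x ** minv B) * h (s x) * b x) \<partial>lborel) \<partial>N)"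
    by (rule P.Fubini') measurable
  also have "\<dots> = (\<integral>\<^sup>+x. cone_haar g * (h (s x) * b x) \<partial>N)"
  proof (rule nn_integral_cong)
    fix x assume x: "x \<in> space N"
    show "(\<integral>\<^sup>+B. det_powr B (- 2 * ?q) * (g (ct (minv B) ** s x ** minv B) * h (s x) * b x) \<partial>lborel) =
      cone_haar g * (h (s x) * b x)"
    proof (cases "s x \<in> pos_def")
      case True
      then obtain R where R: "R ** R = s x" "ct R = R" "det R \<noteq> 0" by (rule pos_def_root)
      have det: "det (minv R) \<noteq> 0" using R by (simp add: det_minv)
      \<comment> \<open>Replacing \<open>B\<close> by \<open>B ** minv R\<close> turns the inverse
        of \<open>B\<close> into \<open>R ** minv B\<close>, so that \<open>R R = s x\<close>
        appears in the middle of the Gram matrix.\<close>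
      have "cone_haar g = det_powr (minv R) (2 * ?q) *
        (\<integral>\<^sup>+B. det_powr (B ** minv R) (- 2 * ?q) * g (ct (minv (B ** minv R)) ** minv (B ** minv R)) \<partial>lborel)"
        unfolding cone_haar_def by (subst nn_integral_matrix_right[OF det]) (auto simp: det_powr_nat[OF det])
      also have "(\<integral>\<^sup>+B. det_powr (B ** minv R) (- 2 * ?q) * g (ct (minv (B ** minv R)) ** minv (B ** minv R)) \<partial>lborel) =
        (\<integral>\<^sup>+B. det_powr (minv R) (- 2 * ?q) * (det_powr B (- 2 * ?q) * g (ct (minv B) ** s x ** minv B)) \<partial>lborel)"
      proof (rule nn_integral_cong)
        fix B :: "complex^'q^'q"
        show "det_powr (B ** minv R) (- 2 * ?q) * g (ct (minv (B ** minv R)) ** minv (B ** minv R)) =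
          det_powr (minv R) (- 2 * ?q) * (det_powr B (- 2 * ?q) * g (ct (minv B) ** s x ** minv B))"
        proof (cases "det B = 0")
          case False
          have "minv (B ** minv R) = R ** minv B"
          proof (rule minv_eqI)
            show "det (B ** minv R) \<noteq> 0" using False det by (simp add: det_mul)
            have "R ** minv B ** (B ** minv R) = R ** (minv B ** B) ** minv R"
              by (simp only: matrix_mul_assoc)
            then show "R ** minv B ** (B ** minv R) = mat 1"
              using minv_mult(1)[OF False] minv_mult(2)[OF R(3)] by simp
          qed
          moreover have "ct (R ** minv B) ** (R ** minv B) = ct (minv B) ** s x ** minv B"
            by (simp only: ct_mult R(2) R(1)[symmetric] matrix_mul_assoc)
          ultimately show ?thesis by (simp add: det_powr_mult mult_ac)
        qed (simp add: det_powr_singular det_mul)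
      qed
      also have "\<dots> = det_powr (minv R) (- 2 * ?q) * (\<integral>\<^sup>+B. det_powr B (- 2 * ?q) * g (ct (minv B) ** s x ** minv B) \<partial>lborel)"
        by (rule nn_integral_cmult) measurable
      finally have "cone_haar g = (\<integral>\<^sup>+B. det_powr B (- 2 * ?q) * g (ct (minv B) ** s x ** minv B) \<partial>lborel)"
        using det_powr_minus[OF det, of "2 * ?q"] by (simp flip: mult.assoc)
      then show ?thesis
        by (simp only:) (subst nn_integral_multc[symmetric], auto simp: mult_ac)
    qed (simp add: h0)
  qed
  also have "\<dots> = cone_haar g * (\<integral>\<^sup>+x. h (s x) * b x \<partial>N)"
    by (rule nn_integral_cmult) measurable
  finally show ?thesis using J1 by (simp add: H_def)
qed

section \<open>Norm estimates, null sets and nondegenerate reference integrals\<close>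

lemma norm_cinner_le: "cmod (cinner x y) \<le> norm x * norm y"
proof -
  have "cmod (cinner x y) \<le> (\<Sum>i\<in>UNIV. \<bar>cmod (x $ i)\<bar> * \<bar>cmod (y $ i)\<bar>)"
    unfolding cinner_def by (rule order_trans[OF norm_sum]) (simp add: norm_mult)
  also have "\<dots> \<le> norm x * norm y"
    unfolding norm_vec_def by (rule L2_set_mult_ineq)
  finally show ?thesis .
qed

lemma norm_matrix_vector_le: "norm ((A :: complex^'n^'m) *v x) \<le> norm A * norm x"
proof -
  have "cmod ((A *v x) $ i) \<le> norm (A $ i) * norm x" for i
  proof -
    have "(A *v x) $ i = cinner (\<chi> j. cnj (A $ i $ j)) x"
      by (simp add: cinner_def matrix_vector_mult_nth)
    then show ?thesis
      using norm_cinner_le[of "\<chi> j. cnj (A $ i $ j)" x] by (simp add: norm_vec_def)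
  qed
  then have "norm (A *v x) \<le> L2_set (\<lambda>i. norm (A $ i) * norm x) UNIV"
    unfolding norm_vec_def[of "A *v x"] by (intro L2_set_mono) auto
  also have "\<dots> = norm A * norm x"
    by (simp add: norm_vec_def[of A] L2_set_left_distrib)
  finally show ?thesis .
qed

lemma mat_mult_vector: "mat c *v x = c *s (x :: complex^'n)"
  by (simp add: vec_eq_iff matrix_vector_mult_nth mat_nth if_times cong: if_cong)

lemma norm_mat_sq: "(norm (mat c :: complex^'q^'q))\<^sup>2 = real CARD('q) * (cmod c)\<^sup>2"
proof -
  have "(norm (mat c :: complex^'q^'q))\<^sup>2 = (\<Sum>i\<in>(UNIV::'q set). \<Sum>j\<in>(UNIV::'q set). if i = j then (cmod c)\<^sup>2 else 0)"
    unfolding norm_matrix_sq by (intro sum.cong refl) (simp add: mat_nth)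
  then show ?thesis by simp
qed

lemma norm_herm_le: "norm (herm X) \<le> norm X"
  by (rule power2_le_imp_le) (simp_all add: norm_sq_herm_skew[of X])

lemma herm_mat [simp]: "herm (mat (complex_of_real r)) = mat (of_real r)"
  and skew_mat [simp]: "skew (mat (complex_of_real r)) = 0"
  by (simp_all add: herm_def skew_def vec_eq_iff mat_mult_nth mat_nth)

text \<open>An error of norm below \<open>r\<close> cannot outweigh the form of \<open>r\<close>
  times the identity. This provides an open set on which the reference integrals are
  positive.\<close>

lemma herm_pos_def:
  assumes "dist (mat (complex_of_real r)) X < r"
  shows "herm X \<in> pos_def"
proof -
  define E where "E = herm (X - mat (of_real r))"
  have hX: "herm X = mat (of_real r) + E"
    by (simp add: E_def linear_diff[OF linear_herm])
  have E: "norm E < r"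
    using norm_herm_le[of "X - mat (of_real r)"] assms by (simp add: E_def dist_norm norm_minus_commute)
  have "0 < Re (cinner x (herm X *v x))" if "x \<noteq> 0" for x
  proof -
    have "cinner x (herm X *v x) = of_real (r * (norm x)\<^sup>2) + cinner x (E *v x)"
      by (simp add: hX matrix_vector_mult_add_rdistrib cinner_add_right mat_mult_vector cinner_smult_right cinner_self)
    moreover have "\<bar>Re (cinner x (E *v x))\<bar> \<le> norm x * (norm E * norm x)"
      by (meson abs_Re_le_cmod mult_left_mono norm_cinner_le norm_ge_zero norm_matrix_vector_le order_trans)
    moreover have "norm x * (norm E * norm x) < r * (norm x)\<^sup>2"
      using E that by (simp add: power2_eq_square)
    ultimately show ?thesis by simp
  qed
  then show ?thesis
    using pos_semidef_det_nz_iff[of "herm X"] by (simp add: pos_def_def)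
qed

lemma borel_measurable_trace [measurable (raw)]:
  fixes f :: "'a \<Rightarrow> complex^'n^'n"
  assumes "f \<in> borel_measurable M"
  shows "(\<lambda>x. trace (f x)) \<in> borel_measurable M"
  by (rule measurable_compose[OF assms borel_measurable_continuous_onI]) (intro continuous_intros)

lemma re_trace_gram: "Re (trace (ct C ** C)) = (norm C)\<^sup>2"
  using norm_sq_trace[of C] by (metis Re_complex_of_real)

lemma open_AE_notin:
  fixes U :: "'a::euclidean_space set"
  assumes "open U" "AE x in lborel. x \<notin> U"
  shows "x \<notin> U"
  using assms emeasure_lborel_open_nonzero AE_iff_null_sets[of U lborel] by (auto simp: null_sets_def)

text \<open>The determinant is polynomial in the shift and does not vanish at
  \<open>norm A + 1\<close>, where the identity term dominates \<open>A\<close>.\<close>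

lemma finite_singular_shifts:
  fixes A :: "complex^'q^'q"
  shows "finite {t :: real. det (A + mat (of_real t)) = 0}"
proof -
  define p where "p = char_polynomial (- A)"
  have poly: "poly p c = det (mat c + A)" for c
    unfolding p_def char_polynomial_def det_def
    by (simp add: poly_sum poly_prod mat_nth if_distrib[of "\<lambda>p. poly p c"] cong: if_cong)
  have "p \<noteq> 0"
  proof
    assume "p = 0"
    then have "det (mat (of_real (norm A + 1)) + A) = 0" using poly by simp
    then obtain x where x: "x \<noteq> 0" "(mat (of_real (norm A + 1)) + A) *v x = 0"
      by (auto simp: det_eq_0_iff_kernel)
    then have "complex_of_real (norm A + 1) *s x = - (A *v x)"
      by (simp add: matrix_vector_mult_add_rdistrib mat_mult_vector eq_neg_iff_add_eq_0)
    then have "norm (complex_of_real (norm A + 1) *s x) \<le> norm A * norm x"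
      using norm_matrix_vector_le[of A x] by (simp del: of_real_add)
    moreover have "complex_of_real (norm A + 1) *s x = (norm A + 1) *\<^sub>R x"
      by (simp add: vec_eq_iff, simp add: scaleR_conv_of_real algebra_simps)
    ultimately have "(norm A + 1) * norm x \<le> norm A * norm x" by simp
    then show False using x by simp
  qed
  then have "finite {c. poly p c = 0}" by (rule poly_roots_finite)
  moreover have "of_real ` {t :: real. det (A + mat (of_real t)) = 0} \<subseteq> {c. poly p c = 0}"
    by (auto simp: poly add.commute)
  ultimately have "finite (complex_of_real ` {t :: real. det (A + mat (of_real t)) = 0})"
    by (rule finite_subset[rotated])
  then show ?thesis by (rule finite_imageD) (simp add: inj_on_def)
qed

lemma isometry_exists:
  assumes "CARD('q) \<le> CARD('m)"
  obtains J :: "complex^'q^'m" where "ct J ** J = mat 1"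
proof -
  obtain f :: "'q \<Rightarrow> 'm" where f: "inj f"
    using card_le_inj[of "UNIV :: 'q set" "UNIV :: 'm set"] assms by auto
  define J :: "complex^'q^'m" where "J = (\<chi> a b. if a = f b then 1 else 0)"
  have "ct J ** J = mat 1"
    using f by (auto simp: vec_eq_iff matrix_mult_nth mat_nth J_def if_distrib[of cnj] if_times inj_eq cong: if_cong)
  then show ?thesis by (rule that)
qed

text \<open>Translations along an isometry \<open>J\<close> preserve Lebesgue measure, but for fixed
  \<open>Y\<close> only finitely many translates are singular. Averaging over translations with
  \<open>t\<close> in \<open>{0..1}\<close> and exchanging the integrals shows that the singular set
  is null.\<close>

lemma AE_gram_nonsingular:
  assumes mq: "CARD('q) \<le> CARD('m)"
  shows "AE Y in (lborel :: (complex^'q^'m) measure). det (ct Y ** Y) \<noteq> 0"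
proof -
  define N where "N = {Y :: complex^'q^'m. det (ct Y ** Y) = 0}"
  have N_closed: "closed N"
    unfolding N_def by (intro closed_Collect_eq continuous_intros)
  then have [measurable]: "N \<in> sets borel" by simp
  obtain J :: "complex^'q^'m" where J: "ct J ** J = mat 1" by (rule isometry_exists[OF mq])
  \<comment> \<open>A kernel vector of the Gram matrix is killed by \<open>Y + t J\<close>, hence by
    \<open>J* Y + t\<close>, which is a shift of a square matrix.\<close>
  have fin: "finite {t :: real. Y + t *\<^sub>R J \<in> N}" for Y
  proof (rule finite_subset[OF _ finite_singular_shifts[of "ct J ** Y"]], rule subsetI, simp only: mem_Collect_eq)
    fix t assume "Y + t *\<^sub>R J \<in> N"
    then obtain x where x: "x \<noteq> 0" "(ct (Y + t *\<^sub>R J) ** (Y + t *\<^sub>R J)) *v x = 0"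
      by (auto simp: N_def det_eq_0_iff_kernel)
    then have "(Y + t *\<^sub>R J) *v x = 0"
      using cinner_gram[of x "Y + t *\<^sub>R J"] by simp
    then have "ct J *v ((Y + t *\<^sub>R J) *v x) = 0" by simp
    moreover have "ct J ** (Y + t *\<^sub>R J) = ct J ** Y + mat (of_real t)"
      by (simp add: matrix_mult_add_right matrix_mult_scaleR_right J)
         (simp add: vec_eq_iff mat_nth, simp add: scaleR_conv_of_real)
    ultimately have "(ct J ** Y + mat (of_real t)) *v x = 0"
      by (simp add: matrix_vector_mul_assoc)
    then show "det (ct J ** Y + mat (of_real t)) = 0"
      using x by (auto simp: det_eq_0_iff_kernel)
  qed
  have "emeasure lborel N = (\<integral>\<^sup>+t. indicator {0..1::real} t * emeasure lborel N \<partial>lborel)"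
    by (subst nn_integral_multc) auto
  also have "\<dots> = (\<integral>\<^sup>+t. (\<integral>\<^sup>+Y. indicator {0..1::real} t * indicator N (Y + t *\<^sub>R J) \<partial>lborel) \<partial>lborel)"
  proof (rule nn_integral_cong)
    fix t :: real
    have "(\<integral>\<^sup>+Y. indicator {0..1::real} t * indicator N (Y + t *\<^sub>R J) \<partial>lborel) =
      indicator {0..1::real} t * (\<integral>\<^sup>+Y. indicator N (Y + t *\<^sub>R J) \<partial>lborel)"
      by (rule nn_integral_cmult) measurable
    also have "(\<integral>\<^sup>+Y. indicator N (Y + t *\<^sub>R J) \<partial>lborel) = (\<integral>\<^sup>+Y. indicator N Y \<partial>lborel)"
      by (rule nn_integral_lborel_translate') measurable
    finally show "indicator {0..1::real} t * emeasure lborel N = (\<integral>\<^sup>+Y. indicator {0..1::real} t * indicator N (Y + t *\<^sub>R J) \<partial>lborel)"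
      by simp
  qed
  also have "\<dots> = (\<integral>\<^sup>+Y. (\<integral>\<^sup>+t. indicator {0..1::real} t * indicator N (Y + t *\<^sub>R J) \<partial>lborel) \<partial>lborel)"
    by (rule lborel_pair.Fubini') measurable
  also have "\<dots> = (\<integral>\<^sup>+Y. 0 \<partial>(lborel :: (complex^'q^'m) measure))"
  proof (rule nn_integral_cong)
    fix Y :: "complex^'q^'m"
    have "(\<integral>\<^sup>+t. indicator {0..1::real} t * indicator N (Y + t *\<^sub>R J) \<partial>lborel) \<le>
      (\<integral>\<^sup>+t. indicator {t. Y + t *\<^sub>R J \<in> N} t \<partial>lborel)"
      by (intro nn_integral_mono) (auto simp: indicator_def)
    also have "\<dots> = emeasure lborel {t. Y + t *\<^sub>R J \<in> N}"
      using fin[of Y] by (intro nn_integral_indicator) (simp add: finite_imp_closed borel_closed)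
    also have "\<dots> = 0"
      using fin[of Y] by (intro emeasure_lborel_countable countable_finite)
    finally show "(\<integral>\<^sup>+t. indicator {0..1::real} t * indicator N (Y + t *\<^sub>R J) \<partial>lborel) = 0" by simp
  qed
  finally have "emeasure lborel N = 0" by simp
  then show ?thesis
    by (subst AE_iff_measurable[OF _ refl]) (auto simp: N_def)
qed

text \<open>A reference set of finite positive mass for both integrals to be compared. The trace
  bound controls \<open>C\<close> when \<open>S = C* C\<close>, the norm bound controls Hermitian
  parts, and with \<open>q + 1\<close> the identity, of norm \<open>sqrt q\<close> and trace
  \<open>q\<close>, satisfies both strictly.\<close>

definition bounded_cone :: "(complex^'q^'q) set"
  where "bounded_cone = {S \<in> pos_def. norm S \<le> real CARD('q) + 1 \<and> Re (trace S) \<le> real CARD('q) + 1}"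

lemma bounded_cone_borel [measurable]: "bounded_cone \<in> sets borel"
  unfolding bounded_cone_def by measurable

lemma bounded_cone_gram_integral:
  assumes n: "CARD('q) \<le> n"
  defines "I \<equiv> (\<integral>\<^sup>+C. indicator bounded_cone (ct C ** C) * det_powr C (2 * real n - 2 * real CARD('q)) \<partial>(lborel :: (complex^'q^'q) measure))"
  shows "I \<noteq> 0" "I \<noteq> \<infinity>"
proof -
  let ?b = "real CARD('q) + 1" and ?e = "2 * real n - 2 * real CARD('q)"
  have "bounded ((\<lambda>C. cmod (det C)) ` (cball 0 ?b :: (complex^'q^'q) set))"
    by (intro compact_imp_bounded compact_continuous_image continuous_intros compact_cball)
  then obtain K where "\<forall>C\<in>cball 0 ?b :: (complex^'q^'q) set. cmod (det C) \<le> K"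
    by (auto simp: bounded_iff)
  then have K: "\<And>C :: complex^'q^'q. norm C \<le> ?b \<Longrightarrow> cmod (det C) \<le> K"
    by simp
  have "I \<le> (\<integral>\<^sup>+C. ennreal (K powr ?e) * indicator (cball 0 ?b) C \<partial>(lborel :: (complex^'q^'q) measure))"
    unfolding I_def
  proof (rule nn_integral_mono)
    fix C :: "complex^'q^'q"
    show "indicator bounded_cone (ct C ** C) * det_powr C ?e \<le> ennreal (K powr ?e) * indicator (cball 0 ?b) C"
    proof (cases "ct C ** C \<in> bounded_cone")
      case True
      then have "(norm C)\<^sup>2 \<le> ?b" by (simp add: bounded_cone_def re_trace_gram)
      also have "\<dots> \<le> ?b\<^sup>2" by (rule self_le_power) simp_all
      finally have C: "norm C \<le> ?b" by (rule power2_le_imp_le) simp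
      show ?thesis
        using C True n by (simp add: det_powr_def ennreal_leI powr_mono2 K)
    qed simp
  qed
  also have "\<dots> = ennreal (K powr ?e) * emeasure lborel (cball 0 ?b :: (complex^'q^'q) set)"
    by (rule nn_integral_cmult_indicator) simp
  also have "\<dots> < \<infinity>"
    using emeasure_lborel_cball_finite[of "0 :: complex^'q^'q" ?b] by (simp add: ennreal_mult_less_top)
  finally show "I \<noteq> \<infinity>" by auto
  let ?U = "{C :: complex^'q^'q. norm (ct C ** C) < ?b \<and> Re (trace (ct C ** C)) < ?b}"
  have op: "open ?U"
    by (intro open_Collect_conj open_Collect_less continuous_intros)
  show "I \<noteq> 0"
  proof
    assume "I = 0"
    then have "AE C in (lborel :: (complex^'q^'q) measure). indicator bounded_cone (ct C ** C) * det_powr C ?e = 0"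
      unfolding I_def by (subst (asm) nn_integral_0_iff_AE) auto
    with AE_gram_nonsingular[where ?'m = 'q and ?'q = 'q, OF order_refl] have "AE C in lborel. C \<notin> ?U"
      by eventually_elim (auto simp: bounded_cone_def gram_in_pos_def det_mul det_ct det_powr_def indicator_def)
    moreover have "0 \<in> ?U" by (simp add: trace_def)
    ultimately show False using open_AE_notin[OF op] by blast
  qed
qed

lemma bounded_cone_herm_integral:
  defines "I \<equiv> (\<integral>\<^sup>+X. indicator bounded_cone (herm X) * indicator (cball 0 1) (skew X) \<partial>(lborel :: (complex^'q^'q) measure))"
  shows "I \<noteq> 0" "I \<noteq> \<infinity>"
proof -
  let ?b = "real CARD('q) + 1"
  have "I \<le> (\<integral>\<^sup>+X. indicator (cball 0 (?b + 1)) X \<partial>(lborel :: (complex^'q^'q) measure))"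
    unfolding I_def
  proof (rule nn_integral_mono)
    fix X :: "complex^'q^'q"
    have "norm X \<le> ?b + 1" if "norm (herm X) \<le> ?b" "norm (skew X) \<le> 1"
    proof -
      have "(norm X)\<^sup>2 \<le> ?b\<^sup>2 + 1"
        unfolding norm_sq_herm_skew[of X] using that by (intro add_mono power_mono power_le_one) auto
      also have "\<dots> \<le> (?b + 1)\<^sup>2" by (simp add: power2_sum)
      finally show ?thesis by (rule power2_le_imp_le) simp
    qed
    then show "indicator bounded_cone (herm X) * indicator (cball 0 1) (skew X) \<le> (indicator (cball 0 (?b + 1)) X :: ennreal)"
      by (auto simp: indicator_def bounded_cone_def)
  qed
  also have "\<dots> < \<infinity>"
    using emeasure_lborel_cball_finite[of "0 :: complex^'q^'q" "?b + 1"] by simp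
  finally show "I \<noteq> \<infinity>" by auto
  let ?U = "{X :: complex^'q^'q. dist (mat (of_real 1)) X < 1 \<and> norm (herm X) < ?b \<and> norm (skew X) < 1 \<and> Re (trace (herm X)) < ?b}"
  have cont: "continuous_on UNIV (herm :: complex^'q^'q \<Rightarrow> _)" "continuous_on UNIV (skew :: complex^'q^'q \<Rightarrow> _)"
    using linear_herm linear_skew by (auto intro!: linear_continuous_on simp: linear_conv_bounded_linear)
  have op: "open ?U"
    by (intro open_Collect_conj open_Collect_less continuous_intros cont)
  show "I \<noteq> 0"
  proof
    assume "I = 0"
    then have "AE X in (lborel :: (complex^'q^'q) measure). indicator bounded_cone (herm X) * indicator (cball 0 1) (skew X) = (0 :: ennreal)"
      unfolding I_def by (subst (asm) nn_integral_0_iff_AE) auto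
    then have "AE X in lborel. X \<notin> ?U"
      by (rule AE_mp) (use herm_pos_def[of 1] in \<open>auto simp: bounded_cone_def indicator_def intro!: AE_I2 split: if_splits\<close>)
    moreover have "norm (mat 1 :: complex^'q^'q) < ?b"
      by (rule power2_less_imp_less) (simp_all add: norm_mat_sq power2_sum add_nonneg_pos)
    then have "mat (of_real 1) \<in> ?U"
      by (simp only: mem_Collect_eq herm_mat skew_mat) (simp add: trace_def mat_nth)
    ultimately show False using open_AE_notin[OF op] by blast
  qed
qed

lemma ennreal_mult_cancel_finite:
  fixes a x y :: ennreal
  assumes "a \<noteq> 0" "a \<noteq> \<infinity>" "a * x = y"
  shows "x = y / a"
  using assms by (metis ennreal_mult_divide_eq infinity_ennreal_def mult.commute)

text \<open>Lebesgue measure on the Hermitian matrices is encoded as the law of \<open>herm X\<close> for \<open>X\<close> with skew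
  part in the unit ball.\<close>
lemma gram_integral_herm:
  assumes mq: "CARD('q) \<le> CARD('m)"
  shows "\<exists>C. \<forall>g\<in>borel_measurable borel. (\<forall>S. S \<notin> pos_def \<longrightarrow> g S = 0) \<longrightarrow>
    (\<integral>\<^sup>+Y. g (ct Y ** Y) \<partial>(lborel :: (complex^'q^'m) measure)) =
    C * (\<integral>\<^sup>+X. g (herm X) * det_powr (herm X) (real CARD('m) - real CARD('q)) * indicator (cball 0 1) (skew X) \<partial>lborel)"
proof -
  let ?L = "lborel :: (complex^'q^'m) measure"
  let ?m = "real CARD('m)" and ?q = "real CARD('q)"
  let ?h = "indicator bounded_cone :: complex^'q^'q \<Rightarrow> ennreal"
  let ?k = "\<lambda>X :: complex^'q^'q. indicator (cball 0 1) (skew X) :: ennreal"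
  define H where "H n = (\<integral>\<^sup>+C. ?h (ct C ** C) * det_powr C (2 * real n - 2 * ?q) \<partial>lborel)" for n
  have H: "H n \<noteq> 0" "H n \<noteq> \<infinity>" if "CARD('q) \<le> n" for n
    using bounded_cone_gram_integral[OF that] by (auto simp: H_def)
  define t where "t = (\<integral>\<^sup>+Y. ?h (ct Y ** Y) \<partial>?L)"
  define l where "l = (\<integral>\<^sup>+X. ?h (herm X) * ?k X \<partial>lborel)"
  have l: "l \<noteq> 0" "l \<noteq> \<infinity>"
    using bounded_cone_herm_integral[where ?'q = 'q] by (auto simp: l_def)
  have h0: "\<And>S. S \<notin> pos_def \<Longrightarrow> ?h S = 0" by (simp add: bounded_cone_def)
  have [measurable]: "?h \<in> borel_measurable borel" by (rule borel_measurable_indicator) measurable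
  show ?thesis
  \<comment> \<open>The constant results from eliminating \<open>cone_haar G\<close> between the two
    applications of the uniqueness lemma, to Gram matrices and to Hermitian parts.\<close>
  proof (intro exI[of _ "t / H CARD('m) * (H CARD('q) / l)"] ballI impI)
    fix g :: "complex^'q^'q \<Rightarrow> ennreal"
    assume [measurable]: "g \<in> borel_measurable borel" and "\<forall>S. S \<notin> pos_def \<longrightarrow> g S = 0"
    then have g0: "\<And>S. S \<notin> pos_def \<Longrightarrow> g S = 0" by blast
    \<comment> \<open>The exponent \<open>m\<close> cancels the power \<open>- m\<close> produced
      for Gram matrices and leaves \<open>m - q\<close> after the power \<open>- q\<close> produced
      for Hermitian parts.\<close>
    define G where "G S = g S * det_powr S ?m" for S
    have [measurable]: "G \<in> borel_measurable borel" unfolding G_def by measurable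
    have G0: "\<And>S. S \<notin> pos_def \<Longrightarrow> G S = 0" by (simp add: G_def g0)
    have Gdet: "G S * det_powr S a = g S * det_powr S (?m + a)" for S a
      by (simp add: G_def det_powr_add mult.assoc)
    have "H CARD('m) * (\<integral>\<^sup>+Y. G (ct Y ** Y) * det_powr (ct Y ** Y) (- ?m) * 1 \<partial>?L) =
      cone_haar G * (\<integral>\<^sup>+Y. ?h (ct Y ** Y) * 1 \<partial>?L)"
      unfolding H_def
    proof (rule cone_relatively_invariant)
      fix A :: "complex^'q^'q" and f :: "complex^'q^'q \<Rightarrow> ennreal"
      assume A: "det A \<noteq> 0" and [measurable]: "f \<in> borel_measurable borel"
      have "(\<integral>\<^sup>+Y. f (ct Y ** Y) \<partial>?L) =
        ennreal (cmod (det A) ^ (2 * CARD('m))) * (\<integral>\<^sup>+Y. f (ct (Y ** A) ** (Y ** A)) \<partial>?L)"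
        by (rule nn_integral_matrix_right[OF A]) measurable
      then show "(\<integral>\<^sup>+Y. f (ct Y ** Y) * 1 \<partial>?L) =
        ennreal (cmod (det A) ^ (2 * CARD('m))) * (\<integral>\<^sup>+Y. f (ct A ** (ct Y ** Y) ** A) * 1 \<partial>?L)"
        by (simp add: ct_mult matrix_mul_assoc)
    qed (use G0 h0 in \<open>auto intro: lborel.sigma_finite_measure_axioms\<close>)
    moreover have "G S * det_powr S (- ?m) = g S" for S
      using g0[of S] by (cases "S \<in> pos_def") (auto simp: Gdet det_powr_0 pos_def_def)
    ultimately have 1: "H CARD('m) * (\<integral>\<^sup>+Y. g (ct Y ** Y) \<partial>?L) = cone_haar G * t"
      by (simp add: t_def)
    have "H CARD('q) * (\<integral>\<^sup>+X. G (herm X) * det_powr (herm X) (- ?q) * ?k X \<partial>lborel) =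
      cone_haar G * (\<integral>\<^sup>+X. ?h (herm X) * ?k X \<partial>lborel)"
      unfolding H_def
    proof (rule cone_relatively_invariant)
      fix A :: "complex^'q^'q" and f :: "complex^'q^'q \<Rightarrow> ennreal"
      assume A: "det A \<noteq> 0" and [measurable]: "f \<in> borel_measurable borel"
      show "(\<integral>\<^sup>+X. f (herm X) * ?k X \<partial>lborel) =
        ennreal (cmod (det A) ^ (2 * CARD('q))) * (\<integral>\<^sup>+X. f (ct A ** herm X ** A) * ?k X \<partial>lborel)"
        by (rule nn_integral_herm_conj[OF A]) (auto intro!: borel_measurable_indicator borel_closed)
    qed (use G0 h0 in \<open>auto intro: lborel.sigma_finite_measure_axioms\<close>)
    then have 2: "H CARD('q) * (\<integral>\<^sup>+X. g (herm X) * det_powr (herm X) (?m - ?q) * ?k X \<partial>lborel) = cone_haar G * l"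
      by (simp add: l_def Gdet)
    define L where "L = (\<integral>\<^sup>+X. g (herm X) * det_powr (herm X) (?m - ?q) * ?k X \<partial>lborel)"
    have "cone_haar G = H CARD('q) * L / l"
      using 2 l by (intro ennreal_mult_cancel_finite) (auto simp: L_def mult.commute)
    moreover have "(\<integral>\<^sup>+Y. g (ct Y ** Y) \<partial>?L) = cone_haar G * t / H CARD('m)"
      using 1 H[OF mq] by (intro ennreal_mult_cancel_finite) auto
    ultimately show "(\<integral>\<^sup>+Y. g (ct Y ** Y) \<partial>?L) = t / H CARD('m) * (H CARD('q) / l) * L"
      by (simp add: divide_ennreal_def mult_ac)
  qed
qed

section \<open>The law of a block of a random unitary matrix\<close>

text \<open>Squaring is a continuous injection on the compact set of positive semidefinite matrices
  of norm at most 1, so its inverse is continuous on the image. A root \<open>R\<close> of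
  \<open>S\<close> has squared norm \<open>Re (trace S)\<close>, whence the trace bound.\<close>

lemma measurable_pos_semidef_sqrt:
  obtains P :: "complex^'q^'q \<Rightarrow> complex^'q^'q" where "P \<in> borel_measurable borel"
    "\<And>S. pos_semidef S \<Longrightarrow> Re (trace S) \<le> 1 \<Longrightarrow> pos_semidef (P S) \<and> P S ** P S = S"
proof -
  define K where "K = {R :: complex^'q^'q. pos_semidef R} \<inter> cball 0 1"
  have K: "compact K" unfolding K_def by (rule closed_Int_compact[OF closed_pos_semidef compact_cball])
  define f where "f R = R ** R" for R :: "complex^'q^'q"
  define g where "g = the_inv_into K f"
  have inj: "inj_on f K"
    unfolding inj_on_def f_def K_def using pos_semidef_sq_unique by blast
  have cont: "continuous_on K f" unfolding f_def by (intro continuous_intros)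
  have gf: "\<forall>x\<in>K. g (f x) = x" unfolding g_def using inj by (simp add: the_inv_into_f_f)
  have "continuous_on (f ` K) g"
    using cont K gf by (rule continuous_on_inv)
  moreover have "f ` K \<in> sets borel"
    using compact_continuous_image[OF cont K] by (simp add: borel_compact)
  ultimately have "(\<lambda>S. indicator (f ` K) S *\<^sub>R g S) \<in> borel_measurable borel"
    by (rule borel_measurable_continuous_on_indicator[rotated])
  moreover have "pos_semidef (indicator (f ` K) S *\<^sub>R g S) \<and> (indicator (f ` K) S *\<^sub>R g S) ** (indicator (f ` K) S *\<^sub>R g S) = S"
    if S: "pos_semidef S" "Re (trace S) \<le> 1" for S
  proof -
    obtain R where R: "pos_semidef R" "R ** R = S"
      using pos_semidef_sqrt[OF S(1)] by metis
    then have "(norm R)\<^sup>2 \<le> 1\<^sup>2"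
      using S(2) re_trace_gram[of R] by (simp add: pos_semidef_iff)
    then have "norm R \<le> 1" by (rule power2_le_imp_le) simp
    then have "R \<in> K" "f R = S" using R by (auto simp: K_def f_def)
    then have "indicator (f ` K) S *\<^sub>R g S = R" using gf by (auto simp: indicator_def)
    then show ?thesis using R by simp
  qed
  ultimately show ?thesis using that by blast
qed

abbreviation corner :: "complex^('a::finite + 'b::finite)^('a + 'b) \<Rightarrow> complex^'b^'b"
  where "corner u \<equiv> ct inr_mat ** u ** inr_mat"

text \<open>Lebesgue measure on the tall matrices \<open>Z\<close> is invariant under left multiplication by unitary matrices, so for
  \<open>Z\<close> with last block \<open>y\<close> and \<open>S = Z* Z\<close> the matrix \<open>y S^(-1/2)\<close> has the law of the block and is
  independent of \<open>S\<close>; on the other hand its law can be read off from the law of \<open>S - y* y\<close>.\<close>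
lemma corner_law:
  fixes M :: "'k measure" and u :: "'k \<Rightarrow> complex^('m::finite + 'q::finite)^('m + 'q)"
  assumes M: "finite_measure M" "emeasure M (space M) = 1" and [measurable]: "u \<in> borel_measurable M"
    and unitary: "\<And>k. k \<in> space M \<Longrightarrow> u k \<in> unitary_group"
    and inv: "\<And>U F. U \<in> unitary_group \<Longrightarrow> F \<in> borel_measurable borel \<Longrightarrow>
      (\<integral>\<^sup>+k. F (u k ** U) \<partial>M) = (\<integral>\<^sup>+k. F (u k) \<partial>M)"
    and mq: "CARD('q) \<le> CARD('m)"
  shows "\<exists>c. \<forall>f\<in>borel_measurable borel.
    (\<integral>\<^sup>+k. f (corner (u k)) \<partial>M) = c * (\<integral>\<^sup>+w. f w * (indicator pos_def (mat 1 - ct w ** w) *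
      det_powr (mat 1 - ct w ** w) (real CARD('m) - real CARD('q))) \<partial>lborel)"
proof -
  interpret finite_measure M by fact
  interpret PM: pair_sigma_finite M "lborel :: (complex^'q^('m + 'q)) measure" ..
  let ?m = "real CARD('m)" and ?q = "real CARD('q)"
  let ?L = "lborel :: (complex^'q^'m) measure" and ?LZ = "lborel :: (complex^'q^('m + 'q)) measure"
  let ?E = "inr_mat :: complex^'q^('m + 'q)"
  obtain P :: "complex^'q^'q \<Rightarrow> complex^'q^'q" where P_meas [measurable]: "P \<in> borel_measurable borel"
    and P: "\<And>S. pos_semidef S \<Longrightarrow> Re (trace S) \<le> 1 \<Longrightarrow> pos_semidef (P S) \<and> P S ** P S = S"
    by (rule measurable_pos_semidef_sqrt) blast
  \<comment> \<open>For \<open>S = Z* Z\<close> the trace bound says \<open>norm Z \<le> 1\<close>: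
    this keeps the mass \<open>Np\<close> finite and stays where \<open>P\<close> is a root.\<close>
  define A where "A = {S :: complex^'q^'q. S \<in> pos_def \<and> Re (trace S) \<le> 1}"
  have [measurable]: "A \<in> sets borel" unfolding A_def by measurable
  have PA: "ct (P S) = P S" "P S ** P S = S" "det (P S) \<noteq> 0" if "S \<in> A" for S
  proof -
    have "pos_semidef S" "Re (trace S) \<le> 1" "det S \<noteq> 0"
      using that by (auto simp: A_def pos_def_def)
    then have *: "pos_semidef (P S)" "P S ** P S = S" "det S \<noteq> 0" using P by auto
    then show "ct (P S) = P S" "P S ** P S = S" by (auto simp: pos_semidef_iff)
    show "det (P S) \<noteq> 0" using * by (metis det_mul mult_zero_left)
  qed
  define Np where "Np = (\<integral>\<^sup>+Z. indicator A (ct Z ** Z) \<partial>?LZ)"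
  have "Np = (\<integral>\<^sup>+Z. indicator (cball 0 1) Z \<partial>?LZ)"
    unfolding Np_def
  proof (rule nn_integral_cong_AE)
    have "CARD('q) \<le> CARD('m + 'q)" by simp
    then have "AE Z in ?LZ. det (ct Z ** Z) \<noteq> 0"
      by (rule AE_gram_nonsingular)
    then show "AE Z in ?LZ. indicator A (ct Z ** Z) = (indicator (cball 0 1) Z :: ennreal)"
      by (rule AE_mp) (auto simp: A_def gram_in_pos_def re_trace_gram indicator_def abs_square_le_1 intro!: AE_I2)
  qed
  then have Np: "Np = emeasure lborel (cball 0 1 :: (complex^'q^('m + 'q)) set)" by simp
  have Np: "Np \<noteq> 0" "Np \<noteq> \<infinity>"
  proof -
    have "emeasure lborel (ball 0 1 :: (complex^'q^('m + 'q)) set) \<le> Np"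
      unfolding Np by (intro emeasure_mono) auto
    moreover have "emeasure lborel (ball 0 1 :: (complex^'q^('m + 'q)) set) \<noteq> 0"
      by (rule emeasure_lborel_open_nonzero[of _ 0]) auto
    ultimately show "Np \<noteq> 0" by (metis le_zero_eq)
    show "Np \<noteq> \<infinity>" unfolding Np
      using emeasure_lborel_cball_finite[of "0 :: complex^'q^('m + 'q)" 1] by auto
  qed
  define L where "L = (\<lambda>p :: (complex^'q^'q) \<times> (complex^'q^'m). inl_mat ** snd p + ?E ** fst p)"
  have L_simps: "ct ?E ** L (y, Y) = y" "ct (L (y, Y)) ** L (y, Y) = ct Y ** Y + ct y ** y" for y Y
    by (simp_all add: L_def matrix_mult_add_left matrix_mult_add_right ct_add ct_mult flip: matrix_mul_assoc)
  have L: "linear L"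
    by (intro linearI) (simp_all add: L_def matrix_mult_add_right matrix_mult_scaleR_right algebra_simps)
  have "bij L"
  proof (rule bij_betw_byWitness[where f' = "\<lambda>Z. (ct ?E ** Z, ct inl_mat ** Z)"])
    show "\<forall>p\<in>UNIV. (ct ?E ** L p, ct inl_mat ** L p) = p"
      by (auto simp: L_def matrix_mult_add_right)
    show "\<forall>Z\<in>UNIV. L (ct ?E ** Z, ct inl_mat ** Z) = Z"
      by (auto simp: L_def sum_matrix_eq_iff matrix_mult_add_right)
  qed auto
  then obtain c0 where c0: "c0 \<noteq> 0" "c0 \<noteq> \<infinity>"
    and split: "\<And>f. f \<in> borel_measurable borel \<Longrightarrow> (\<integral>\<^sup>+p. f (L p) \<partial>lborel) = c0 * (\<integral>\<^sup>+Z. f Z \<partial>lborel)"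
    using nn_integral_linear_bij[OF L] by metis
  obtain C where C: "\<forall>g\<in>borel_measurable borel. (\<forall>S. S \<notin> pos_def \<longrightarrow> g S = 0) \<longrightarrow>
    (\<integral>\<^sup>+Y. g (ct Y ** Y) \<partial>?L) =
    C * (\<integral>\<^sup>+X. g (herm X) * det_powr (herm X) (?m - ?q) * indicator (cball 0 1) (skew X) \<partial>lborel)"
    using gram_integral_herm[OF mq] by (rule exE)
  let ?k = "\<lambda>X :: complex^'q^'q. indicator (cball 0 1) (skew X) :: ennreal"
  define D where "D = (\<integral>\<^sup>+X. indicator A (herm X) * det_powr (herm X) ?m * ?k X \<partial>lborel)"
  show ?thesis
  \<comment> \<open>\<open>c0\<close> compares pairs of blocks with tall matrices, \<open>C\<close>
    belongs to the density of Gram matrices, and \<open>Np\<close> and \<open>D\<close> are the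
    masses of the variable \<open>S\<close> in the two evaluations of the same integral.\<close>
  proof (intro exI[of _ "C * D / (c0 * Np)"] ballI)
    fix f :: "complex^'q^'q \<Rightarrow> ennreal" assume [measurable]: "f \<in> borel_measurable borel"
    define F where "F y S = f (y ** minv (P S)) * indicator A S" for y S
    have F_meas [measurable (raw)]: "(\<lambda>x. F (a x) (b x)) \<in> borel_measurable N"
      if [measurable]: "a \<in> borel_measurable N" "b \<in> borel_measurable N" for a b and N :: "'z measure"
      unfolding F_def by measurable
    define \<pi> where "\<pi> = (\<integral>\<^sup>+k. f (corner (u k)) \<partial>M)"
    define I where "I = (\<integral>\<^sup>+Z. F (ct ?E ** Z) (ct Z ** Z) \<partial>lborel)"
    have Imeas: "(\<lambda>Z. F (ct ?E ** Z) (ct Z ** Z)) \<in> borel_measurable borel"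
      unfolding F_def by measurable
    \<comment> \<open>\<open>M\<close> has mass 1 and left multiplication by \<open>u k\<close> is
      an isometry, so the integral may be averaged over \<open>k\<close>.\<close>
    have "I = (\<integral>\<^sup>+k. I \<partial>M)" by (simp add: M(2))
    also have "\<dots> = (\<integral>\<^sup>+k. (\<integral>\<^sup>+Z. F (ct ?E ** (u k ** Z)) (ct (u k ** Z) ** (u k ** Z)) \<partial>lborel) \<partial>M)"
    proof (rule nn_integral_cong)
      fix k assume "k \<in> space M"
      then show "I = (\<integral>\<^sup>+Z. F (ct ?E ** (u k ** Z)) (ct (u k ** Z) ** (u k ** Z)) \<partial>lborel)"
        unfolding I_def using unitary
        by (intro nn_integral_isometry[OF _ _ Imeas, symmetric] linear_matrix_mult) auto
    qed
    also have "\<dots> = (\<integral>\<^sup>+Z. (\<integral>\<^sup>+k. F (ct ?E ** (u k ** Z)) (ct (u k ** Z) ** (u k ** Z)) \<partial>M) \<partial>lborel)"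
      unfolding F_def by (rule PM.Fubini'[symmetric]) measurable
    also have "\<dots> = (\<integral>\<^sup>+Z. \<pi> * indicator A (ct Z ** Z) \<partial>?LZ)"
    proof (rule nn_integral_cong)
      fix Z :: "complex^'q^('m + 'q)"
      have uZ: "ct (u k ** Z) ** (u k ** Z) = ct Z ** Z" if "k \<in> space M" for k
        using unitary[OF that] by (simp add: ct_mult flip: matrix_mul_assoc)
      show "(\<integral>\<^sup>+k. F (ct ?E ** (u k ** Z)) (ct (u k ** Z) ** (u k ** Z)) \<partial>M) = \<pi> * indicator A (ct Z ** Z)"
      proof (cases "ct Z ** Z \<in> A")
        case True
        define R where "R = P (ct Z ** Z)"
        have R: "ct R = R" "R ** R = ct Z ** Z" "det R \<noteq> 0" using PA[OF True] by (simp_all add: R_def)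
        \<comment> \<open>\<open>Z\<close> is a unitary image of the standard matrix with the same
          Gram matrix. The normalised block of \<open>u k ** Z\<close> thus becomes the corner of
          \<open>u k ** U\<close>, and right invariance removes \<open>U\<close>.\<close>
        have "ct (?E ** R) ** (?E ** R) = ct Z ** Z"
          by (simp add: ct_mult R flip: matrix_mul_assoc)
        then obtain U where U: "U \<in> unitary_group" "Z = U ** (?E ** R)" by (rule tall_gram_eq)
        have "(\<integral>\<^sup>+k. F (ct ?E ** (u k ** Z)) (ct (u k ** Z) ** (u k ** Z)) \<partial>M) = (\<integral>\<^sup>+k. f (corner (u k ** U)) \<partial>M)"
        proof (rule nn_integral_cong)
          fix k assume k: "k \<in> space M"
          have "ct ?E ** (u k ** Z) ** minv R = corner (u k ** U) ** R ** minv R"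
            unfolding U(2) by (simp only: matrix_mul_assoc)
          also have "\<dots> = corner (u k ** U)" by (rule minv_mult(5)[OF R(3)])
          finally show "F (ct ?E ** (u k ** Z)) (ct (u k ** Z) ** (u k ** Z)) = f (corner (u k ** U))"
            unfolding F_def uZ[OF k] using True by (simp add: R_def)
        qed
        also have "\<dots> = \<pi>"
          unfolding \<pi>_def by (rule inv[OF U(1), where F = "\<lambda>v. f (corner v)"]) measurable
        finally show ?thesis using True by simp
      next
        case False
        have "(\<integral>\<^sup>+k. F (ct ?E ** (u k ** Z)) (ct (u k ** Z) ** (u k ** Z)) \<partial>M) = (\<integral>\<^sup>+k. 0 \<partial>M)"
          by (intro nn_integral_cong) (use False in \<open>simp add: F_def uZ\<close>)
        then show ?thesis using False by simp
      qed
    qed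
    also have "\<dots> = \<pi> * Np"
      unfolding Np_def by (rule nn_integral_cmult) measurable
    finally have I1: "I = \<pi> * Np" .
    define Bf where "Bf = (\<integral>\<^sup>+w. f w * (indicator pos_def (mat 1 - ct w ** w) *
      det_powr (mat 1 - ct w ** w) (?m - ?q)) \<partial>lborel)"
    define Q where "Q y X = F y (herm X) * indicator pos_def (herm X - ct y ** y) *
      det_powr (herm X - ct y ** y) (?m - ?q) * ?k X" for y X
    have "c0 * I = (\<integral>\<^sup>+p. F (ct ?E ** L p) (ct (L p) ** L p) \<partial>lborel)"
      unfolding I_def by (rule split[OF Imeas, symmetric])
    also have "\<dots> = (\<integral>\<^sup>+p. F (fst p) (ct (snd p) ** snd p + ct (fst p) ** fst p) \<partial>((lborel :: (complex^'q^'q) measure) \<Otimes>\<^sub>M ?L))"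
      unfolding lborel_prod by (rule nn_integral_cong) (metis L_simps prod.collapse)
    also have "\<dots> = (\<integral>\<^sup>+y. (\<integral>\<^sup>+Y. F y (ct Y ** Y + ct y ** y) \<partial>?L) \<partial>lborel)"
      unfolding F_def by (subst lborel.nn_integral_fst[symmetric]) auto
    also have "\<dots> = (\<integral>\<^sup>+y. C * (\<integral>\<^sup>+X. Q y X \<partial>lborel) \<partial>lborel)"
    proof (rule nn_integral_cong)
      fix y :: "complex^'q^'q"
      define g where "g S = F y (S + ct y ** y) * indicator pos_def S" for S
      have [measurable]: "g \<in> borel_measurable borel" unfolding g_def F_def by measurable
      have "(\<integral>\<^sup>+Y. F y (ct Y ** Y + ct y ** y) \<partial>?L) = (\<integral>\<^sup>+Y. g (ct Y ** Y) \<partial>?L)"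
        by (rule nn_integral_cong_AE, rule AE_mp[OF AE_gram_nonsingular[OF mq]]) (auto simp: g_def gram_in_pos_def intro!: AE_I2)
      also have "\<dots> = C * (\<integral>\<^sup>+X. g (herm X) * det_powr (herm X) (?m - ?q) * ?k X \<partial>lborel)"
        by (rule C[rule_format]) (auto simp: g_def)
      \<comment> \<open>Translation by the Hermitian matrix \<open>y* y\<close> moves only the
        Hermitian part and leaves the cut-off on \<open>skew X\<close> alone.\<close>
      also have "(\<integral>\<^sup>+X. g (herm X) * det_powr (herm X) (?m - ?q) * ?k X \<partial>lborel) =
        (\<integral>\<^sup>+X. g (herm (X + - (ct y ** y))) * det_powr (herm (X + - (ct y ** y))) (?m - ?q) * ?k (X + - (ct y ** y)) \<partial>lborel)"
        by (rule nn_integral_lborel_translate'[symmetric]) measurable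
      also have "\<dots> = (\<integral>\<^sup>+X. Q y X \<partial>lborel)"
      proof (rule nn_integral_cong)
        fix X :: "complex^'q^'q"
        have "ct (- (ct y ** y)) = - (ct y ** y)" by (simp add: ct_minus ct_mult)
        note h = herm_add_hermitian[OF this, of X]
        show "g (herm (X + - (ct y ** y))) * det_powr (herm (X + - (ct y ** y))) (?m - ?q) * ?k (X + - (ct y ** y)) = Q y X"
          unfolding h by (simp add: g_def Q_def)
      qed
      finally show "(\<integral>\<^sup>+Y. F y (ct Y ** Y + ct y ** y) \<partial>?L) = C * (\<integral>\<^sup>+X. Q y X \<partial>lborel)" .
    qed
    also have "\<dots> = C * (\<integral>\<^sup>+y. (\<integral>\<^sup>+X. Q y X \<partial>lborel) \<partial>lborel)"
      unfolding Q_def F_def by (rule nn_integral_cmult) measurable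
    also have "(\<integral>\<^sup>+y. (\<integral>\<^sup>+X. Q y X \<partial>lborel) \<partial>lborel) = (\<integral>\<^sup>+X. (\<integral>\<^sup>+y. Q y X \<partial>lborel) \<partial>lborel)"
      unfolding Q_def F_def by (rule lborel_pair.Fubini') measurable
    also have "\<dots> = (\<integral>\<^sup>+X. (indicator A (herm X) * det_powr (herm X) ?m * ?k X) * Bf \<partial>lborel)"
    proof (rule nn_integral_cong)
      fix X :: "complex^'q^'q"
      show "(\<integral>\<^sup>+y. Q y X \<partial>lborel) = (indicator A (herm X) * det_powr (herm X) ?m * ?k X) * Bf"
      proof (cases "herm X \<in> A")
        case True
        \<comment> \<open>Substituting \<open>y = w R\<close> separates \<open>w\<close> from
          \<open>X\<close>: the difference \<open>herm X - y* y\<close> becomes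
          \<open>R (1 - w* w) R\<close>, and the Jacobian and the density together leave
          \<open>det (herm X)\<close> to the power \<open>m\<close>.\<close>
        define R where "R = P (herm X)"
        have R: "ct R = R" "R ** R = herm X" "det R \<noteq> 0" using PA[OF True] by (simp_all add: R_def)
        have "(\<integral>\<^sup>+y. Q y X \<partial>lborel) = det_powr R (2 * ?q) * (\<integral>\<^sup>+w. Q (w ** R) X \<partial>lborel)"
        proof -
          have [measurable]: "(\<lambda>y. Q y X) \<in> borel_measurable borel"
            unfolding Q_def F_def by measurable
          have "(\<integral>\<^sup>+y. Q y X \<partial>lborel) = ennreal (cmod (det R) ^ (2 * CARD('q))) * (\<integral>\<^sup>+w. Q (w ** R) X \<partial>lborel)"
            by (rule nn_integral_matrix_right[OF R(3)]) measurable
          then show ?thesis by (simp only: det_powr_nat[OF R(3)] of_nat_mult of_nat_numeral)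
        qed
        also have "(\<integral>\<^sup>+w. Q (w ** R) X \<partial>lborel) = (\<integral>\<^sup>+w. (det_powr R (2 * (?m - ?q)) * ?k X) * (f w * (indicator pos_def (mat 1 - ct w ** w) *
          det_powr (mat 1 - ct w ** w) (?m - ?q))) \<partial>lborel)"
        proof (rule nn_integral_cong)
          fix w :: "complex^'q^'q"
          have 1: "F (w ** R) (herm X) = f w"
            unfolding F_def R_def[symmetric] minv_mult(5)[OF R(3)] using True by simp
          have 2: "herm X - ct (w ** R) ** (w ** R) = ct R ** (mat 1 - ct w ** w) ** R"
            by (simp add: R(2)[symmetric] R(1) ct_mult matrix_mult_diff_left matrix_mult_diff_right matrix_mul_assoc)
          have 3: "det_powr (ct R ** (mat 1 - ct w ** w) ** R) a = det_powr R (2 * a) * det_powr (mat 1 - ct w ** w) a" for a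
            unfolding det_powr_double[symmetric] by (simp add: det_powr_mult R(1) mult_ac)
          have 4: "(indicator pos_def (ct R ** (mat 1 - ct w ** w) ** R) :: ennreal) = indicator pos_def (mat 1 - ct w ** w)"
            using conj_in_pos_def[OF R(3)] by (simp add: indicator_def)
          show "Q (w ** R) X = (det_powr R (2 * (?m - ?q)) * ?k X) * (f w * (indicator pos_def (mat 1 - ct w ** w) *
            det_powr (mat 1 - ct w ** w) (?m - ?q)))"
            unfolding Q_def 1 2 3 4 by (simp add: mult_ac)
        qed
        also have "\<dots> = (det_powr R (2 * (?m - ?q)) * ?k X) * Bf"
          unfolding Bf_def by (rule nn_integral_cmult) measurable
        also have "det_powr R (2 * ?q) * \<dots> = det_powr (herm X) ?m * ?k X * Bf"
        proof -
          have "det_powr R (2 * ?q) * det_powr R (2 * (?m - ?q)) = det_powr (herm X) ?m"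
            unfolding R(2)[symmetric] det_powr_double by (simp flip: det_powr_add)
          then show ?thesis by (simp flip: mult.assoc)
        qed
        finally show ?thesis using True by simp
      qed (simp add: Q_def F_def)
    qed
    also have "\<dots> = D * Bf"
      unfolding D_def by (rule nn_integral_multc) measurable
    finally have "(c0 * Np) * \<pi> = C * D * Bf"
      by (simp add: I1 mult_ac)
    then have "\<pi> = C * D * Bf / (c0 * Np)"
      using Np c0 by (intro ennreal_mult_cancel_finite) (auto simp: ennreal_mult_eq_top_iff)
    then show "(\<integral>\<^sup>+k. f (corner (u k)) \<partial>M) = C * D / (c0 * Np) * (\<integral>\<^sup>+w. f w * (indicator pos_def (mat 1 - ct w ** w) *
      det_powr (mat 1 - ct w ** w) (?m - ?q)) \<partial>lborel)"
      by (simp add: \<pi>_def Bf_def divide_ennreal_def mult_ac)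
  qed
qed

section \<open>The ball of contractions\<close>

lemma cinner_1_minus_gram: "cinner x ((mat 1 - ct w ** w) *v x) = of_real ((norm x)\<^sup>2 - (norm (w *v x))\<^sup>2)"
  by (simp add: matrix_vector_mult_diff_rdistrib cinner_diff_right cinner_self cinner_gram)

lemma matrix_ball_iff: "w \<in> matrix_ball \<longleftrightarrow> (\<forall>x. norm (w *v x) \<le> norm x)"
  by (auto simp: matrix_ball_def pos_semidef_iff ct_diff ct_mult cinner_1_minus_gram)

lemma closed_matrix_ball: "closed (matrix_ball :: (complex^'q^'q) set)"
proof -
  have "matrix_ball = (\<lambda>w :: complex^'q^'q. mat 1 - ct w ** w) -` {S. pos_semidef S}"
    by (auto simp: matrix_ball_def)
  then show ?thesis
    using closed_vimage[OF closed_pos_semidef, of "\<lambda>w :: complex^'q^'q. mat 1 - ct w ** w"]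
    by (simp add: continuous_intros)
qed

text \<open>If \<open>1 - w* w\<close> is singular, the contraction \<open>w\<close> keeps the norm
  of some nonzero vector, which happens at most once on each ray from 0. A closed set met at most
  once by every ray is negligible.\<close>

lemma AE_matrix_ball_nonsingular:
  "AE w in (lborel :: (complex^'q^'q) measure). w \<in> matrix_ball \<longrightarrow> det (mat 1 - ct w ** w) \<noteq> 0"
proof -
  define S where "S = {w :: complex^'q^'q. w \<in> matrix_ball \<and> det (mat 1 - ct w ** w) = 0}"
  have S_alt: "S = matrix_ball \<inter> {w. det (mat 1 - ct w ** w) = 0}" by (auto simp: S_def)
  have "closed S"
    unfolding S_alt by (intro closed_Int closed_matrix_ball closed_Collect_eq continuous_intros)
  have ker: "\<exists>x. x \<noteq> 0 \<and> norm (w *v x) = norm x" if "w \<in> S" for w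
  proof -
    have "det (mat 1 - ct w ** w) = 0" using that by (simp add: S_def)
    then obtain x where "x \<noteq> 0" and x: "(mat 1 - ct w ** w) *v x = 0"
      unfolding det_eq_0_iff_kernel by blast
    have "complex_of_real ((norm x)\<^sup>2 - (norm (w *v x))\<^sup>2) = 0"
      unfolding cinner_1_minus_gram[symmetric] x by simp
    then have "(norm x)\<^sup>2 - (norm (w *v x))\<^sup>2 = 0"
      by (simp only: of_real_eq_0_iff)
    then have "(norm x)\<^sup>2 = (norm (w *v x))\<^sup>2" by simp
    then show ?thesis using \<open>x \<noteq> 0\<close> by auto
  qed
  have sc: "(c *\<^sub>R w) *v x = c *\<^sub>R (w *v x)" for c and w :: "complex^'q^'q" and x
    by (simp add: vec_eq_iff matrix_vector_mult_nth scaleR_sum_right)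
  have "negligible S"
  proof (rule starlike_negligible[OF \<open>closed S\<close>, of 0])
    fix c :: real and w
    assume *: "0 + c *\<^sub>R w \<in> S" "0 \<le> c" "0 + w \<in> S"
    obtain x where x: "x \<noteq> 0" "norm (w *v x) = norm x" using ker[of w] * by auto
    obtain y where y: "y \<noteq> 0" "norm ((c *\<^sub>R w) *v y) = norm y" using ker[of "c *\<^sub>R w"] * by auto
    have "norm ((c *\<^sub>R w) *v x) \<le> norm x" "norm (w *v y) \<le> norm y"
      using * by (auto simp: S_def matrix_ball_iff)
    then have 1: "c * norm x \<le> norm x" "c * norm (w *v y) = norm y" "norm (w *v y) \<le> norm y"
      using x y * by (simp_all add: sc)
    have "norm y \<le> c * norm y"
      using mult_left_mono[OF 1(3) *(2)] 1(2) by linarith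
    then have "c \<le> 1" "1 \<le> c" using 1(1) x(1) y(1) by auto
    then show "c = 1" by simp
  qed
  then have "S \<in> null_sets lebesgue" by (simp add: negligible_iff_null_sets)
  then have "S \<in> null_sets lborel"
    using \<open>closed S\<close> by (simp add: null_sets_completion_iff borel_closed)
  then have "AE w in lborel. w \<notin> S" by (rule AE_not_in)
  then show ?thesis by (rule AE_mp) (auto simp: S_def)
qed

text \<open>By the spectral theorem the determinant is a product of nonnegative reals; this
  identifies the complex weight of the integral formula with a real density.\<close>

lemma det_pos_semidef: "pos_semidef (S :: complex^'q^'q) \<Longrightarrow> det S = of_real (cmod (det S))"
proof -
  assume "pos_semidef S"
  then obtain V d where V: "V \<in> unitary_group" and d: "\<And>i. 0 \<le> d $ i" and S: "S = ct V ** diag_matrix d ** V"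
    using pos_semidef_spectral[of S] by metis
  have "det S = of_real (\<Prod>i\<in>UNIV. d $ i)"
    using norm_det_unitary[OF V] by (simp add: S det_mul det_ct det_diag_matrix mult.commute[of "cnj _"])
      (metis (no_types, lifting) complex_norm_square mult.left_commute mult.right_neutral of_real_1 power_one)
  moreover have "0 \<le> (\<Prod>i\<in>UNIV. d $ i)" using d by (intro prod_nonneg) auto
  ultimately show ?thesis by (simp only: norm_of_real) simp
qed

section \<open>Haar measure\<close>

lemma haar_space: "normalized_haar_measure K M \<Longrightarrow> space M = K"
  unfolding normalized_haar_measure_def by (metis sets_eq_imp_space_eq space_restrict_space2 space_restrict_space Int_UNIV_right space_borel)

lemma haar_finite: "normalized_haar_measure K M \<Longrightarrow> finite_measure M"
  using haar_space[of K M] by (intro finite_measureI) (auto simp: normalized_haar_measure_def)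

lemma haar_borel_measurable:
  fixes f :: "complex^'n^'n \<Rightarrow> 'b::topological_space"
  assumes M: "normalized_haar_measure K M" and f: "f \<in> borel_measurable borel"
  shows "f \<in> borel_measurable M"
proof -
  have "sets M = sets (restrict_space borel K)" using M by (simp add: normalized_haar_measure_def)
  then have "borel_measurable M = (borel_measurable (restrict_space borel K) :: (complex^'n^'n \<Rightarrow> 'b) set)"
    by (rule measurable_cong_sets) simp
  then show ?thesis using measurable_restrict_space1[OF f] by simp
qed

lemma haar_mult_measurable:
  assumes M: "normalized_haar_measure K M" and K: "\<And>g h. g \<in> K \<Longrightarrow> h \<in> K \<Longrightarrow> g ** h \<in> K" and g: "g \<in> K"
  shows "(\<lambda>h. g ** h) \<in> measurable M M"
proof -
  have "sets M = sets (restrict_space borel K)" using M by (simp add: normalized_haar_measure_def)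
  then have eq: "measurable M M = measurable M (restrict_space borel K)"
    by (intro measurable_cong_sets) auto
  have "(\<lambda>h. g ** h) \<in> borel_measurable M"
    by (rule haar_borel_measurable[OF M]) measurable
  then show ?thesis
    unfolding eq using K[OF g] haar_space[OF M] by (intro measurable_restrict_space2) auto
qed

lemma haar_nn_integral_left:
  assumes M: "normalized_haar_measure K M" and K: "\<And>g h. g \<in> K \<Longrightarrow> h \<in> K \<Longrightarrow> g ** h \<in> K" and g: "g \<in> K"
    and F: "F \<in> borel_measurable borel"
  shows "(\<integral>\<^sup>+h. F (g ** h) \<partial>M) = (\<integral>\<^sup>+h. F h \<partial>M)"
proof -
  have "distr M M (\<lambda>h. g ** h) = M" using M g by (simp add: normalized_haar_measure_def)
  then have "(\<integral>\<^sup>+h. F h \<partial>M) = (\<integral>\<^sup>+h. F h \<partial>distr M M (\<lambda>h. g ** h))" by simp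
  also have "\<dots> = (\<integral>\<^sup>+h. F (g ** h) \<partial>M)"
    using haar_borel_measurable[OF M F] by (intro nn_integral_distr haar_mult_measurable[OF M K g]) auto
  finally show ?thesis by simp
qed

text \<open>Integrating \<open>F (a* b)\<close> over \<open>a\<close> and \<open>b\<close> in both orders gives invariance under inversion.\<close>
lemma haar_nn_integral_ct:
  fixes K :: "(complex^'n^'n) set"
  assumes M: "normalized_haar_measure K M" and K: "\<And>g h. g \<in> K \<Longrightarrow> h \<in> K \<Longrightarrow> g ** h \<in> K" "\<And>g. g \<in> K \<Longrightarrow> ct g \<in> K"
    and F [measurable]: "F \<in> borel_measurable borel"
  shows "(\<integral>\<^sup>+h. F (ct h) \<partial>M) = (\<integral>\<^sup>+h. F h \<partial>M)"
proof -
  interpret finite_measure M by (rule haar_finite[OF M])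
  interpret P: pair_sigma_finite M M ..
  have one: "emeasure M (space M) = 1" using M haar_space[OF M] by (simp add: normalized_haar_measure_def)
  have id: "(\<lambda>h. h) \<in> borel_measurable M" by (rule haar_borel_measurable[OF M]) measurable
  have [measurable]: "(\<lambda>p. fst p) \<in> borel_measurable (M \<Otimes>\<^sub>M M)" "(\<lambda>p. snd p) \<in> borel_measurable (M \<Otimes>\<^sub>M M)"
    using measurable_compose[OF measurable_fst id] measurable_compose[OF measurable_snd id] by auto
  have "(\<integral>\<^sup>+h. F h \<partial>M) = (\<integral>\<^sup>+a. (\<integral>\<^sup>+h. F h \<partial>M) \<partial>M)" by (simp add: one)
  also have "\<dots> = (\<integral>\<^sup>+a. (\<integral>\<^sup>+b. F (ct a ** b) \<partial>M) \<partial>M)"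
    by (rule nn_integral_cong, rule haar_nn_integral_left[OF M K(1), symmetric])
      (auto simp: haar_space[OF M] K)
  also have "\<dots> = (\<integral>\<^sup>+b. (\<integral>\<^sup>+a. F (ct a ** b) \<partial>M) \<partial>M)"
    by (rule P.Fubini'[symmetric]) (simp add: case_prod_beta')
  also have "\<dots> = (\<integral>\<^sup>+b. (\<integral>\<^sup>+a. F (ct a) \<partial>M) \<partial>M)"
  proof (rule nn_integral_cong)
    fix b assume "b \<in> space M"
    then have cb: "ct b \<in> K" by (simp add: haar_space[OF M] K)
    have "(\<integral>\<^sup>+a. F (ct (ct b ** a)) \<partial>M) = (\<integral>\<^sup>+a. F (ct a) \<partial>M)"
      by (rule haar_nn_integral_left[OF M K(1), where F = "\<lambda>a. F (ct a)"]) (auto simp: cb)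
    then show "(\<integral>\<^sup>+a. F (ct a ** b) \<partial>M) = (\<integral>\<^sup>+a. F (ct a) \<partial>M)" by (simp add: ct_mult)
  qed
  also have "\<dots> = (\<integral>\<^sup>+a. F (ct a) \<partial>M)" by (simp add: one)
  finally show ?thesis by simp
qed

text \<open>The adjoint preserves the measure and turns right translations into left ones.\<close>

lemma haar_nn_integral_right:
  fixes K :: "(complex^'n^'n) set"
  assumes M: "normalized_haar_measure K M" and K: "\<And>g h. g \<in> K \<Longrightarrow> h \<in> K \<Longrightarrow> g ** h \<in> K" "\<And>g. g \<in> K \<Longrightarrow> ct g \<in> K"
    and g: "g \<in> K" and F [measurable]: "F \<in> borel_measurable borel"
  shows "(\<integral>\<^sup>+h. F (h ** g) \<partial>M) = (\<integral>\<^sup>+h. F h \<partial>M)"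
proof -
  have "(\<integral>\<^sup>+h. F (h ** g) \<partial>M) = (\<integral>\<^sup>+h. F (ct h ** g) \<partial>M)"
    by (rule haar_nn_integral_ct[OF M K, where F = "\<lambda>h. F (h ** g)", symmetric]) auto
  also have "\<dots> = (\<integral>\<^sup>+h. F (ct (ct g ** h)) \<partial>M)" by (simp add: ct_mult)
  also have "\<dots> = (\<integral>\<^sup>+h. F (ct h) \<partial>M)"
    by (rule haar_nn_integral_left[OF M K(1), where F = "\<lambda>a. F (ct a)"]) (auto simp: K g)
  also have "\<dots> = (\<integral>\<^sup>+h. F h \<partial>M)"
    by (rule haar_nn_integral_ct[OF M K]) auto
  finally show ?thesis .
qed

abbreviation upper :: "complex^('a::finite + 'b::finite)^('a + 'b) \<Rightarrow> complex^'a^'a"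
  where "upper k \<equiv> ct inl_mat ** k ** inl_mat"

lemma corner_block_diag [simp]: "corner (block_diag u v) = v" "upper (block_diag u v) = u"
  by (simp_all add: block_diag_eq vec_eq_iff)

lemma block_diag_mult: "block_diag u v ** block_diag u' v' = block_diag (u ** u') (v ** v')"
  by (simp add: block_diag_eq block_matrix_mult)

lemma K_tilde_cases:
  assumes "k \<in> K_tilde"
  shows "k = block_diag (upper k) (corner k)" "upper k \<in> unitary_group" "corner k \<in> special_unitary_group"
  using assms by (auto simp: K_tilde_def)

lemma K_tildeI: "u \<in> unitary_group \<Longrightarrow> v \<in> special_unitary_group \<Longrightarrow> block_diag u v \<in> K_tilde"
  by (auto simp: K_tilde_def)

lemma special_unitary_mult: "u \<in> special_unitary_group \<Longrightarrow> v \<in> special_unitary_group \<Longrightarrow> u ** v \<in> special_unitary_group"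
  by (simp add: special_unitary_iff unitary_mult det_mul)

lemma special_unitary_ct: "u \<in> special_unitary_group \<Longrightarrow> ct u \<in> special_unitary_group"
  by (simp add: special_unitary_iff unitary_ct det_ct)

lemma special_unitary_1: "mat 1 \<in> special_unitary_group"
  by (simp add: special_unitary_iff)

lemma K_tilde_ct: "k \<in> K_tilde \<Longrightarrow> ct k \<in> K_tilde"
proof -
  assume k: "k \<in> K_tilde"
  have "ct k = block_diag (ct (upper k)) (ct (corner k))"
    by (subst K_tilde_cases(1)[OF k]) (simp add: block_diag_eq ct_block_matrix)
  then show ?thesis
    using K_tilde_cases[OF k] by (simp add: K_tildeI unitary_ct special_unitary_ct)
qed

lemma continuous_on_block_diag [continuous_intros]:
  fixes f :: "'z::topological_space \<Rightarrow> complex^'a^'a" and g :: "'z \<Rightarrow> complex^'b^'b"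
  assumes "continuous_on X f" "continuous_on X g"
  shows "continuous_on X (\<lambda>x. block_diag (f x) (g x))"
  unfolding block_diag_eq block_matrix_def by (intro continuous_intros assms)

lemma compact_K_tilde: "compact (K_tilde :: (complex^('p::finite + 'q::finite)^('p + 'q)) set)"
proof -
  have "K_tilde = (\<lambda>p. block_diag (fst p) (snd p)) ` (unitary_group \<times> special_unitary_group :: ((complex^'p^'p) \<times> (complex^'q^'q)) set)"
    by (auto simp: K_tilde_def image_iff) blast+
  moreover have "compact ((\<lambda>p. block_diag (fst p) (snd p)) ` (unitary_group \<times> special_unitary_group :: ((complex^'p^'p) \<times> (complex^'q^'q)) set))"
    by (intro compact_continuous_image continuous_intros compact_Times compact_unitary compact_special_unitary)
  ultimately show ?thesis by simp
qed

text \<open>The last \<open>q\<close> columns of a unitary matrix with prescribed corner \<open>w\<close> are completed by a square root of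
  \<open>1 - w* w\<close>, for which there is room because \<open>q \<le> m\<close>.\<close>
lemma corner_unitary_image:
  assumes mq: "CARD('q) \<le> CARD('m)"
  shows "corner ` (unitary_group :: (complex^('m::finite + 'q::finite)^('m + 'q)) set) = matrix_ball"
proof (intro equalityI subsetI)
  fix w assume "w \<in> corner ` (unitary_group :: (complex^('m + 'q)^('m + 'q)) set)"
  then obtain u :: "complex^('m + 'q)^('m + 'q)" where u: "u \<in> unitary_group" "w = corner u" by blast
  obtain A B C D where ub: "u = block_matrix A B C D"
    using block_matrix_collapse[of u] by metis
  have "w = D" by (simp add: u(2) ub vec_eq_iff)
  moreover have "ct B ** B + ct D ** D = mat 1"
    using u(1) by (simp add: unitary_iff ub ct_block_matrix block_matrix_mult block_matrix_1)
  ultimately have "mat 1 - ct w ** w = ct B ** B" by (simp add: algebra_simps)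
  then show "w \<in> matrix_ball" by (simp add: matrix_ball_def pos_semidef_gram)
next
  fix w :: "complex^'q^'q" assume "w \<in> matrix_ball"
  then obtain R where R: "pos_semidef R" "R ** R = mat 1 - ct w ** w"
    using pos_semidef_sqrt[of "mat 1 - ct w ** w"] by (auto simp: matrix_ball_def)
  have Rh: "ct R = R" using R by (simp add: pos_semidef_iff)
  obtain J :: "complex^'q^'m" where J: "ct J ** J = mat 1" by (rule isometry_exists[OF mq])
  define Z :: "complex^'q^('m + 'q)" where "Z = inl_mat ** (J ** R) + inr_mat ** w"
  have "ct (J ** R) ** (J ** R) = R ** (ct J ** J) ** R"
    by (simp only: ct_mult Rh matrix_mul_assoc)
  then have "ct Z ** Z = R ** R + ct w ** w"
    by (simp add: Z_def J ct_add matrix_mult_add_left matrix_mult_add_right ct_mult flip: matrix_mul_assoc)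
  then have "ct inr_mat ** inr_mat = ct Z ** Z" by (simp add: R(2))
  then obtain U where U: "U \<in> unitary_group" "Z = U ** inr_mat" by (rule tall_gram_eq)
  then have "corner U = ct inr_mat ** Z" by (simp add: matrix_mul_assoc)
  then have "corner U = w" by (simp add: Z_def matrix_mult_add_right)
  with U(1) show "w \<in> corner ` (unitary_group :: (complex^('m + 'q)^('m + 'q)) set)" by blast
qed

text \<open>A continuous map from a compact space to a Hausdorff space is closed, hence a quotient
  map onto its image.\<close>

lemma continuous_on_quotient:
  fixes h :: "'a::t2_space \<Rightarrow> 'b::t2_space" and f :: "'b \<Rightarrow> 'c::topological_space"
  assumes K: "compact K" and h: "continuous_on K h" and fh: "continuous_on K (\<lambda>x. f (h x))"
  shows "continuous_on (h ` K) f"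
proof -
  have cl: "closed (h ` K)" using compact_continuous_image[OF h K] by (rule compact_imp_closed)
  show ?thesis
    unfolding continuous_on_closed_vimage[OF cl]
  proof (intro allI impI)
    fix B :: "'c set" assume "closed B"
    then have "closed ((\<lambda>x. f (h x)) -` B \<inter> K)"
      using fh compact_imp_closed[OF K] by (simp add: continuous_on_closed_vimage)
    then have "compact ((\<lambda>x. f (h x)) -` B \<inter> K)"
      by (metis K compact_Int_closed inf_commute inf.left_idem)
    then have "compact (h ` ((\<lambda>x. f (h x)) -` B \<inter> K))"
      by (rule compact_continuous_image[OF continuous_on_subset[OF h], rotated]) auto
    moreover have "h ` ((\<lambda>x. f (h x)) -` B \<inter> K) = f -` B \<inter> h ` K" by auto
    ultimately show "closed (f -` B \<inter> h ` K)" by (simp add: compact_imp_closed)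
  qed
qed

text \<open>The blocks that meet \<open>corner k\<close> contribute the phase
  \<open>r1 * r2\<close>, those that meet \<open>corner (upper k)\<close> none. The factor in front
  of \<open>k\<close> supplies it there, so it becomes common to both terms.\<close>

lemma corner_product:
  fixes t s :: "real^'q" and z1 z2 :: complex and k :: "complex^(('m::finite + 'q::finite) + 'q)^(('m + 'q) + 'q)"
  defines "r1 \<equiv> root_branch CARD('q) z1" and "r2 \<equiv> root_branch CARD('q) z2"
  assumes k: "k \<in> K_tilde"
  shows "corner (coset_rep t z1 ** (block_diag (block_diag (mat 1) (mat (r1 * r2))) (mat 1) ** k) ** coset_rep s z2) =
    mat (r1 * r2) ** (sinh_diag t ** corner (upper k) ** sinh_diag s + cosh_diag t ** corner k ** cosh_diag s)"
proof -
  let ?\<zeta> = "r1 * r2"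
  let ?Z = "block_diag (mat 1) (mat ?\<zeta>) :: complex^('m + 'q)^('m + 'q)"
  let ?u = "upper k" and ?v = "corner k"
  have kb: "block_diag ?Z (mat 1) ** k = block_matrix (?Z ** ?u) 0 0 ?v"
    by (subst (1) K_tilde_cases(1)[OF k]) (simp add: block_diag_mult, simp add: block_diag_eq)
  have corner_block: "corner (block_matrix A B C D) = D" for A :: "complex^('m + 'q)^('m + 'q)" and B C and D :: "complex^'q^'q"
    by (simp add: vec_eq_iff)
  have ZE: "ct inr_mat ** ?Z = mat ?\<zeta> ** ct inr_mat"
    by (simp add: sum_matrix_eq_iff' block_diag_eq vec_eq_iff matrix_mul_assoc[symmetric])
  have "corner (coset_rep t z1 ** (block_diag ?Z (mat 1) ** k) ** coset_rep s z2) =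
    sinh_diag t ** ct inr_mat ** (?Z ** ?u) ** (inr_mat ** sinh_diag s) + mat r1 ** cosh_diag t ** ?v ** (mat r2 ** cosh_diag s)"
    unfolding kb unfolding coset_rep_eq block_matrix_mult corner_block r1_def[symmetric] r2_def[symmetric] by simp
  also have "sinh_diag t ** ct inr_mat ** (?Z ** ?u) ** (inr_mat ** sinh_diag s) = sinh_diag t ** (ct inr_mat ** ?Z) ** ?u ** inr_mat ** sinh_diag s"
    by (simp only: matrix_mul_assoc)
  also have "\<dots> = (sinh_diag t ** mat ?\<zeta>) ** (corner ?u ** sinh_diag s)"
    unfolding ZE by (simp only: matrix_mul_assoc)
  also have "\<dots> = mat ?\<zeta> ** (sinh_diag t ** corner ?u ** sinh_diag s)"
    by (simp only: mat_commute[symmetric] matrix_mul_assoc)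
  also have "mat r1 ** cosh_diag t ** ?v ** (mat r2 ** cosh_diag s) = mat r1 ** (cosh_diag t ** ?v ** mat r2) ** cosh_diag s"
    by (simp only: matrix_mul_assoc)
  also have "\<dots> = mat r1 ** (mat r2 ** (cosh_diag t ** ?v)) ** cosh_diag s"
    by (simp only: mat_commute)
  also have "\<dots> = mat (r1 * r2) ** (cosh_diag t ** ?v ** cosh_diag s)"
    by (simp only: matrix_mul_assoc mat_mult_mat)
  finally show ?thesis by (simp only: matrix_mult_add_right)
qed

section \<open>The product formula\<close>

text \<open>Right translations in the unitary block give the invariance required by
  \<open>corner_law\<close>. Averaging over left translations by diag(1, v) and using right
  invariance of \<open>\<nu>\<close> makes \<open>corner k\<close> independent of the other corner.
  The constant can stay anonymous, since it is recovered from \<open>F = 1\<close>.\<close>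

lemma joint_corner_law:
  fixes \<mu> :: "(complex^(('m::finite + 'q::finite) + 'q)^(('m + 'q) + 'q)) measure"
    and \<nu> :: "(complex^'q^'q) measure"
  assumes \<mu>: "normalized_haar_measure K_tilde \<mu>" and \<nu>: "normalized_haar_measure special_unitary_group \<nu>"
    and mq: "CARD('q) \<le> CARD('m)"
  shows "\<exists>c :: real. \<forall>F :: (complex^'q^'q) \<times> (complex^'q^'q) \<Rightarrow> complex.
    continuous_on (matrix_ball \<times> special_unitary_group) F \<longrightarrow>
    (LINT k|\<mu>. F (corner (upper k), corner k)) =
      of_real c * (LINT w:matrix_ball|lborel. (LINT v|\<nu>. F (w, v)) * det (mat 1 - ct w ** w) ^ (CARD('m) - CARD('q)))"
proof -
  let ?n = "CARD('m) - CARD('q)"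
  let ?B = "matrix_ball :: (complex^'q^'q) set" and ?SU = "special_unitary_group :: (complex^'q^'q) set"
  note sp = haar_space[OF \<mu>] haar_space[OF \<nu>]
  interpret m: finite_measure \<mu> by (rule haar_finite[OF \<mu>])
  interpret n: finite_measure \<nu> by (rule haar_finite[OF \<nu>])
  interpret mn: pair_sigma_finite \<mu> \<nu> ..
  have one: "emeasure \<mu> (space \<mu>) = 1" "emeasure \<nu> (space \<nu>) = 1"
    using \<mu> \<nu> sp by (auto simp: normalized_haar_measure_def)
  have idm: "(\<lambda>k. k) \<in> borel_measurable \<mu>" "(\<lambda>v. v) \<in> borel_measurable \<nu>"
    by (rule haar_borel_measurable[OF \<mu>], measurable) (rule haar_borel_measurable[OF \<nu>], measurable)
  have pairm [measurable]: "(\<lambda>p. fst p) \<in> borel_measurable (\<mu> \<Otimes>\<^sub>M \<nu>)" "(\<lambda>p. snd p) \<in> borel_measurable (\<mu> \<Otimes>\<^sub>M \<nu>)"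
    using measurable_compose[OF measurable_fst idm(1)] measurable_compose[OF measurable_snd idm(2)] by auto
  have Wm [measurable]: "(\<lambda>k. corner (upper k)) \<in> borel_measurable \<mu>" and Vm [measurable]: "(\<lambda>k. corner k) \<in> borel_measurable \<mu>"
    by (rule haar_borel_measurable[OF \<mu>], measurable)+
  have upm: "(\<lambda>k. upper k) \<in> borel_measurable \<mu>"
    by (rule haar_borel_measurable[OF \<mu>]) measurable
  have inv: "(\<integral>\<^sup>+k. F (upper k ** U) \<partial>\<mu>) = (\<integral>\<^sup>+k. F (upper k) \<partial>\<mu>)"
    if U: "U \<in> unitary_group" and [measurable]: "F \<in> borel_measurable borel" for U F
  proof -
    have "(\<integral>\<^sup>+k. F (upper (k ** block_diag U (mat 1))) \<partial>\<mu>) = (\<integral>\<^sup>+k. F (upper k) \<partial>\<mu>)"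
      by (rule haar_nn_integral_right[OF \<mu> K_tilde_mult K_tilde_ct, where F = "\<lambda>k. F (upper k)"])
        (auto simp: K_tildeI U special_unitary_1)
    moreover have "upper (k ** block_diag U (mat 1)) = upper k ** U" if "k \<in> space \<mu>" for k
    proof -
      have "k = block_diag (upper k) (corner k)" using that by (intro K_tilde_cases) (simp add: sp)
      then have "upper (k ** block_diag U (mat 1)) = upper (block_diag (upper k) (corner k) ** block_diag U (mat 1))" by simp
      then show ?thesis by (simp only: block_diag_mult corner_block_diag)
    qed
    ultimately show ?thesis by (simp cong: nn_integral_cong)
  qed
  define dens where "dens w = indicator pos_def (mat 1 - ct w ** w) *
      det_powr (mat 1 - ct w ** w) (real CARD('m) - real CARD('q))" for w :: "complex^'q^'q"
  have [measurable]: "dens \<in> borel_measurable borel" unfolding dens_def by measurable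
  have un: "upper k \<in> unitary_group" if "k \<in> space \<mu>" for k
    using that K_tilde_cases(2) by (simp add: sp)
  have "\<exists>c. \<forall>f\<in>borel_measurable borel.
    (\<integral>\<^sup>+k. f (corner (upper k)) \<partial>\<mu>) = c * (\<integral>\<^sup>+w. f w * dens w \<partial>lborel)"
    unfolding dens_def by (rule corner_law[OF haar_finite[OF \<mu>] one(1) upm un inv mq])
  then obtain c0 where "\<forall>f\<in>borel_measurable borel.
    (\<integral>\<^sup>+k. f (corner (upper k)) \<partial>\<mu>) = c0 * (\<integral>\<^sup>+w. f w * dens w \<partial>lborel)" by (rule exE)
  note c0 = this[rule_format]
  \<comment> \<open>An infinite \<open>c0\<close> would make this product 0 or infinite, so the
    total mass 1 makes it a real number.\<close>
  have "c0 * (\<integral>\<^sup>+w. dens w \<partial>lborel) = 1"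
    using c0[of "\<lambda>_. 1"] one by simp
  then have c0_fin: "c0 \<noteq> \<infinity>"
    by (auto simp: ennreal_top_mult split: if_splits)
  define c where "c = enn2real c0"
  have c: "c0 = ennreal c" "0 \<le> c" using c0_fin by (auto simp: c_def less_top)
  define gd where "gd w = indicator matrix_ball w * (c * cmod (det (mat 1 - ct w ** w)) ^ ?n)" for w :: "complex^'q^'q"
  have gd_nonneg: "0 \<le> gd w" for w using c by (simp add: gd_def)
  have ball_borel [measurable]: "?B \<in> sets borel" by (intro borel_closed closed_matrix_ball)
  have [measurable]: "gd \<in> borel_measurable borel" unfolding gd_def by measurable
  \<comment> \<open>Only almost everywhere: the ball contains \<open>w\<close> with
    \<open>1 - w* w\<close> singular, and there the natural power \<open>0 ^ 0 = 1\<close> differs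
    from \<open>det_powr\<close> when \<open>CARD('m) = CARD('q)\<close>.\<close>
  have ae: "AE w in lborel. c0 * dens w = ennreal (gd w)"
    using AE_matrix_ball_nonsingular[where ?'q = 'q]
  proof (rule AE_mp, intro AE_I2 impI)
    fix w :: "complex^'q^'q" assume w: "w \<in> ?B \<longrightarrow> det (mat 1 - ct w ** w) \<noteq> 0"
    have n: "real CARD('m) - real CARD('q) = real ?n" using mq by simp
    show "c0 * dens w = ennreal (gd w)"
    proof (cases "w \<in> ?B")
      case True
      then have det: "det (mat 1 - ct w ** w) \<noteq> 0" using w by blast
      then have "mat 1 - ct w ** w \<in> pos_def"
        using True by (simp add: pos_def_def matrix_ball_def)
      then have "dens w = ennreal (cmod (det (mat 1 - ct w ** w)) ^ ?n)"
        unfolding dens_def n det_powr_nat[OF det] by simp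
      then show ?thesis using True c(2) by (simp add: c(1) gd_def ennreal_mult del: ennreal_power)
    next
      case False
      then have "mat 1 - ct w ** w \<notin> pos_def"
        by (simp add: pos_def_def matrix_ball_def)
      then show ?thesis using False by (simp add: dens_def gd_def)
    qed
  qed
  define Q where "Q = density lborel (\<lambda>w. ennreal (gd w))"
  have Q: "(\<integral>\<^sup>+k. f (corner (upper k)) \<partial>\<mu>) = (\<integral>\<^sup>+w. f w \<partial>Q)" if [measurable]: "f \<in> borel_measurable borel" for f
  proof -
    have "(\<integral>\<^sup>+w. f w \<partial>Q) = (\<integral>\<^sup>+w. ennreal (gd w) * f w \<partial>lborel)"
      unfolding Q_def by (rule nn_integral_density) measurable
    also have "\<dots> = (\<integral>\<^sup>+w. c0 * (f w * dens w) \<partial>lborel)"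
      by (rule nn_integral_cong_AE, rule AE_mp[OF ae]) (intro AE_I2 impI, metis mult.assoc mult.commute)
    also have "\<dots> = c0 * (\<integral>\<^sup>+w. f w * dens w \<partial>lborel)"
      by (rule nn_integral_cmult) measurable
    finally show ?thesis using c0[of f] by simp
  qed
  have setsQ [measurable_cong]: "sets Q = sets borel" by (simp add: Q_def)
  have "emeasure Q (space Q) = 1"
    using Q[of "\<lambda>_. 1"] one by simp
  then interpret q: finite_measure Q by (intro finite_measureI) simp
  interpret qn: pair_sigma_finite Q \<nu> ..
  have qnm: "(\<lambda>p. p) \<in> borel_measurable (Q \<Otimes>\<^sub>M \<nu>)"
  proof -
    have "(\<lambda>p. fst p) \<in> borel_measurable (Q \<Otimes>\<^sub>M \<nu>)" "(\<lambda>p. snd p) \<in> borel_measurable (Q \<Otimes>\<^sub>M \<nu>)"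
      using measurable_compose[OF measurable_snd idm(2)] by (auto simp: measurable_cong_sets[OF refl setsQ[symmetric]])
    then have "(\<lambda>p. (fst p, snd p)) \<in> borel_measurable (Q \<Otimes>\<^sub>M \<nu>)"
      unfolding borel_prod[symmetric] by (rule measurable_Pair)
    then show ?thesis by simp
  qed
  define h where "h k = (corner (upper k), corner k)" for k :: "complex^(('m + 'q) + 'q)^(('m + 'q) + 'q)"
  have hm: "h \<in> borel_measurable \<mu>"
    unfolding h_def borel_prod[symmetric] by measurable
  have joint: "(\<integral>\<^sup>+k. F (h k) \<partial>\<mu>) = (\<integral>\<^sup>+w. (\<integral>\<^sup>+v. F (w, v) \<partial>\<nu>) \<partial>Q)"
    if F [measurable]: "F \<in> borel_measurable borel" for F
  proof -
    have "F \<in> borel_measurable (borel \<Otimes>\<^sub>M borel)" unfolding borel_prod by (rule F)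
    then have F2: "(\<lambda>x. F (a x, b x)) \<in> borel_measurable N"
      if "a \<in> borel_measurable N" "b \<in> borel_measurable N" for a b and N :: "'z measure"
      using that by measurable
    have Fh: "(\<lambda>k. F (h k)) \<in> borel_measurable borel"
      unfolding h_def by (intro F2) measurable
    have "(\<integral>\<^sup>+k. F (h k) \<partial>\<mu>) = (\<integral>\<^sup>+v. (\<integral>\<^sup>+k. F (h k) \<partial>\<mu>) \<partial>\<nu>)" by (simp add: one)
    also have "\<dots> = (\<integral>\<^sup>+v. (\<integral>\<^sup>+k. F (corner (upper k), v ** corner k) \<partial>\<mu>) \<partial>\<nu>)"
    proof (rule nn_integral_cong)
      fix v assume "v \<in> space \<nu>"
      then have v: "block_diag (mat 1) v \<in> (K_tilde :: (complex^(('m + 'q) + 'q)^(('m + 'q) + 'q)) set)"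
        by (simp add: sp K_tildeI)
      have "(\<integral>\<^sup>+k. F (h (block_diag (mat 1) v ** k)) \<partial>\<mu>) = (\<integral>\<^sup>+k. F (h k) \<partial>\<mu>)"
        by (rule haar_nn_integral_left[OF \<mu> K_tilde_mult v Fh])
      moreover have "h (block_diag (mat 1) v ** k) = (corner (upper k), v ** corner k)" if "k \<in> space \<mu>" for k
      proof -
        have "k = block_diag (upper k) (corner k)" using that by (intro K_tilde_cases) (simp add: sp)
        then have "h (block_diag (mat 1) v ** k) = h (block_diag (mat 1) v ** block_diag (upper k) (corner k))" by simp
        then show ?thesis by (simp only: h_def block_diag_mult corner_block_diag matrix_mul_lid)
      qed
      ultimately show "(\<integral>\<^sup>+k. F (h k) \<partial>\<mu>) = (\<integral>\<^sup>+k. F (corner (upper k), v ** corner k) \<partial>\<mu>)"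
        by (simp cong: nn_integral_cong)
    qed
    also have "\<dots> = (\<integral>\<^sup>+k. (\<integral>\<^sup>+v. F (corner (upper k), v ** corner k) \<partial>\<nu>) \<partial>\<mu>)"
    proof (rule mn.Fubini')
      show "(\<lambda>(k, v). F (corner (upper k), v ** corner k)) \<in> borel_measurable (\<mu> \<Otimes>\<^sub>M \<nu>)"
        unfolding case_prod_beta' by (intro F2) measurable
    qed
    also have "\<dots> = (\<integral>\<^sup>+k. (\<integral>\<^sup>+v. F (corner (upper k), v) \<partial>\<nu>) \<partial>\<mu>)"
    proof (rule nn_integral_cong)
      fix k assume "k \<in> space \<mu>"
      then have k: "corner k \<in> special_unitary_group" using K_tilde_cases(3) by (simp add: sp)
      show "(\<integral>\<^sup>+v. F (corner (upper k), v ** corner k) \<partial>\<nu>) = (\<integral>\<^sup>+v. F (corner (upper k), v) \<partial>\<nu>)"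
        by (rule haar_nn_integral_right[OF \<nu> special_unitary_mult special_unitary_ct k, where F = "\<lambda>v. F (corner (upper k), v)"])
          (auto intro: F2)
    qed
    also have "\<dots> = (\<integral>\<^sup>+w. (\<integral>\<^sup>+v. F (w, v) \<partial>\<nu>) \<partial>Q)"
    proof (rule Q)
      have "(\<lambda>(w, v). F (w, v)) \<in> borel_measurable (borel \<Otimes>\<^sub>M \<nu>)"
        unfolding case_prod_beta' by (intro F2 measurable_fst measurable_compose[OF measurable_snd idm(2)])
      then show "(\<lambda>w. \<integral>\<^sup>+v. F (w, v) \<partial>\<nu>) \<in> borel_measurable borel"
        by (rule n.borel_measurable_nn_integral)
    qed
    finally show ?thesis .
  qed
  \<comment> \<open>An equality of image measures carries the identity from nonnegative to complex
    integrands.\<close>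
  have distr_eq: "distr \<mu> borel h = distr (Q \<Otimes>\<^sub>M \<nu>) borel (\<lambda>p. p)"
  proof (rule measure_eqI)
    fix A assume "A \<in> sets (distr \<mu> borel h)"
    then have A: "A \<in> sets borel" by simp
    have "emeasure (distr \<mu> borel h) A = (\<integral>\<^sup>+k. indicator A (h k) \<partial>\<mu>)"
      using A hm by (subst nn_integral_indicator[symmetric], simp, subst nn_integral_distr) auto
    also have "\<dots> = (\<integral>\<^sup>+w. (\<integral>\<^sup>+v. indicator A (w, v) \<partial>\<nu>) \<partial>Q)"
      by (rule joint) (use A in measurable)
    also have "\<dots> = (\<integral>\<^sup>+p. indicator A p \<partial>(Q \<Otimes>\<^sub>M \<nu>))"
      using measurable_compose[OF qnm borel_measurable_indicator[OF A]] by (rule n.nn_integral_fst)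
    also have "\<dots> = emeasure (distr (Q \<Otimes>\<^sub>M \<nu>) borel (\<lambda>p. p)) A"
      using A qnm by (subst nn_integral_indicator[symmetric], simp, subst nn_integral_distr) auto
    finally show "emeasure (distr \<mu> borel h) A = emeasure (distr (Q \<Otimes>\<^sub>M \<nu>) borel (\<lambda>p. p)) A" .
  qed simp
  show ?thesis
  proof (intro exI[of _ c] allI impI)
    fix F :: "(complex^'q^'q) \<times> (complex^'q^'q) \<Rightarrow> complex"
    assume F: "continuous_on (?B \<times> ?SU) F"
    \<comment> \<open>\<open>F\<close> is controlled on the compact product only; extension by zero
      makes it bounded and Borel on the whole space.\<close>
    define F' where "F' = (\<lambda>p. indicator (?B \<times> ?SU) p *\<^sub>R F p)"
    have "?B = corner ` (unitary_group :: (complex^('m + 'q)^('m + 'q)) set)"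
      by (rule corner_unitary_image[OF mq, symmetric])
    also have "compact \<dots>" by (intro compact_continuous_image compact_unitary continuous_intros)
    finally have comp: "compact (?B \<times> ?SU)" by (intro compact_Times compact_special_unitary)
    have F'm: "F' \<in> borel_measurable borel"
      unfolding F'_def using comp F by (intro borel_measurable_continuous_on_indicator) (auto intro: borel_compact)
    have "bounded (F ` (?B \<times> ?SU))"
      using comp F by (intro compact_imp_bounded compact_continuous_image)
    then obtain b where b: "\<And>p. p \<in> ?B \<times> ?SU \<Longrightarrow> norm (F p) \<le> b"
      by (auto simp: bounded_iff)
    have F'b: "norm (F' p) \<le> max b 0" for p
      using b[of p] by (auto simp: F'_def indicator_def)
    have F'qn: "F' \<in> borel_measurable (Q \<Otimes>\<^sub>M \<nu>)"
      using measurable_compose[OF qnm F'm] by simp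
    interpret fqn: finite_measure "Q \<Otimes>\<^sub>M \<nu>"
      by (rule finite_measure_pair_measure) unfold_locales
    have int: "integrable (Q \<Otimes>\<^sub>M \<nu>) F'"
      by (rule fqn.integrable_const_bound[where B = "max b 0"]) (use F'b F'qn in auto)
    have "(LINT k|\<mu>. F (corner (upper k), corner k)) = (LINT k|\<mu>. F' (h k))"
    proof (rule Bochner_Integration.integral_cong)
      fix k assume "k \<in> space \<mu>"
      then have "k \<in> K_tilde" by (simp add: sp)
      then have "h k \<in> ?B \<times> ?SU"
        using K_tilde_cases[of k] corner_unitary_image[OF mq] by (auto simp: h_def)
      then show "F (corner (upper k), corner k) = F' (h k)" by (simp add: F'_def h_def)
    qed simp
    also have "\<dots> = (LINT p|distr \<mu> borel h. F' p)"
      using hm F'm by (intro integral_distr[symmetric]) auto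
    also have "\<dots> = (LINT p|(Q \<Otimes>\<^sub>M \<nu>). F' p)"
      unfolding distr_eq using qnm F'm by (intro integral_distr) auto
    also have "\<dots> = (LINT w|Q. (LINT v|\<nu>. F' (w, v)))"
      by (rule qn.integral_fst'[OF int, symmetric])
    also have "\<dots> = (LINT w|lborel. gd w *\<^sub>R (LINT v|\<nu>. F' (w, v)))"
      unfolding Q_def
    proof (rule integral_density)
      have "(\<lambda>w. LINT v|\<nu>. F' (w, v)) \<in> borel_measurable Q"
        by (rule n.borel_measurable_lebesgue_integral) (use F'qn in simp)
      then show "(\<lambda>w. LINT v|\<nu>. F' (w, v)) \<in> borel_measurable lborel"
        by (simp add: measurable_cong_sets[OF setsQ refl])
    qed (auto simp: gd_nonneg)
    also have "\<dots> = (LINT w|lborel. of_real c * (indicator ?B w *\<^sub>R ((LINT v|\<nu>. F (w, v)) * det (mat 1 - ct w ** w) ^ ?n)))"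
    proof (rule Bochner_Integration.integral_cong)
      fix w :: "complex^'q^'q"
      show "gd w *\<^sub>R (LINT v|\<nu>. F' (w, v)) = of_real c * (indicator ?B w *\<^sub>R ((LINT v|\<nu>. F (w, v)) * det (mat 1 - ct w ** w) ^ ?n))"
      proof (cases "w \<in> ?B")
        case True
        have "(LINT v|\<nu>. F' (w, v)) = (LINT v|\<nu>. F (w, v))"
          by (rule Bochner_Integration.integral_cong) (auto simp: F'_def True sp)
        moreover have "det (mat 1 - ct w ** w) = of_real (cmod (det (mat 1 - ct w ** w)))"
          using True by (intro det_pos_semidef) (simp add: matrix_ball_def)
        then have "det (mat 1 - ct w ** w) ^ ?n = of_real (cmod (det (mat 1 - ct w ** w)) ^ ?n)"
          by (metis of_real_power)
        ultimately show ?thesis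
          using True by (simp add: gd_def scaleR_conv_of_real mult_ac del: of_real_power)
      qed (simp add: gd_def)
    qed simp
    also have "\<dots> = of_real c * (LINT w:?B|lborel. (LINT v|\<nu>. F (w, v)) * det (mat 1 - ct w ** w) ^ ?n)"
      unfolding set_lebesgue_integral_def by (rule integral_mult_right_zero)
    finally show "(LINT k|\<mu>. F (corner (upper k), corner k)) =
      of_real c * (LINT w:?B|lborel. (LINT v|\<nu>. F (w, v)) * det (mat 1 - ct w ** w) ^ ?n)" .
  qed
qed

text \<open>The function arg is rendered by \<open>sgn\<close>. Its value at 0 never enters: on the
  domain of integration \<open>D\<close> is, up to a phase, a corner of a pseudo-unitary matrix, so
  its singular values are at least 1.\<close>

theorem proposition2p2:
  fixes p q :: nat
    and \<phi> :: "complex^(('m::finite + 'q::{finite,linorder}) + 'q)^(('m + 'q) + 'q) \<Rightarrow> complex"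
    and \<mu> :: "(complex^(('m + 'q) + 'q)^(('m + 'q) + 'q)) measure"
    and \<nu> :: "(complex^'q::{finite,linorder}^'q::{finite,linorder}) measure"
  assumes "q = CARD('q)" and "p = CARD('m + 'q)"
    and "q \<ge> 1" and "p \<ge> 2 * q"
    and "normalized_haar_measure K_tilde \<mu>"
    and "normalized_haar_measure special_unitary_group \<nu>"
    and "spherical_function pseudo_unitary_group K_tilde \<mu> \<phi>"
  shows "\<forall>s\<in>chamber. \<forall>t\<in>chamber. \<forall>z1\<in>sphere 0 1. \<forall>z2\<in>sphere 0 1.
    \<phi> (coset_rep t z1) * \<phi> (coset_rep s z2) =
      1 / kappa TYPE('q) p *
      (LINT w:matrix_ball|lborel. (LINT v|\<nu>.
        (let D = sinh_diag t ** w ** sinh_diag s + cosh_diag t ** v ** cosh_diag s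
         in \<phi> (coset_rep (arcosh_vec (sigma_sing D)) (z1 * z2 * sgn (det D)))) *
        det (mat 1 - conj_transpose w ** w) ^ (p - 2 * q)))"
proof (intro ballI)
  fix s t :: "real^'q::{finite,linorder}" and z1 z2 :: complex
  assume "s \<in> chamber" "t \<in> chamber" and z: "z1 \<in> sphere 0 1" "z2 \<in> sphere 0 1"
  let ?G = "pseudo_unitary_group :: (complex^(('m + 'q) + 'q)^(('m + 'q) + 'q)) set"
  let ?K = "K_tilde :: (complex^(('m + 'q) + 'q)^(('m + 'q) + 'q)) set"
  have mq: "CARD('q) \<le> CARD('m)" and n: "p - 2 * q = CARD('m) - CARD('q)"
    using assms(1,2,4) by auto
  note \<mu> = assms(5) and \<nu> = assms(6)
  have cont: "continuous_on ?G \<phi>"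
    and bi: "\<And>g k k'. g \<in> ?G \<Longrightarrow> k \<in> ?K \<Longrightarrow> k' \<in> ?K \<Longrightarrow> \<phi> (k ** g ** k') = \<phi> g"
    and prod: "\<And>g h. g \<in> ?G \<Longrightarrow> h \<in> ?G \<Longrightarrow> \<phi> g * \<phi> h = (LINT k|\<mu>. \<phi> (g ** k ** h))"
    using assms(7) by (auto simp: spherical_function_def)
  obtain c where "\<forall>F. continuous_on (matrix_ball \<times> special_unitary_group) F \<longrightarrow>
    (LINT k|\<mu>. F (corner (upper k), corner k)) =
      of_real c * (LINT w:matrix_ball|lborel. (LINT v|\<nu>. F (w, v)) * det (mat 1 - ct w ** w) ^ (CARD('m) - CARD('q)))"
    using joint_corner_law[OF \<mu> \<nu> mq] by (rule exE)
  note c = this[rule_format]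
  have one: "measure \<mu> (space \<mu>) = 1" "measure \<nu> (space \<nu>) = 1"
    using \<mu> \<nu> haar_space[OF \<mu>] haar_space[OF \<nu>] by (auto simp: normalized_haar_measure_def measure_def)
  \<comment> \<open>For \<open>F = 1\<close> one side is the total mass 1 and the other is
    \<open>c\<close> times \<open>kappa\<close>, which fixes the constant.\<close>
  have "of_real c * kappa TYPE('q) p = 1"
    using c[of "\<lambda>_. 1"] n one by (simp add: kappa_def assms(1))
  then have kappa: "1 / kappa TYPE('q) p = of_real c"
    by (metis nonzero_eq_divide_eq mult_zero_right zero_neq_one)
  define D where "D = (\<lambda>p. sinh_diag t ** fst p ** sinh_diag s + cosh_diag t ** snd p ** cosh_diag s)"
  define F where "F = (\<lambda>p. \<phi> (coset_rep (arcosh_vec (sigma_sing (D p))) (z1 * z2 * sgn (det (D p)))))"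
  define a b :: "complex^(('m + 'q) + 'q)^(('m + 'q) + 'q)" where "a = coset_rep t z1" and "b = coset_rep s z2"
  have ab: "a \<in> ?G" "b \<in> ?G" unfolding a_def b_def by (rule coset_rep_in_group)+
  \<comment> \<open>The product of the two branches is a root of \<open>z1 * z2\<close>, but it need
    not be \<open>root_branch\<close> of that product; only its power of order
    \<open>CARD('q)\<close> matters.\<close>
  define \<rho> where "\<rho> = root_branch CARD('q) z1 * root_branch CARD('q) z2"
  have \<rho>: "cmod \<rho> = 1" "\<rho> ^ CARD('q) = z1 * z2"
    using z by (simp_all add: \<rho>_def norm_mult power_mult_distrib root_branch_power)
  define k0 :: "complex^(('m + 'q) + 'q)^(('m + 'q) + 'q)" where "k0 = block_diag (block_diag (mat 1) (mat \<rho>)) (mat 1)"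
  have "block_diag (mat 1) (mat \<rho>) \<in> (unitary_group :: (complex^('m + 'q)^('m + 'q)) set)"
    using unitary_mat[OF \<rho>(1)] ct_mat[of 1]
    by (simp add: unitary_iff block_diag_eq ct_block_matrix block_matrix_mult block_matrix_1 del: ct_mat)
  then have k0: "k0 \<in> ?K" unfolding k0_def by (intro K_tildeI special_unitary_1)
  have KG: "k \<in> ?G" if "k \<in> ?K" for k using that K_tilde_subset by blast
  have aKb: "a ** k ** b \<in> ?G" if "k \<in> ?K" for k
    using that by (intro pseudo_unitary_mult ab KG)
  have key: "\<phi> (a ** (k0 ** k) ** b) = F (corner (upper k), corner k)" if k: "k \<in> ?K" for k
  proof -
    have "corner (a ** (k0 ** k) ** b) = mat \<rho> ** D (corner (upper k), corner k)"
      unfolding a_def b_def k0_def \<rho>_def D_def fst_conv snd_conv by (rule corner_product[OF k])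
    then have "\<phi> (a ** (k0 ** k) ** b) = \<phi> (coset_rep (arcosh_vec (sigma_sing (D (corner (upper k), corner k))))
        (\<rho> ^ CARD('q) * sgn (det (D (corner (upper k), corner k)))))"
      by (intro biinvariant_coset_rep[where \<phi> = \<phi> and \<rho> = \<rho>] bi aKb K_tilde_mult k0 k \<rho>(1))
    then show ?thesis by (simp add: F_def \<rho>(2))
  qed
  define h where "h k = (corner (upper k), corner k)" for k :: "complex^(('m + 'q) + 'q)^(('m + 'q) + 'q)"
  have hK: "h ` ?K = matrix_ball \<times> special_unitary_group"
  proof (intro equalityI subsetI)
    fix p assume "p \<in> h ` ?K"
    then show "p \<in> matrix_ball \<times> special_unitary_group"
      using K_tilde_cases corner_unitary_image[OF mq] by (auto simp: h_def)
  next
    fix p :: "((complex, 'q) vec, 'q) vec \<times> ((complex, 'q) vec, 'q) vec"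
    assume p: "p \<in> matrix_ball \<times> special_unitary_group"
    then have "fst p \<in> corner ` (unitary_group :: (complex^('m + 'q)^('m + 'q)) set)"
      by (simp only: corner_unitary_image[OF mq] mem_Times_iff)
    then obtain u :: "complex^('m + 'q)^('m + 'q)" where u: "u \<in> unitary_group" "fst p = corner u"
      by blast
    then have "block_diag u (snd p) \<in> ?K" "h (block_diag u (snd p)) = p"
      using p by (auto simp: K_tildeI h_def prod_eq_iff)
    then show "p \<in> h ` ?K" by (intro image_eqI[of _ _ "block_diag u (snd p)"]) simp_all
  qed
  \<comment> \<open>\<open>coset_rep\<close> involves a discontinuous branch in its second
    parameter, so continuity is established on the group, where the function equals
    \<open>\<phi> (a ** (k0 ** k) ** b)\<close>.\<close>
  have F: "continuous_on (matrix_ball \<times> special_unitary_group) F"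
    unfolding hK[symmetric]
  proof (rule continuous_on_quotient[OF compact_K_tilde])
    show "continuous_on ?K h"
      unfolding h_def by (intro continuous_intros)
    have "continuous_on ?K (\<lambda>k. \<phi> (a ** (k0 ** k) ** b))"
      by (rule continuous_on_compose2[OF cont]) (auto intro!: continuous_intros aKb K_tilde_mult k0)
    then show "continuous_on ?K (\<lambda>k. F (h k))"
      by (rule continuous_on_eq) (simp add: key h_def)
  qed
  have "\<phi> a * \<phi> b = (LINT k|\<mu>. \<phi> (a ** k ** b))" by (rule prod[OF ab])
  \<comment> \<open>Left invariance inserts the rotation \<open>k0\<close>, after which the
    integrand depends only on the two corners of \<open>k\<close>.\<close>
  also have "\<dots> = (LINT k|distr \<mu> \<mu> (\<lambda>k. k0 ** k). \<phi> (a ** k ** b))"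
    using \<mu> k0 by (simp add: normalized_haar_measure_def)
  also have "\<dots> = (LINT k|\<mu>. \<phi> (a ** (k0 ** k) ** b))"
  proof (rule integral_distr)
    show "(\<lambda>k. k0 ** k) \<in> measurable \<mu> \<mu>"
      by (rule haar_mult_measurable[OF \<mu> K_tilde_mult k0])
    have "continuous_on ?K (\<lambda>k. \<phi> (a ** k ** b))"
      by (rule continuous_on_compose2[OF cont]) (auto intro!: continuous_intros aKb)
    then have "(\<lambda>k. \<phi> (a ** k ** b)) \<in> borel_measurable (restrict_space borel ?K)"
      by (rule borel_measurable_continuous_on_restrict)
    then show "(\<lambda>k. \<phi> (a ** k ** b)) \<in> borel_measurable \<mu>"
      using \<mu> by (simp add: normalized_haar_measure_def cong: measurable_cong_sets)
  qed
  also have "\<dots> = (LINT k|\<mu>. F (corner (upper k), corner k))"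
    by (rule Bochner_Integration.integral_cong) (simp_all add: key haar_space[OF \<mu>])
  also have "\<dots> = of_real c * (LINT w:matrix_ball|lborel. (LINT v|\<nu>. F (w, v)) * det (mat 1 - ct w ** w) ^ (p - 2 * q))"
    unfolding n by (rule c[OF F])
  \<comment> \<open>The density does not depend on \<open>v\<close>, so it may be moved into the
    inner integral.\<close>
  finally show "\<phi> (coset_rep t z1) * \<phi> (coset_rep s z2) =
      1 / kappa TYPE('q) p *
      (LINT w:matrix_ball|lborel. (LINT v|\<nu>.
        (let D = sinh_diag t ** w ** sinh_diag s + cosh_diag t ** v ** cosh_diag s
         in \<phi> (coset_rep (arcosh_vec (sigma_sing D)) (z1 * z2 * sgn (det D)))) *
        det (mat 1 - conj_transpose w ** w) ^ (p - 2 * q)))"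
    by (simp add: kappa a_def b_def F_def D_def Let_def)
qed

end
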